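(* Let $z_\sigma\in P_\sigma$ solve $$A(v_\sigma,z_\sigma)=\int_I\langle g,v_\sigma\rangle\,dt+(v_\sigma(T),z_T)\quad\forall v_\sigma\in Y_\sigma$$ for given $g\in L^2(I;H^{-1}(\Omega))$ and $z_T\in L^2(\Omega)$. Then there exists a constant $C>0$, independent of $\sigma=(\tau,h)$, such that $$\|\nabla\partial_t(-\Delta_h)^{-1}z_\sigma\|_{L^2(I;L^2(\Omega))}+\|z_\sigma\|_{C(\bar I;L^2(\Omega))}\le C\big(\|g\|_{L^2(I;H^{-1}(\Omega))}+\|z_T\|_{L^2(\Omega)}\big),$$ where $-\Delta_h:V_h\to V_h$ is defined by $(-\Delta_hv_h,w_h)=(\nabla v_h,\nabla w_h)$ for all $w_h\in V_h$.
   Context: $\Omega\subset\mathbb{R}^d$ ($d=2,3$) is a convex polyhedron; $T>0$, $I=(0,T)$; $(\cdot,\cdot)$ is the $L^2(\Omega)$ inner product and $\langle\cdot,\cdot\rangle$ the $H^{-1}(\Omega)$–$H_0^1(\Omega)$ pairing. Discretization: $\{\mathcal{T}_h\}_{h>0}$ is a family of quasi-uniform, shape regular triangulations of $\Omega$ with mesh parameter $h$; $V_h=\{v_h\in H_0^1(\Omega): v_h|_K\in P_1(K)\ \forall K\in\mathcal{T}_h\}$. Time grid $0=t_0<t_1<\dots<t_M=T$, $I_m=(t_{m-1},t_m]$ for $m<M$, $I_M=(t_{M-1},t_M)$, $\tau=\max_m(t_m-t_{m-1})$. With $\mathcal{P}_i(I_m;V_h)$ the $V_h$-valued polynomials in $t$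 of degree at most $i$ on $I_m$, $$P_\sigma=\{v\in C(\bar I;H_0^1(\Omega)): v|_{I_m}\in\mathcal{P}_1(I_m;V_h),\ 1\le m\le M\},$$ $$Y_\sigma=\{v\in L^2(I;H_0^1(\Omega)): v|_{I_m}\in\mathcal{P}_0(I_m;V_h),\ 1\le m\le M,\ v(T)\in V_h\},$$ where the value $v(T)$ is an additional independent degree of freedom. The bilinear form is $$A(u,v)=-\int_I\langle u,\partial_tv\rangle dt+\int_I(\nabla u,\nabla v)dt+(u(T),v(T)).$$ *)

theory Defs
  imports "HOL-Analysis.Analysis"
begin

section \<open>Lebesgue and Sobolev spaces on a domain\<close>

text \<open>
  Elements of Lebesgue and Sobolev spaces are represented by functions on the whole space
  \<^typ>\<open>'a\<close>. Only their values on \<open>\<Omega>\<close> matter, and functions that agree almost everywhere on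
  \<open>\<Omega>\<close> represent the same element; all inner products and norms below respect this.
\<close>

definition L2 :: "'a::euclidean_space set \<Rightarrow> ('a \<Rightarrow> 'b::euclidean_space) set" where
  "L2 \<Omega> = {u. u \<in> borel_measurable (lebesgue_on \<Omega>) \<and>
              integrable (lebesgue_on \<Omega>) (\<lambda>x. (norm (u x))\<^sup>2)}"

definition L2_ip ::
  "'a::euclidean_space set \<Rightarrow> ('a \<Rightarrow> 'b::euclidean_space) \<Rightarrow> ('a \<Rightarrow> 'b) \<Rightarrow> real" where
  "L2_ip \<Omega> u v = (\<integral>x. u x \<bullet> v x \<partial>lebesgue_on \<Omega>)"

definition L2_nrm :: "'a::euclidean_space set \<Rightarrow> ('a \<Rightarrow> 'b::euclidean_space) \<Rightarrow> real" where
  "L2_nrm \<Omega> u = sqrt (L2_ip \<Omega> u u)"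

definition partial_deriv :: "'a::euclidean_space \<Rightarrow> ('a \<Rightarrow> real) \<Rightarrow> 'a \<Rightarrow> real" where
  "partial_deriv i f x = frechet_derivative f (at x) i"

fun C_k :: "nat \<Rightarrow> ('a::euclidean_space \<Rightarrow> real) \<Rightarrow> bool" where
  "C_k 0 f \<longleftrightarrow> continuous_on UNIV f"
| "C_k (Suc k) f \<longleftrightarrow>
     (\<forall>x. f differentiable (at x)) \<and> (\<forall>i\<in>Basis. C_k k (partial_deriv i f))"

definition test_functions :: "'a::euclidean_space set \<Rightarrow> ('a \<Rightarrow> real) set" where
  "test_functions \<Omega> =
     {\<phi>. (\<forall>k. C_k k \<phi>) \<and> (\<exists>S. compact S \<and> S \<subseteq> \<Omega> \<and> (\<forall>x. x \<notin> S \<longrightarrow> \<phi> x = 0))}"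

definition is_weak_gradient ::
  "'a::euclidean_space set \<Rightarrow> ('a \<Rightarrow> real) \<Rightarrow> ('a \<Rightarrow> 'a) \<Rightarrow> bool" where
  "is_weak_gradient \<Omega> u G \<longleftrightarrow>
     (\<forall>\<phi>\<in>test_functions \<Omega>. \<forall>i\<in>Basis.
        (\<integral>x. u x * partial_deriv i \<phi> x \<partial>lebesgue_on \<Omega>)
          = - (\<integral>x. (G x \<bullet> i) * \<phi> x \<partial>lebesgue_on \<Omega>))"

definition H1 :: "'a::euclidean_space set \<Rightarrow> ('a \<Rightarrow> real) set" where
  "H1 \<Omega> = {u \<in> L2 \<Omega>. \<exists>G\<in>L2 \<Omega>. is_weak_gradient \<Omega> u G}"

text \<open>The weak gradient is unique almost everywhere, so the choice does not matter.\<close>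

definition grad :: "'a::euclidean_space set \<Rightarrow> ('a \<Rightarrow> real) \<Rightarrow> 'a \<Rightarrow> 'a" where
  "grad \<Omega> u = (SOME G. G \<in> L2 \<Omega> \<and> is_weak_gradient \<Omega> u G)"

definition H1_nrm :: "'a::euclidean_space set \<Rightarrow> ('a \<Rightarrow> real) \<Rightarrow> real" where
  "H1_nrm \<Omega> u = sqrt ((L2_nrm \<Omega> u)\<^sup>2 + (L2_nrm \<Omega> (grad \<Omega> u))\<^sup>2)"

text \<open>\<open>H\<^sub>0\<^sup>1(\<Omega>)\<close> is the closure of the test functions in \<open>H\<^sup>1(\<Omega>)\<close>, normed by
  \<open>\<parallel>\<nabla>u\<parallel>\<close>, as is usual on a bounded domain.\<close>

definition H10 :: "'a::euclidean_space set \<Rightarrow> ('a \<Rightarrow> real) set" where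
  "H10 \<Omega> = {u \<in> H1 \<Omega>. \<forall>\<epsilon>>0. \<exists>\<phi>\<in>test_functions \<Omega>. H1_nrm \<Omega> (\<lambda>x. u x - \<phi> x) < \<epsilon>}"

definition H10_nrm :: "'a::euclidean_space set \<Rightarrow> ('a \<Rightarrow> real) \<Rightarrow> real" where
  "H10_nrm \<Omega> u = L2_nrm \<Omega> (grad \<Omega> u)"

text \<open>
  An element \<open>F\<close> of \<open>H\<^sup>-\<^sup>1(\<Omega>)\<close> is a bounded linear functional on \<open>H\<^sub>0\<^sup>1(\<Omega>)\<close>, so the duality
  pairing of \<open>F\<close> and \<open>\<phi>\<close> is \<open>F \<phi>\<close>. The values of \<open>F\<close> outside \<open>H\<^sub>0\<^sup>1(\<Omega>)\<close> are irrelevant. Boundedness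
  makes \<open>F\<close> invariant under changes of \<open>\<phi>\<close> on null sets.
\<close>

definition Hm1 :: "'a::euclidean_space set \<Rightarrow> (('a \<Rightarrow> real) \<Rightarrow> real) set" where
  "Hm1 \<Omega> = {F. (\<forall>u\<in>H10 \<Omega>. \<forall>v\<in>H10 \<Omega>. F (\<lambda>x. u x + v x) = F u + F v) \<and>
                (\<forall>c. \<forall>u\<in>H10 \<Omega>. F (\<lambda>x. c * u x) = c * F u) \<and>
                (\<exists>B. \<forall>u\<in>H10 \<Omega>. \<bar>F u\<bar> \<le> B * H10_nrm \<Omega> u)}"

definition Hm1_nrm :: "'a::euclidean_space set \<Rightarrow> (('a \<Rightarrow> real) \<Rightarrow> real) \<Rightarrow> real" where
  "Hm1_nrm \<Omega> F = (SUP u\<in>{u \<in> H10 \<Omega>. H10_nrm \<Omega> u \<le> 1}. \<bar>F u\<bar>)"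

text \<open>The embedding of \<open>L\<^sup>2(\<Omega>)\<close> into \<open>H\<^sup>-\<^sup>1(\<Omega>)\<close> of the Gelfand triple.\<close>

definition L2_to_Hm1 ::
  "'a::euclidean_space set \<Rightarrow> ('a \<Rightarrow> real) \<Rightarrow> ('a \<Rightarrow> real) \<Rightarrow> real" where
  "L2_to_Hm1 \<Omega> f = (\<lambda>\<phi>. L2_ip \<Omega> f \<phi>)"


section \<open>Functions of time\<close>

text \<open>
  \<open>L\<^sup>2(J;X)\<close> for a space \<open>X\<close> of real-valued functions (or functionals) with norm \<open>nrm\<close>: the
  square-integrable functions that are strongly measurable, i.e. almost everywhere limits of
  simple functions.
\<close>

definition strongly_measurable ::
  "real set \<Rightarrow> ('c \<Rightarrow> real) set \<Rightarrow> (('c \<Rightarrow> real) \<Rightarrow> real) \<Rightarrow> (real \<Rightarrow> 'c \<Rightarrow> real) \<Rightarrow> bool" where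
  "strongly_measurable J X nrm v \<longleftrightarrow>
     (\<exists>s. (\<forall>n::nat. simple_function (lebesgue_on J) (s n) \<and> (\<forall>t\<in>J. s n t \<in> X)) \<and>
          (AE t in lebesgue_on J. (\<lambda>n. nrm (\<lambda>x. v t x - s n t x)) \<longlonglongrightarrow> 0))"

definition L2_time ::
  "real set \<Rightarrow> ('c \<Rightarrow> real) set \<Rightarrow> (('c \<Rightarrow> real) \<Rightarrow> real) \<Rightarrow> (real \<Rightarrow> 'c \<Rightarrow> real) set" where
  "L2_time J X nrm =
     {v. (\<forall>t\<in>J. v t \<in> X) \<and> strongly_measurable J X nrm v \<and>
         integrable (lebesgue_on J) (\<lambda>t. (nrm (v t))\<^sup>2)}"

definition L2_time_nrm :: "real set \<Rightarrow> ('x \<Rightarrow> real) \<Rightarrow> (real \<Rightarrow> 'x) \<Rightarrow> real" where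
  "L2_time_nrm J nrm v = sqrt (\<integral>t. (nrm (v t))\<^sup>2 \<partial>lebesgue_on J)"

definition C_time ::
  "real set \<Rightarrow> ('c \<Rightarrow> real) set \<Rightarrow> (('c \<Rightarrow> real) \<Rightarrow> real) \<Rightarrow> (real \<Rightarrow> 'c \<Rightarrow> real) set" where
  "C_time J X nrm =
     {v. (\<forall>t\<in>J. v t \<in> X) \<and>
         (\<forall>t\<in>J. ((\<lambda>s. nrm (\<lambda>x. v s x - v t x)) \<longlongrightarrow> 0) (at t within J))}"

definition C_time_nrm :: "real set \<Rightarrow> ('x \<Rightarrow> real) \<Rightarrow> (real \<Rightarrow> 'x) \<Rightarrow> real" where
  "C_time_nrm J nrm v = (SUP t\<in>J. nrm (v t))"

text \<open>
  The time derivative is only applied to continuous, piecewise polynomial functions of time with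
  values in the finite element space. For these the classical derivative exists
  outside the finitely many grid points and represents the weak derivative.
\<close>

definition time_deriv :: "(real \<Rightarrow> 'a \<Rightarrow> real) \<Rightarrow> real \<Rightarrow> 'a \<Rightarrow> real" where
  "time_deriv v t = (\<lambda>x. deriv (\<lambda>s. v s x) t)"


section \<open>Finite element discretization in space\<close>

definition convex_polyhedral_domain :: "'a::euclidean_space set \<Rightarrow> bool" where
  "convex_polyhedral_domain \<Omega> \<longleftrightarrow>
     open \<Omega> \<and> convex \<Omega> \<and> \<Omega> \<noteq> {} \<and> polytope (closure \<Omega>)"

text \<open>Cells are closed, nondegenerate simplices that meet in common faces.\<close>

definition triangulation_of :: "'a::euclidean_space set \<Rightarrow> 'a set set \<Rightarrow> bool" where
  "triangulation_of \<Omega> \<T> \<longleftrightarrow>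
     triangulation \<T> \<and> (\<forall>K\<in>\<T>. int DIM('a) simplex K) \<and> \<Union>\<T> = closure \<Omega>"

definition inball_diameter :: "'a::euclidean_space set \<Rightarrow> real" where
  "inball_diameter K = (SUP r\<in>{r. 0 \<le> r \<and> (\<exists>x. cball x r \<subseteq> K)}. 2 * r)"

text \<open>
  A family of triangulations indexed by its mesh parameter. A given domain need not have a
  triangulation for each \<open>h > 0\<close> (none exists if \<open>h\<close> exceeds the diameter of \<open>\<Omega>\<close>), hence
  the set \<open>H\<close> of admissible mesh parameters.
\<close>

definition mesh_family ::
  "'a::euclidean_space set \<Rightarrow> real set \<Rightarrow> (real \<Rightarrow> 'a set set) \<Rightarrow> bool" where
  "mesh_family \<Omega> H \<T> \<longleftrightarrow>
     H \<subseteq> {0<..} \<and> (\<forall>h\<in>H. triangulation_of \<Omega> (\<T> h) \<and> h = Max (diameter ` \<T> h))"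

definition shape_regular :: "real set \<Rightarrow> (real \<Rightarrow> 'a::euclidean_space set set) \<Rightarrow> bool" where
  "shape_regular H \<T> \<longleftrightarrow>
     (\<exists>\<kappa>>0. \<forall>h\<in>H. \<forall>K\<in>\<T> h. diameter K \<le> \<kappa> * inball_diameter K)"

definition quasi_uniform :: "real set \<Rightarrow> (real \<Rightarrow> 'a::euclidean_space set set) \<Rightarrow> bool" where
  "quasi_uniform H \<T> \<longleftrightarrow> (\<exists>c>0. \<forall>h\<in>H. \<forall>K\<in>\<T> h. c * h \<le> diameter K)"

definition P1_on :: "'a::euclidean_space set \<Rightarrow> ('a \<Rightarrow> real) \<Rightarrow> bool" where
  "P1_on K v \<longleftrightarrow> (\<exists>c b. \<forall>x\<in>K. v x = c + b \<bullet> x)"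

text \<open>
  A finite element function is represented by its continuous representative, extended by zero
  outside \<open>\<Omega>\<close>: the cells are closed, so neighbouring affine pieces agree on common faces. This makes
  the representative unique, so operators on \<open>V\<^sub>h\<close> can be defined on functions.
\<close>

definition V_h :: "'a::euclidean_space set \<Rightarrow> 'a set set \<Rightarrow> ('a \<Rightarrow> real) set" where
  "V_h \<Omega> \<T> = {v \<in> H10 \<Omega>. (\<forall>K\<in>\<T>. P1_on K v) \<and> (\<forall>x. x \<notin> \<Omega> \<longrightarrow> v x = 0)}"

definition neg_laplace_h ::
  "'a::euclidean_space set \<Rightarrow> 'a set set \<Rightarrow> ('a \<Rightarrow> real) \<Rightarrow> ('a \<Rightarrow> real)" where
  "neg_laplace_h \<Omega> \<T> v =
     (THE u. u \<in> V_h \<Omega> \<T> \<and>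
             (\<forall>w\<in>V_h \<Omega> \<T>. L2_ip \<Omega> u w = L2_ip \<Omega> (grad \<Omega> v) (grad \<Omega> w)))"

definition inv_neg_laplace_h ::
  "'a::euclidean_space set \<Rightarrow> 'a set set \<Rightarrow> ('a \<Rightarrow> real) \<Rightarrow> ('a \<Rightarrow> real)" where
  "inv_neg_laplace_h \<Omega> \<T> = the_inv_into (V_h \<Omega> \<T>) (neg_laplace_h \<Omega> \<T>)"


section \<open>Discretization in time\<close>

definition time_grid :: "real \<Rightarrow> nat \<Rightarrow> (nat \<Rightarrow> real) \<Rightarrow> bool" where
  "time_grid T M t \<longleftrightarrow> 1 \<le> M \<and> t 0 = 0 \<and> t M = T \<and> (\<forall>m<M. t m < t (Suc m))"

text \<open>The interval \<open>I\<^sub>m\<close>; the last one does not contain the final time.\<close>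

definition time_cell :: "nat \<Rightarrow> (nat \<Rightarrow> real) \<Rightarrow> nat \<Rightarrow> real set" where
  "time_cell M t m = (if m < M then {t (m - 1)<..t m} else {t (m - 1)<..<t m})"

definition poly_in_time ::
  "nat \<Rightarrow> real set \<Rightarrow> ('a \<Rightarrow> real) set \<Rightarrow> (real \<Rightarrow> 'a \<Rightarrow> real) \<Rightarrow> bool" where
  "poly_in_time i J V v \<longleftrightarrow>
     (\<exists>c :: nat \<Rightarrow> 'a \<Rightarrow> real. (\<forall>j\<le>i. c j \<in> V) \<and>
        (\<forall>s\<in>J. v s = (\<lambda>x. \<Sum>j\<le>i. s ^ j * c j x)))"

definition P_sigma ::
  "'a::euclidean_space set \<Rightarrow> real \<Rightarrow> 'a set set \<Rightarrow> nat \<Rightarrow> (nat \<Rightarrow> real)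
     \<Rightarrow> (real \<Rightarrow> 'a \<Rightarrow> real) set" where
  "P_sigma \<Omega> T \<T> M t =
     {v \<in> C_time {0..T} (H10 \<Omega>) (H10_nrm \<Omega>).
        \<forall>m\<in>{1..M}. poly_in_time 1 (time_cell M t m) (V_h \<Omega> \<T>) v}"

text \<open>The value \<open>v T\<close> is an independent degree of freedom, as \<open>T\<close> lies in no time cell.\<close>

definition Y_sigma ::
  "'a::euclidean_space set \<Rightarrow> real \<Rightarrow> 'a set set \<Rightarrow> nat \<Rightarrow> (nat \<Rightarrow> real)
     \<Rightarrow> (real \<Rightarrow> 'a \<Rightarrow> real) set" where
  "Y_sigma \<Omega> T \<T> M t =
     {v \<in> L2_time {0<..<T} (H10 \<Omega>) (H10_nrm \<Omega>).
        (\<forall>m\<in>{1..M}. poly_in_time 0 (time_cell M t m) (V_h \<Omega> \<T>) v) \<and> v T \<in> V_h \<Omega> \<T>}"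

definition A_form ::
  "'a::euclidean_space set \<Rightarrow> real \<Rightarrow> (real \<Rightarrow> 'a \<Rightarrow> real) \<Rightarrow> (real \<Rightarrow> 'a \<Rightarrow> real) \<Rightarrow> real" where
  "A_form \<Omega> T u v =
     - (\<integral>t. L2_to_Hm1 \<Omega> (time_deriv v t) (u t) \<partial>lebesgue_on {0<..<T})
     + (\<integral>t. L2_ip \<Omega> (grad \<Omega> (u t)) (grad \<Omega> (v t)) \<partial>lebesgue_on {0<..<T})
     + L2_ip \<Omega> (u T) (v T)"

end

theory Submission
  imports Defs
begin

text \<open>
  The stability estimate is an energy argument for an implicit time stepping scheme that runs
  backwards from \<open>T\<close>; its constant is the absolute number \<open>5\<close>.

  Test functions supported on a single time cell decouple the variational problem. If
  \<open>z = a + s b\<close> on the cell \<open>(t\<^sub>m\<^sub>-\<^sub>1, t\<^sub>m)\<close> of length \<open>k\<close>, and \<open>\<mu>\<close> is the value of this function at the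
  midpoint, then \<open>k ((\<nabla>\<mu>, \<nabla>w) - (b, w)) = \<integral> \<langle>g, w\<rangle>\<close> for all finite element functions \<open>w\<close>, a
  Crank-Nicolson step (\<open>crank_nicolson\<close>). The separate degree of freedom at \<open>T\<close> makes \<open>z(T)\<close> the
  \<open>L\<^sup>2\<close> projection of the given final value (\<open>final_value_bound\<close>).

  Testing with \<open>w = \<mu>\<close> telescopes, because \<open>2 k (b, \<mu>)\<close> is the increment of \<open>\<parallel>z\<parallel>\<^sup>2\<close> over the cell. This bounds
  the nodal values, hence the maximum in time of the piecewise affine \<open>z\<close>, and the sum of the
  \<open>k \<parallel>\<nabla>\<mu>\<parallel>\<^sup>2\<close> (\<open>energy_step\<close>). On the cell, the derivative of \<open>(-\<Delta>\<^sub>h)\<^sup>-\<^sup>1 z\<close> is the function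
  \<open>y = (-\<Delta>\<^sub>h)\<^sup>-\<^sup>1 b\<close>. Testing with \<open>w = y\<close> turns \<open>(b, y)\<close> into \<open>\<parallel>\<nabla>y\<parallel>\<^sup>2\<close>, which is therefore controlled by
  \<open>\<nabla>\<mu>\<close> and \<open>g\<close> (\<open>slope_potential_bound\<close>).

  The rest of the text provides what this argument presupposes. The gradient is chosen among all weak
  gradients, so it is linear only because weak gradients are unique almost everywhere; this rests on
  the fundamental lemma of the calculus of variations. The discrete Laplacian is bijective because
  the Dirichlet form is definite on finite element functions, by Poincare's inequality, and because
  a finite element function is determined by finitely many nodal values, which gives Riesz
  representation. Poincare's inequality also identifies \<open>z\<close> at the grid points, where it is
  determined by its continuity in \<open>H\<^sub>0\<^sup>1\<close>, with the limits of the affine pieces.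
\<close>

section \<open>Spaces of functions with a semi-inner product\<close>

text \<open>
  The \<open>L\<^sup>2\<close> inner products and the Dirichlet form are only semi-definite on functions, since a
  function that is zero almost everywhere need not be zero. Linear combinations are formed pointwise;
  the single closure and linearity axiom with a coefficient covers sums, differences and multiples.
\<close>

locale semi_inner_functions =
  fixes V :: "('a \<Rightarrow> 'b::real_vector) set"
    and ip :: "('a \<Rightarrow> 'b) \<Rightarrow> ('a \<Rightarrow> 'b) \<Rightarrow> real"
  assumes zero_mem: "(\<lambda>x. 0) \<in> V"
    and combine_mem: "\<And>u v c. u \<in> V \<Longrightarrow> v \<in> V \<Longrightarrow> (\<lambda>x. u x + c *\<^sub>R v x) \<in> V"
    and sym: "\<And>u v. u \<in> V \<Longrightarrow> v \<in> V \<Longrightarrow> ip u v = ip v u"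
    and combine_left: "\<And>u v w c. u \<in> V \<Longrightarrow> v \<in> V \<Longrightarrow> w \<in> V \<Longrightarrow>
          ip (\<lambda>x. u x + c *\<^sub>R v x) w = ip u w + c * ip v w"
    and nonneg: "\<And>u. u \<in> V \<Longrightarrow> 0 \<le> ip u u"
begin

lemma add_mem: "u \<in> V \<Longrightarrow> v \<in> V \<Longrightarrow> (\<lambda>x. u x + v x) \<in> V"
  using combine_mem[of u v 1] by simp

lemma diff_mem: "u \<in> V \<Longrightarrow> v \<in> V \<Longrightarrow> (\<lambda>x. u x - v x) \<in> V"
  using combine_mem[of u v "-1"] by simp

lemma scale_mem: "u \<in> V \<Longrightarrow> (\<lambda>x. c *\<^sub>R u x) \<in> V"
  using combine_mem[OF zero_mem, of u c] by simp

lemma combine_right: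
  "u \<in> V \<Longrightarrow> v \<in> V \<Longrightarrow> w \<in> V \<Longrightarrow> ip w (\<lambda>x. u x + c *\<^sub>R v x) = ip w u + c * ip w v"
  using sym[of w "\<lambda>x. u x + c *\<^sub>R v x"] sym[of w u] sym[of w v] combine_left[of u v w c]
    combine_mem[of u v c] by simp

lemma zero_left: "u \<in> V \<Longrightarrow> ip (\<lambda>x. 0) u = 0"
  using combine_left[OF zero_mem zero_mem, of u 1] by simp

lemma zero_right: "u \<in> V \<Longrightarrow> ip u (\<lambda>x. 0) = 0"
  using zero_left[of u] sym[of u "\<lambda>x. 0"] zero_mem by simp

lemma scale_left: "u \<in> V \<Longrightarrow> w \<in> V \<Longrightarrow> ip (\<lambda>x. c *\<^sub>R u x) w = c * ip u w"
  using combine_left[OF zero_mem, of u w c] zero_left by simp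

lemma scale_right: "u \<in> V \<Longrightarrow> w \<in> V \<Longrightarrow> ip w (\<lambda>x. c *\<^sub>R u x) = c * ip w u"
  using combine_right[OF zero_mem, of u w c] zero_right by simp

lemma diff_left: "u \<in> V \<Longrightarrow> v \<in> V \<Longrightarrow> w \<in> V \<Longrightarrow> ip (\<lambda>x. u x - v x) w = ip u w - ip v w"
  using combine_left[of u v w "-1"] by simp

lemma ip_combine_self:
  assumes "u \<in> V" "v \<in> V"
  shows "ip (\<lambda>x. u x + c *\<^sub>R v x) (\<lambda>x. u x + c *\<^sub>R v x) = ip u u + 2 * c * ip u v + c\<^sup>2 * ip v v"
  using assms sym[of u v]
  by (simp add: combine_left combine_right combine_mem algebra_simps power2_eq_square)

lemma cauchy_schwarz_squared:
  assumes u: "u \<in> V" and v: "v \<in> V"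
  shows "(ip u v)\<^sup>2 \<le> ip u u * ip v v"
proof -
  have q: "0 \<le> ip u u + 2 * c * ip u v + c\<^sup>2 * ip v v" for c
    using nonneg[OF combine_mem[OF u v, of c]] ip_combine_self[OF u v, of c] by simp
  show ?thesis
  proof (cases "ip v v = 0")
    case True
    \<comment> \<open>The quadratic in \<open>c\<close> degenerates to an affine function that is bounded below.\<close>
    have "ip u v = 0"
    proof (rule ccontr)
      assume "ip u v \<noteq> 0"
      then show False using q[of "- (ip u u + 1) / (2 * ip u v)"] True by (simp add: field_simps)
    qed
    then show ?thesis using True by simp
  next
    case False
    then have "ip v v > 0" using nonneg[OF v] by simp
    moreover have "ip u u - (ip u v)\<^sup>2 / ip v v \<ge> 0"
      using q[of "- ip u v / ip v v"] False by (simp add: field_simps power2_eq_square)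
    ultimately show ?thesis by (simp add: field_simps)
  qed
qed

lemma cauchy_schwarz:
  assumes "u \<in> V" "v \<in> V"
  shows "\<bar>ip u v\<bar> \<le> sqrt (ip u u) * sqrt (ip v v)"
  using cauchy_schwarz_squared[OF assms] by (metis real_sqrt_abs real_sqrt_le_mono real_sqrt_mult)

lemma triangle:
  assumes u: "u \<in> V" and v: "v \<in> V"
  shows "sqrt (ip (\<lambda>x. u x + v x) (\<lambda>x. u x + v x)) \<le> sqrt (ip u u) + sqrt (ip v v)"
proof (rule real_le_lsqrt)
  have "ip (\<lambda>x. u x + v x) (\<lambda>x. u x + v x) = ip u u + 2 * ip u v + ip v v"
    using ip_combine_self[OF u v, of 1] by simp
  also have "\<dots> \<le> ip u u + 2 * (sqrt (ip u u) * sqrt (ip v v)) + ip v v"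
    using cauchy_schwarz[OF u v] by simp
  also have "\<dots> = (sqrt (ip u u) + sqrt (ip v v))\<^sup>2"
    using nonneg u v by (simp add: power2_sum)
  finally show "ip (\<lambda>x. u x + v x) (\<lambda>x. u x + v x) \<le> (sqrt (ip u u) + sqrt (ip v v))\<^sup>2" .
  show "0 \<le> sqrt (ip u u) + sqrt (ip v v)" using nonneg[OF u] nonneg[OF v] by simp
qed

lemma nrm_scale: "u \<in> V \<Longrightarrow> sqrt (ip (\<lambda>x. c *\<^sub>R u x) (\<lambda>x. c *\<^sub>R u x)) = \<bar>c\<bar> * sqrt (ip u u)"
  using scale_left[of u "\<lambda>x. c *\<^sub>R u x" c] scale_right[of u u c] scale_mem[of u c]
  by (simp add: real_sqrt_mult real_sqrt_abs2 flip: mult.assoc)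

lemma triangle_combine:
  assumes u: "u \<in> V" and v: "v \<in> V"
  shows "sqrt (ip (\<lambda>x. u x + c *\<^sub>R v x) (\<lambda>x. u x + c *\<^sub>R v x)) \<le> sqrt (ip u u) + \<bar>c\<bar> * sqrt (ip v v)"
  using triangle[OF u scale_mem[OF v, of c]] nrm_scale[OF v, of c] by simp

lemma ip_zero_right_of_null:
  assumes "u \<in> V" "v \<in> V" "ip v v = 0"
  shows "ip u v = 0"
  using cauchy_schwarz[OF assms(1,2)] assms(3) by simp

text \<open>
  Riesz representation in finite dimension. Finite-dimensionality is expressed by a finite set of
  linear functionals that separates points, which for finite elements are the nodal values. The
  induction removes one functional \<open>\<xi>\<close>: the kernel of \<open>\<xi>\<close> has an orthogonal complement spanned by
  one vector \<open>n\<close> with \<open>\<xi> n = 1\<close>, and a multiple of \<open>n\<close> corrects the representer on the kernel.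
\<close>

lemma riesz_representation:
  assumes "finite L"
    and "W \<subseteq> V" and "(\<lambda>x. 0) \<in> W"
    and "\<And>u v c. u \<in> W \<Longrightarrow> v \<in> W \<Longrightarrow> (\<lambda>x. u x + c *\<^sub>R v x) \<in> W"
    and "\<And>u. u \<in> W \<Longrightarrow> ip u u = 0 \<Longrightarrow> u = (\<lambda>x. 0)"
    and "\<And>\<xi> u v c. \<xi> \<in> L \<Longrightarrow> u \<in> W \<Longrightarrow> v \<in> W \<Longrightarrow> \<xi> (\<lambda>x. u x + c *\<^sub>R v x) = \<xi> u + c * (\<xi> v :: real)"
    and "\<And>u. u \<in> W \<Longrightarrow> (\<And>\<xi>. \<xi> \<in> L \<Longrightarrow> \<xi> u = 0) \<Longrightarrow> u = (\<lambda>x. 0)"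
    and "\<And>u v c. u \<in> W \<Longrightarrow> v \<in> W \<Longrightarrow> F (\<lambda>x. u x + c *\<^sub>R v x) = F u + c * (F v :: real)"
  shows "\<exists>u\<in>W. \<forall>w\<in>W. ip u w = F w"
  using assms
proof (induction L arbitrary: W F rule: finite_induct)
  case empty
  have null: "w = (\<lambda>x. 0)" if "w \<in> W" for w using empty.prems(6)[OF that] by simp
  have "F (\<lambda>x. 0) = 0" using empty.prems(7)[of "\<lambda>x. 0" "\<lambda>x. 0" 1] empty.prems(2) by simp
  then have "ip (\<lambda>x. 0) w = F w" if "w \<in> W" for w
    using null[OF that] zero_left[OF zero_mem] by simp
  then show ?case using empty.prems(2) by blast
next
  case (insert \<xi> L)
  note sub = subsetD[OF insert.prems(1)] and zero = insert.prems(2) and comb = insert.prems(3)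
    and definite = insert.prems(4) and sep = insert.prems(6) and linF = insert.prems(7)
    and lin\<xi> = insert.prems(5)[OF insertI1]
  have \<xi>0: "\<xi> (\<lambda>x. 0) = 0" using lin\<xi>[OF zero zero, of 1] by simp
  define K where "K = {u \<in> W. \<xi> u = 0}"
  have K: "u \<in> K \<longleftrightarrow> u \<in> W \<and> \<xi> u = 0" for u by (simp add: K_def)
  have KW: "u \<in> W" if "u \<in> K" for u using that by (simp add: K)
  have IH: "\<exists>u\<in>K. \<forall>w\<in>K. ip u w = G w"
    if linG: "\<And>u v c. u \<in> W \<Longrightarrow> v \<in> W \<Longrightarrow> G (\<lambda>x. u x + c *\<^sub>R v x) = G u + c * (G v :: real)" for G
  proof (rule insert.IH)
    show "K \<subseteq> V" using sub KW by blast
    show "(\<lambda>x. 0) \<in> K" unfolding K using zero \<xi>0 by blast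
    show "(\<lambda>x. u x + c *\<^sub>R v x) \<in> K" if "u \<in> K" "v \<in> K" for u v c
      using comb[OF KW[OF that(1)] KW[OF that(2)], of c]
        lin\<xi>[OF KW[OF that(1)] KW[OF that(2)], of c] that by (simp add: K)
    show "u = (\<lambda>x. 0)" if "u \<in> K" "ip u u = 0" for u
      using definite[OF KW[OF that(1)] that(2)] .
    show "\<xi>' (\<lambda>x. u x + c *\<^sub>R v x) = \<xi>' u + c * \<xi>' v" if "\<xi>' \<in> L" "u \<in> K" "v \<in> K" for \<xi>' u v c
      using insert.prems(5)[OF insertI2[OF that(1)] KW[OF that(2)] KW[OF that(3)]] .
    show "u = (\<lambda>x. 0)" if u: "u \<in> K" and v: "\<And>\<xi>'. \<xi>' \<in> L \<Longrightarrow> \<xi>' u = 0" for u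
    proof (rule sep[OF KW[OF u]])
      show "\<xi>' u = 0" if "\<xi>' \<in> insert \<xi> L" for \<xi>'
        using that u v[of \<xi>'] by (cases "\<xi>' = \<xi>") (simp_all add: K)
    qed
    show "G (\<lambda>x. u x + c *\<^sub>R v x) = G u + c * G v" if "u \<in> K" "v \<in> K" for u v c
      using linG[OF KW[OF that(1)] KW[OF that(2)]] .
  qed
  obtain u' where u': "u' \<in> K" "\<And>w. w \<in> K \<Longrightarrow> ip u' w = F w"
    using IH[of F, OF linF] by blast
  show ?case
  proof (cases "K = W")
    case True
    then show ?thesis using u' by blast
  next
    case False
    then obtain e0 where e0: "e0 \<in> W" "\<xi> e0 \<noteq> 0" unfolding K_def by blast
    define e where "e = (\<lambda>x. (1 / \<xi> e0) *\<^sub>R e0 x)"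
    have e: "e \<in> W" "\<xi> e = 1"
      using comb[OF zero e0(1), of "1 / \<xi> e0"] lin\<xi>[OF zero e0(1), of "1 / \<xi> e0"] e0(2) \<xi>0
      by (simp_all add: e_def)
    have "ip e (\<lambda>x. u x + c *\<^sub>R v x) = ip e u + c * ip e v" if "u \<in> W" "v \<in> W" for u v c
      using combine_right[OF sub[OF that(1)] sub[OF that(2)] sub[OF e(1)]] .
    then obtain p where p: "p \<in> K" "\<And>w. w \<in> K \<Longrightarrow> ip p w = ip e w"
      using IH[of "ip e"] by blast
    define n where "n = (\<lambda>x. e x - p x)"
    note pW = KW[OF p(1)] and u'W = KW[OF u'(1)]
    have n: "n \<in> W" "\<xi> n = 1"
      using comb[OF e(1) pW, of "-1"] lin\<xi>[OF e(1) pW, of "-1"] e(2) p(1)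
      by (simp_all add: n_def K)
    note nV = sub[OF n(1)]
    have orth: "ip n w = 0" if "w \<in> K" for w
      unfolding n_def
      using diff_left[OF sub[OF e(1)] sub[OF pW] sub[OF KW[OF that]]] p(2)[OF that] by simp
    have nn: "ip n n \<noteq> 0"
    proof
      assume "ip n n = 0"
      then have "n = (\<lambda>x. 0)" by (rule definite[OF n(1)])
      then show False using n(2) \<xi>0 by simp
    qed
    define c where "c = F n / ip n n"
    have u'n: "ip u' n = 0"
      using orth[OF u'(1)] sym[OF sub[OF u'W] nV] by simp
    have "ip (\<lambda>x. u' x + c *\<^sub>R n x) w = F w" if w: "w \<in> W" for w
    proof -
      define w' where "w' = (\<lambda>x. w x + (- \<xi> w) *\<^sub>R n x)"
      have w': "w' \<in> K" "w = (\<lambda>x. w' x + \<xi> w *\<^sub>R n x)"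
        using comb[OF w n(1), of "- \<xi> w"] lin\<xi>[OF w n(1), of "- \<xi> w"] n(2)
        by (simp_all add: w'_def K)
      note w'W = KW[OF w'(1)]
      have "ip (\<lambda>x. u' x + c *\<^sub>R n x) w = ip u' w + c * ip n w"
        using combine_left[OF sub[OF u'W] nV sub[OF w]] .
      also have "ip u' w = F w'"
        using combine_right[OF sub[OF w'W] nV sub[OF u'W], of "\<xi> w"] u'(2)[OF w'(1)] u'n
        by (simp flip: w'(2))
      also have "ip n w = \<xi> w * ip n n"
        using combine_right[OF sub[OF w'W] nV nV, of "\<xi> w"] orth[OF w'(1)]
        by (simp flip: w'(2))
      also have "F w' + c * (\<xi> w * ip n n) = F w"
        using linF[OF w'W n(1), of "\<xi> w"] nn by (simp add: c_def flip: w'(2))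
      finally show ?thesis .
    qed
    moreover have "(\<lambda>x. u' x + c *\<^sub>R n x) \<in> W" using comb[OF u'W n(1)] .
    ultimately show ?thesis by blast
  qed
qed

end


section \<open>The spaces \<open>L\<^sup>2\<close>\<close>

lemma L2_ip_integrable:
  assumes "u \<in> L2 \<Omega>" "v \<in> L2 \<Omega>"
  shows "integrable (lebesgue_on \<Omega>) (\<lambda>x. u x \<bullet> v x)"
proof (rule Bochner_Integration.integrable_bound)
  show "integrable (lebesgue_on \<Omega>) (\<lambda>x. (norm (u x))\<^sup>2 + (norm (v x))\<^sup>2)"
    using assms by (auto simp: L2_def)
  show "(\<lambda>x. u x \<bullet> v x) \<in> borel_measurable (lebesgue_on \<Omega>)"
    using assms by (auto simp: L2_def)
  have "\<bar>a \<bullet> b\<bar> \<le> (norm a)\<^sup>2 + (norm b)\<^sup>2" for a b :: 'b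
  proof -
    have "\<bar>a \<bullet> b\<bar> \<le> norm a * norm b" by (rule Cauchy_Schwarz_ineq2)
    also have "\<dots> \<le> (norm a)\<^sup>2 + (norm b)\<^sup>2"
      using sum_squares_bound[of "norm a" "norm b"]
        mult_nonneg_nonneg[OF norm_ge_zero[of a] norm_ge_zero[of b]] by linarith
    finally show ?thesis .
  qed
  then show "AE x in lebesgue_on \<Omega>. norm (u x \<bullet> v x) \<le> norm ((norm (u x))\<^sup>2 + (norm (v x))\<^sup>2)"
    by (intro AE_I2) auto
qed

lemma L2_combine:
  assumes "u \<in> L2 \<Omega>" "v \<in> L2 \<Omega>"
  shows "(\<lambda>x. u x + c *\<^sub>R v x) \<in> L2 \<Omega>"
proof -
  have "(norm (u x + c *\<^sub>R v x))\<^sup>2 = u x \<bullet> u x + 2 * c * (u x \<bullet> v x) + c\<^sup>2 * (v x \<bullet> v x)" for x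
    unfolding power2_norm_eq_inner using inner_commute[of "v x" "u x"]
    by (simp add: inner_left_distrib inner_right_distrib power2_eq_square algebra_simps)
  moreover have "integrable (lebesgue_on \<Omega>)
      (\<lambda>x. u x \<bullet> u x + 2 * c * (u x \<bullet> v x) + c\<^sup>2 * (v x \<bullet> v x))"
    by (intro Bochner_Integration.integrable_add integrable_mult_right L2_ip_integrable assms)
  ultimately show ?thesis using assms by (auto simp: L2_def)
qed

interpretation L2: semi_inner_functions "L2 \<Omega>" "L2_ip \<Omega>" for \<Omega> :: "'a::euclidean_space set"
proof
  show "(\<lambda>x. 0) \<in> L2 \<Omega>" by (simp add: L2_def)
  show "L2_ip \<Omega> u v = L2_ip \<Omega> v u" for u v :: "'a \<Rightarrow> 'b"
    by (simp add: L2_ip_def inner_commute)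
  show "0 \<le> L2_ip \<Omega> u u" for u :: "'a \<Rightarrow> 'b" by (simp add: L2_ip_def)
  fix u v w :: "'a \<Rightarrow> 'b" and c :: real
  assume u: "u \<in> L2 \<Omega>" and v: "v \<in> L2 \<Omega>"
  show "(\<lambda>x. u x + c *\<^sub>R v x) \<in> L2 \<Omega>" using L2_combine u v .
  assume w: "w \<in> L2 \<Omega>"
  show "L2_ip \<Omega> (\<lambda>x. u x + c *\<^sub>R v x) w = L2_ip \<Omega> u w + c * L2_ip \<Omega> v w"
    unfolding L2_ip_def using L2_ip_integrable[OF u w] L2_ip_integrable[OF v w]
    by (simp add: inner_left_distrib)
qed

lemma L2_ip_cong_AE:
  assumes "u \<in> L2 \<Omega>" "u' \<in> L2 \<Omega>" "v \<in> L2 \<Omega>" "v' \<in> L2 \<Omega>"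
    and "AE x in lebesgue_on \<Omega>. u x = u' x" "AE x in lebesgue_on \<Omega>. v x = v' x"
  shows "L2_ip \<Omega> u v = L2_ip \<Omega> u' v'"
  unfolding L2_ip_def
proof (rule integral_cong_AE)
  show "AE x in lebesgue_on \<Omega>. u x \<bullet> v x = u' x \<bullet> v' x"
    using assms(5,6) by eventually_elim simp
qed (use assms in \<open>auto simp: L2_def\<close>)

lemma L2_nrm_nonneg: "0 \<le> L2_nrm \<Omega> u"
  by (simp add: L2_nrm_def L2_ip_def)

lemma L2_nrm_power2: "(L2_nrm \<Omega> u)\<^sup>2 = L2_ip \<Omega> u u"
  by (simp add: L2_nrm_def L2_ip_def)

lemma L2_nrm_zero_imp_AE:
  assumes "u \<in> L2 \<Omega>" "L2_nrm \<Omega> u = 0"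
  shows "AE x in lebesgue_on \<Omega>. u x = 0"
proof -
  have "integral\<^sup>L (lebesgue_on \<Omega>) (\<lambda>x. u x \<bullet> u x) = 0"
    using assms(2) by (simp add: L2_nrm_def L2_ip_def)
  then have "AE x in lebesgue_on \<Omega>. u x \<bullet> u x = 0"
    using integral_nonneg_eq_0_iff_AE[OF L2_ip_integrable[OF assms(1,1)]] by simp
  then show ?thesis by simp
qed

section \<open>Smooth functions of compact support\<close>

lemma partial_deriv_eq:
  "(f has_derivative D) (at x) \<Longrightarrow> partial_deriv i f x = D i"
  unfolding partial_deriv_def by (metis frechet_derivative_at)

lemma C_k_Suc_has_derivative: "C_k (Suc k) f \<Longrightarrow> (f has_derivative (\<lambda>h. frechet_derivative f (at x) h)) (at x)"
  using frechet_derivative_works by auto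

lemma C_k_Suc_imp_C_k: "C_k (Suc k) f \<Longrightarrow> C_k k f"
proof (induction k arbitrary: f)
  case 0
  then show ?case
    by (auto intro!: continuous_at_imp_continuous_on differentiable_imp_continuous_within)
next
  case (Suc k)
  then show ?case by (metis C_k.simps(2))
qed

lemma C_k_const: "C_k k (\<lambda>x. c)"
proof (induction k arbitrary: c)
  case (Suc k)
  have "partial_deriv i (\<lambda>x::'a. c) = (\<lambda>x. 0)" for i by (simp add: partial_deriv_def fun_eq_iff)
  then show ?case using Suc by simp
qed simp

lemma C_k_add:
  assumes "C_k k f" "C_k k g"
  shows "C_k k (\<lambda>x. f x + g x)"
  using assms
proof (induction k arbitrary: f g)
  case 0
  then show ?case by (simp add: continuous_on_add)
next
  case (Suc k)
  have "partial_deriv i (\<lambda>x. f x + g x) = (\<lambda>x. partial_deriv i f x + partial_deriv i g x)" for i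
    by (rule ext, subst partial_deriv_eq[OF has_derivative_add[OF C_k_Suc_has_derivative[OF Suc.prems(1)]
            C_k_Suc_has_derivative[OF Suc.prems(2)]]]) (simp add: partial_deriv_def)
  then show ?case using Suc by simp
qed

lemma C_k_mult_partial:
  assumes "C_k (Suc k) f" "C_k (Suc k) g"
  shows "partial_deriv i (\<lambda>x. f x * g x) = (\<lambda>x. f x * partial_deriv i g x + partial_deriv i f x * g x)"
  by (rule ext, subst partial_deriv_eq[OF has_derivative_mult[OF C_k_Suc_has_derivative[OF assms(1)]
          C_k_Suc_has_derivative[OF assms(2)]]]) (simp add: partial_deriv_def)

lemma C_k_mult:
  assumes "C_k k f" "C_k k g"
  shows "C_k k (\<lambda>x. f x * g x)"
  using assms
proof (induction k arbitrary: f g)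
  case 0
  then show ?case by (simp add: continuous_on_mult)
next
  case (Suc k)
  have fg: "C_k k f" "C_k k g" using Suc.prems C_k_Suc_imp_C_k by blast+
  have "C_k k (partial_deriv i (\<lambda>x. f x * g x))" if "i \<in> Basis" for i
    unfolding C_k_mult_partial[OF Suc.prems] using Suc.prems that
    by (intro C_k_add Suc.IH fg) auto
  then show ?case using Suc.prems by simp
qed

lemma C_k_prod: "(\<And>i. i \<in> S \<Longrightarrow> C_k k (f i)) \<Longrightarrow> C_k k (\<lambda>x. \<Prod>i\<in>S. f i x)"
  by (induction S rule: infinite_finite_induct) (simp_all add: C_k_const C_k_mult)

lemma C_k_combine: "C_k k f \<Longrightarrow> C_k k g \<Longrightarrow> C_k k (\<lambda>x. f x + c * g x)"
  by (intro C_k_add C_k_mult C_k_const)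

text \<open>
  The sequence \<open>\<eta>\<close> lists a function of one real variable and its successive derivatives, so each
  partial derivative of the ridge function moves one step along the sequence.
\<close>

lemma C_k_ridge:
  assumes \<eta>: "\<And>n s. (\<eta> n has_real_derivative \<eta> (Suc n) s) (at s)"
  shows "C_k k (\<lambda>x::'a::euclidean_space. c * \<eta> n (a + b * (x \<bullet> i)))"
proof (induction k arbitrary: n c)
  case 0
  have "isCont (\<eta> n) s" for s using DERIV_isCont[OF \<eta>] .
  then have "continuous_on UNIV (\<eta> n)" by (simp add: continuous_at_imp_continuous_on)
  then have "continuous_on UNIV (\<lambda>x. \<eta> n (a + b * (x \<bullet> i)))"
    by (rule continuous_on_compose2) (auto intro!: continuous_intros)
  then show ?case by (simp add: continuous_on_mult)
next
  case (Suc k)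
  have d: "((\<lambda>x. c * \<eta> n (a + b * (x \<bullet> i))) has_derivative
      (\<lambda>h. c * ((b * (h \<bullet> i)) * \<eta> (Suc n) (a + b * (x \<bullet> i))))) (at x)" for x :: 'a
    by (rule derivative_eq_intros refl DERIV_compose_FDERIV[OF \<eta>] | simp)+
  have "partial_deriv j (\<lambda>x::'a. c * \<eta> n (a + b * (x \<bullet> i))) =
      (\<lambda>x. (c * b * (j \<bullet> i)) * \<eta> (Suc n) (a + b * (x \<bullet> i)))" for j
    by (rule ext) (simp add: partial_deriv_eq[OF d])
  then show ?case using Suc differentiableI[OF d] by simp
qed

lemma C_k_inner: "C_k k (\<lambda>x::'a::euclidean_space. x \<bullet> i)"
proof -
  \<comment> \<open>the derivatives \<open>s, 1, 0, 0, \<dots>\<close> of the identity\<close>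
  define \<eta> where "\<eta> n s = (if n = 0 then s else if n = 1 then 1 else (0::real))" for n :: nat and s
  have "(\<eta> n has_real_derivative \<eta> (Suc n) s) (at s)" for n s
    unfolding \<eta>_def by (cases "n = 0"; cases "n = 1") auto
  from C_k_ridge[of \<eta> k 1 0 0 1 i, OF this] show ?thesis by (simp add: \<eta>_def)
qed

text \<open>
  For \<open>p = 1\<close> this is the classical smooth function that vanishes to infinite order at the origin. The
  polynomial is a parameter because the functions of this form are closed under differentiation.
\<close>

definition flat :: "real poly \<Rightarrow> real \<Rightarrow> real" where
  "flat p s = (if 0 < s then poly p (1 / s) * exp (- 1 / s) else 0)"

text \<open>With \<open>y = 1 / s\<close>, this limit is the decay of \<open>flat p\<close> at the origin.\<close>

lemma poly_times_exp_tendsto_0: "((\<lambda>y::real. poly p y * exp (- y)) \<longlongrightarrow> 0) at_top"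
proof -
  have "((\<lambda>y::real. \<Sum>i\<le>degree p. coeff p i * (y ^ i / exp y)) \<longlongrightarrow> 0) at_top"
    by (intro tendsto_null_sum tendsto_mult_right_zero tendsto_power_div_exp_0)
  then show ?thesis
    by (simp add: poly_altdef sum_distrib_right sum_divide_distrib exp_minus field_simps)
qed

lemma flat_has_derivative:
  "(flat p has_real_derivative flat ([:0, 0, 1:] * (p - pderiv p)) s) (at s)"
proof (cases "s = 0")
  case False
  show ?thesis
  proof (cases "s > 0")
    case True
    have "((\<lambda>s. poly p (1 / s) * exp (- 1 / s)) has_real_derivative
        flat ([:0, 0, 1:] * (p - pderiv p)) s) (at s)"
      using True unfolding flat_def
      by (auto intro!: derivative_eq_intros poly_DERIV[THEN DERIV_chain2] simp: field_simps power2_eq_square)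
    then show ?thesis
      by (rule has_field_derivative_transform_within_open[where S = "{0<..}"])
         (use True in \<open>auto simp: flat_def\<close>)
  next
    case neg: False
    have "((\<lambda>s. 0) has_real_derivative flat ([:0, 0, 1:] * (p - pderiv p)) s) (at s)"
      using neg by (simp add: flat_def)
    then show ?thesis
      by (rule has_field_derivative_transform_within_open[where S = "{..<0}"])
         (use neg False in \<open>auto simp: flat_def\<close>)
  qed
next
  case True
  have "((\<lambda>s. poly (pCons 0 p) (inverse s) * exp (- inverse s)) \<longlongrightarrow> 0) (at_right (0::real))"
    by (rule filterlim_compose[OF poly_times_exp_tendsto_0 filterlim_inverse_at_top_right])
  moreover have "\<forall>\<^sub>F s in at_right (0::real). poly (pCons 0 p) (inverse s) * exp (- inverse s) = flat p s / s"
    using eventually_at_right_less[of 0] by eventually_elim (simp add: flat_def field_simps)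
  ultimately have "((\<lambda>s. flat p s / s) \<longlongrightarrow> 0) (at_right 0)"
    by (rule Lim_transform_eventually)
  moreover have "((\<lambda>s. flat p s / s) \<longlongrightarrow> 0) (at_left 0)"
  proof (rule tendsto_eventually)
    show "\<forall>\<^sub>F s in at_left 0. flat p s / s = 0"
      using eventually_at_left_real[of "-1" 0] by (auto elim!: eventually_mono simp: flat_def)
  qed
  ultimately have "((\<lambda>s. flat p s / s) \<longlongrightarrow> 0) (at 0)"
    using filterlim_split_at by blast
  then show ?thesis using True by (simp add: has_field_derivative_iff flat_def)
qed

lemma flat_1_bounds: "0 \<le> flat 1 s" "flat 1 s \<le> 1"
  by (auto simp: flat_def)

lemma C_k_flat_ridge: "C_k k (\<lambda>x::'a::euclidean_space. flat 1 (a + b * (x \<bullet> i)))"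
proof -
  define \<eta> where "\<eta> n = flat (((\<lambda>p. [:0, 0, 1:] * (p - pderiv p)) ^^ n) 1)" for n
  have "(\<eta> n has_real_derivative \<eta> (Suc n) s) (at s)" for n s
    using flat_has_derivative unfolding \<eta>_def by simp
  from C_k_ridge[of \<eta> k 1 0 a b i, OF this] show ?thesis by (simp add: \<eta>_def)
qed

text \<open>
  These bump functions increase to the indicator of the open box as \<open>n \<rightarrow> \<infinity>\<close>, so testing
  against them computes integrals over boxes.
\<close>

definition box_bump :: "'a::euclidean_space \<Rightarrow> 'a \<Rightarrow> nat \<Rightarrow> 'a \<Rightarrow> real" where
  "box_bump a b n x = (\<Prod>i\<in>Basis. flat 1 (Suc n * ((x - a) \<bullet> i)) * flat 1 (Suc n * ((b - x) \<bullet> i)))"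

lemma box_bump_bounds: "0 \<le> box_bump a b n x" "box_bump a b n x \<le> 1"
  unfolding box_bump_def
  by (auto intro!: prod_nonneg prod_le_1 mult_le_one mult_nonneg_nonneg flat_1_bounds)

lemma box_bump_outside:
  assumes "x \<notin> box a b"
  shows "box_bump a b n x = 0"
proof -
  obtain i where i: "i \<in> Basis" "\<not> (a \<bullet> i < x \<bullet> i \<and> x \<bullet> i < b \<bullet> i)"
    using assms by (auto simp: mem_box)
  have "flat 1 (Suc n * ((x - a) \<bullet> i)) * flat 1 (Suc n * ((b - x) \<bullet> i)) = 0"
    using i(2) by (auto simp: flat_def inner_diff_left zero_less_mult_iff)
  then show ?thesis unfolding box_bump_def using i(1) by (meson finite_Basis prod_zero)
qed

lemma box_bump_tendsto: "(\<lambda>n. box_bump a b n x) \<longlonglongrightarrow> indicator (box a b) x"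
proof (cases "x \<in> box a b")
  case True
  have lim: "(\<lambda>n. flat 1 (real (Suc n) * c)) \<longlonglongrightarrow> 1" if "c > 0" for c :: real
  proof -
    have "(\<lambda>n. exp (- (1 / c) * inverse (real (Suc n)))) \<longlonglongrightarrow> exp (- (1 / c) * 0)"
      by (intro tendsto_intros LIMSEQ_inverse_real_of_nat)
    moreover have "flat 1 (real (Suc n) * c) = exp (- (1 / c) * inverse (real (Suc n)))" for n
    proof -
      have "real (Suc n) * c > 0" using that by (intro mult_pos_pos) simp_all
      then show ?thesis by (simp add: flat_def divide_simps del: of_nat_Suc)
    qed
    ultimately show ?thesis by simp
  qed
  have "(\<lambda>n. box_bump a b n x) \<longlonglongrightarrow> (\<Prod>i\<in>(Basis::'a set). 1 * 1)"
    unfolding box_bump_def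
    by (intro tendsto_prod tendsto_mult lim) (use True in \<open>auto simp: mem_box inner_diff_left\<close>)
  then show ?thesis using True by simp
qed (simp add: box_bump_outside)

lemma box_bump_test_function:
  assumes "cbox a b \<subseteq> \<Omega>"
  shows "box_bump a b n \<in> test_functions \<Omega>"
proof -
  have *: "Suc n * ((x - a) \<bullet> i) = - (Suc n * (a \<bullet> i)) + real (Suc n) * (x \<bullet> i)"
      "Suc n * ((b - x) \<bullet> i) = Suc n * (b \<bullet> i) + (- real (Suc n)) * (x \<bullet> i)" for x i
    by (simp_all only: inner_diff_left right_diff_distrib)
  have "box_bump a b n = (\<lambda>x. \<Prod>i\<in>Basis. flat 1 (- (Suc n * (a \<bullet> i)) + real (Suc n) * (x \<bullet> i)) *
                             flat 1 (Suc n * (b \<bullet> i) + (- real (Suc n)) * (x \<bullet> i)))"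
    unfolding box_bump_def[abs_def] * ..
  then have "C_k k (box_bump a b n)" for k
    by (simp only:) (intro C_k_prod C_k_mult C_k_flat_ridge)
  moreover have "\<forall>x. x \<notin> cbox a b \<longrightarrow> box_bump a b n x = 0"
    using box_bump_outside box_subset_cbox by blast
  ultimately show ?thesis
    unfolding test_functions_def mem_Collect_eq using assms
    by (intro conjI exI[of _ "cbox a b"] allI) (simp_all add: compact_cbox)
qed

lemma test_function_C_k: "\<phi> \<in> test_functions \<Omega> \<Longrightarrow> C_k k \<phi>"
  by (simp add: test_functions_def)

lemma test_function_continuous: "\<phi> \<in> test_functions \<Omega> \<Longrightarrow> continuous_on UNIV \<phi>"
  using test_function_C_k[of \<phi> \<Omega> 0] by simp

text \<open>
  Testing with bump functions shows that the mean of \<open>g\<close> over every small box vanishes, and by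
  Lebesgue's differentiation theorem these means converge to \<open>g\<close> almost everywhere.
\<close>

lemma fundamental_lemma_calculus_of_variations:
  fixes g :: "'a::euclidean_space \<Rightarrow> real"
  assumes \<Omega>: "open \<Omega>" and g: "integrable (lebesgue_on \<Omega>) g"
    and test: "\<And>\<phi>. \<phi> \<in> test_functions \<Omega> \<Longrightarrow> (\<integral>x. g x * \<phi> x \<partial>lebesgue_on \<Omega>) = 0"
  shows "AE x in lebesgue_on \<Omega>. g x = 0"
proof -
  have sets: "\<Omega> \<in> sets lebesgue" using \<Omega> by simp
  define f where "f x = (if x \<in> \<Omega> then g x else 0)" for x
  have "integrable lebesgue f"
    unfolding f_def using Lebesgue_Measure.integrable_restrict_UNIV[OF sets] g by blast
  then have f: "f integrable_on cbox a b" for a b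
    using integrable_on_lebesgue integrable_on_subcbox by blast
  have zero: "integral (cbox a b) f = 0" if ab: "cbox a b \<subseteq> \<Omega>" for a b
  proof -
    have "(\<lambda>n. \<integral>x. g x * box_bump a b n x \<partial>lebesgue_on \<Omega>)
        \<longlonglongrightarrow> (\<integral>x. g x * indicator (box a b) x \<partial>lebesgue_on \<Omega>)"
    proof (rule integral_dominated_convergence)
      have bump: "box_bump a b n \<in> borel_measurable (lebesgue_on \<Omega>)" for n
        using test_function_continuous[OF box_bump_test_function[OF ab]] continuous_on_subset
        by (intro continuous_imp_measurable_on_sets_lebesgue sets) blast
      show "(\<lambda>x. g x * box_bump a b n x) \<in> borel_measurable (lebesgue_on \<Omega>)" for n
        using bump[of n] g by measurable
      have "indicator (box a b) \<in> borel_measurable lebesgue"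
        by (intro borel_measurable_indicator) simp
      then have "indicator (box a b) \<in> borel_measurable (lebesgue_on \<Omega>)"
        by (rule measurable_restrict_space1)
      then show "(\<lambda>x. g x * indicator (box a b) x) \<in> borel_measurable (lebesgue_on \<Omega>)"
        using g by measurable
      show "integrable (lebesgue_on \<Omega>) (\<lambda>x. \<bar>g x\<bar>)" using g by simp
      show "AE x in lebesgue_on \<Omega>. (\<lambda>n. g x * box_bump a b n x) \<longlonglongrightarrow> g x * indicator (box a b) x"
        by (intro AE_I2 tendsto_mult tendsto_const box_bump_tendsto)
      show "AE x in lebesgue_on \<Omega>. norm (g x * box_bump a b n x) \<le> \<bar>g x\<bar>" for n
        using box_bump_bounds[of a b n] by (intro AE_I2) (simp add: abs_mult mult_left_le)
    qed
    moreover have "(\<integral>x. g x * box_bump a b n x \<partial>lebesgue_on \<Omega>) = 0" for n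
      using test[OF box_bump_test_function[OF ab]] .
    ultimately have "(\<integral>x. g x * indicator (box a b) x \<partial>lebesgue_on \<Omega>) = 0"
      by (simp add: LIMSEQ_const_iff)
    also have "(\<lambda>x. g x * indicator (box a b) x) = (\<lambda>x. if x \<in> box a b then g x else 0)"
      by (auto simp: indicator_def)
    also have "(\<integral>x. (if x \<in> box a b then g x else 0) \<partial>lebesgue_on \<Omega>) = (\<integral>x. g x \<partial>lebesgue_on (box a b))"
      using ab box_subset_cbox[of a b] sets by (intro Lebesgue_Measure.integral_restrict) auto
    also have "\<dots> = integral (box a b) g"
    proof (rule lebesgue_integral_eq_integral)
      have "integrable (lebesgue_on (box a b)) f"
        using integrable_mult_indicator[OF _ \<open>integrable lebesgue f\<close>, of "box a b"]
        by (simp add: Bochner_Integration.integrable_restrict_space)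
      moreover have "f x = g x" if "x \<in> box a b" for x
        using that ab box_subset_cbox[of a b] by (auto simp: f_def)
      ultimately show "integrable (lebesgue_on (box a b)) g"
        using Bochner_Integration.integrable_cong[of "lebesgue_on (box a b)" "lebesgue_on (box a b)" f g]
        by simp
    qed auto
    also have "\<dots> = integral (cbox a b) g" by (rule integral_open_interval)
    also have "\<dots> = integral (cbox a b) f" 
      using ab by (intro Henstock_Kurzweil_Integration.integral_cong) (auto simp: f_def)
    finally show ?thesis by simp
  qed
  obtain N where N: "negligible N"
    and means: "\<And>x e. \<lbrakk>x \<notin> N; 0 < e\<rbrakk> \<Longrightarrow> \<exists>d>0. \<forall>h. 0 < h \<and> h < d \<longrightarrow>
        norm (integral (cbox x (x + h *\<^sub>R One)) f /\<^sub>R h ^ DIM('a) - f x) < e"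
    using integrable_ccontinuous_explicit[OF f] by blast
  have "g x = 0" if x: "x \<in> \<Omega>" "x \<notin> N" for x
  proof (rule ccontr)
    assume "g x \<noteq> 0"
    then obtain d where d: "d > 0" "\<And>h. 0 < h \<Longrightarrow> h < d \<Longrightarrow>
        norm (integral (cbox x (x + h *\<^sub>R One)) f /\<^sub>R h ^ DIM('a) - f x) < \<bar>g x\<bar>"
      using means[OF x(2), of "\<bar>g x\<bar>"] by auto
    obtain r where r: "r > 0" "ball x r \<subseteq> \<Omega>" using \<Omega> x(1) openE by blast
    define h where "h = min d (r / DIM('a)) / 2"
    have h: "0 < h" "h < d" "h * DIM('a) < r"
      using d(1) r(1) by (auto simp: h_def min_def field_simps)
    have "cbox x (x + h *\<^sub>R One) \<subseteq> ball x r"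
    proof
      fix y assume "y \<in> cbox x (x + h *\<^sub>R One)"
      then have "\<bar>(y - x) \<bullet> i\<bar> \<le> h" if "i \<in> Basis" for i
        using that by (auto simp: mem_box inner_diff_left inner_add_left abs_le_iff)
      then have "(\<Sum>i\<in>Basis. \<bar>(y - x) \<bullet> i\<bar>) \<le> DIM('a) * h"
        using sum_bounded_above[of Basis] by (metis (no_types, lifting))
      then show "y \<in> ball x r"
        using norm_le_l1[of "y - x"] h(3) by (simp add: dist_norm norm_minus_commute mult.commute)
    qed
    then have "integral (cbox x (x + h *\<^sub>R One)) f = 0" using r(2) by (intro zero) blast
    then show False using d(2)[OF h(1,2)] x(1) by (simp add: f_def)
  qed
  then have "AE x in lebesgue. x \<in> \<Omega> \<longrightarrow> g x = 0"
    using N by (intro AE_I'[of N]) (auto simp: negligible_iff_null_sets)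
  then show ?thesis using sets by (simp add: AE_restrict_space_iff)
qed

section \<open>Integration by parts and weak gradients\<close>

lemma continuous_compact_support_L2:
  fixes f :: "'a::euclidean_space \<Rightarrow> 'b::euclidean_space"
  assumes "continuous_on UNIV f" "compact S" "\<And>x. x \<notin> S \<Longrightarrow> f x = 0" "\<Omega> \<in> sets lebesgue"
  shows "f \<in> L2 \<Omega>"
proof -
  have "integrable lborel (\<lambda>x. indicator S x *\<^sub>R (norm (f x))\<^sup>2)"
    using assms(1,2) continuous_on_subset[of UNIV f S]
    by (intro borel_integrable_compact continuous_intros) auto
  moreover have "(\<lambda>x. indicator S x *\<^sub>R (norm (f x))\<^sup>2) = (\<lambda>x. (norm (f x))\<^sup>2)"
    by (rule ext, rename_tac x, case_tac "x \<in> S") (simp_all add: assms(3))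
  ultimately have "integrable lborel (\<lambda>x. (norm (f x))\<^sup>2)" by simp
  then have "integrable lebesgue (\<lambda>x. (norm (f x))\<^sup>2)"
    by (subst integrable_completion) auto
  then have "integrable (lebesgue_on \<Omega>) (\<lambda>x. (norm (f x))\<^sup>2)"
    using assms(4) integrable_mult_indicator[of \<Omega> lebesgue "\<lambda>x. (norm (f x))\<^sup>2"]
    by (simp add: Bochner_Integration.integrable_restrict_space)
  moreover have "f \<in> borel_measurable (lebesgue_on \<Omega>)"
    using assms(1,4) continuous_on_subset[of UNIV f \<Omega>]
    by (intro continuous_imp_measurable_on_sets_lebesgue) auto
  ultimately show ?thesis by (simp add: L2_def)
qed

lemma integral_lebesgue_on_support:
  fixes f :: "'a::euclidean_space \<Rightarrow> real"
  assumes "continuous_on UNIV f" "\<And>x. x \<notin> \<Omega> \<Longrightarrow> f x = 0" "\<Omega> \<in> sets lebesgue"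
  shows "integral\<^sup>L (lebesgue_on \<Omega>) f = integral\<^sup>L lborel f"
proof -
  have "(\<lambda>x. if x \<in> \<Omega> then f x else 0) = f" using assms(2) by auto
  then have "integral\<^sup>L (lebesgue_on \<Omega>) f = integral\<^sup>L lebesgue f"
    using Lebesgue_Measure.integral_restrict_UNIV[OF assms(3), of f] by simp
  also have "\<dots> = integral\<^sup>L lborel f"
    using borel_measurable_continuous_onI[OF assms(1)] by (intro integral_completion) simp
  finally show ?thesis .
qed

text \<open>
  Translations do not change the integral of \<open>f\<close>, so all difference quotients of \<open>f\<close> have integral
  zero; they converge to the partial derivative dominatedly.
\<close>

lemma integral_partial_deriv_eq_0:
  fixes f :: "'a::euclidean_space \<Rightarrow> real"
  assumes f: "C_k (Suc 0) f" and S: "compact S" "\<And>x. x \<notin> S \<Longrightarrow> f x = 0" and i: "i \<in> Basis"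
  shows "integral\<^sup>L lborel (partial_deriv i f) = 0"
proof -
  define g where "g = partial_deriv i f"
  have g: "continuous_on UNIV g" using f i by (simp add: g_def)
  have fc: "continuous_on UNIV f" using C_k_Suc_imp_C_k[OF f] by simp
  have deriv: "((\<lambda>t. f (x + t *\<^sub>R i)) has_real_derivative g (x + t *\<^sub>R i)) (at t)" for x t
  proof -
    have "((\<lambda>t. f (x + t *\<^sub>R i)) has_derivative
        (\<lambda>s. frechet_derivative f (at (x + t *\<^sub>R i)) (s *\<^sub>R i))) (at t)"
      by (rule has_derivative_compose[OF _ C_k_Suc_has_derivative[OF f]])
         (auto intro!: derivative_eq_intros)
    moreover have "frechet_derivative f (at y) (s *\<^sub>R i) = g y * s" for y s
      using linear_scale[OF has_derivative_linear[OF C_k_Suc_has_derivative[OF f, of y]], of s i]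
      by (simp add: g_def partial_deriv_def)
    ultimately show ?thesis by (simp add: has_field_derivative_def)
  qed
  obtain R where R: "S \<subseteq> cball 0 R" using compact_imp_bounded[OF S(1)]
    by (auto simp: bounded_iff subset_iff)
  have "bounded (g ` cball 0 (R + 2))"
    using continuous_on_subset[OF g, of "cball 0 (R + 2)"]
    by (intro compact_imp_bounded compact_continuous_image) auto
  then obtain B where B': "\<forall>y\<in>g ` cball 0 (R + 2). norm y \<le> B"
    unfolding bounded_iff by blast
  have B: "\<bar>g x\<bar> \<le> B" if "x \<in> cball 0 (R + 2)" for x
    using B' that by (metis imageI real_norm_def)
  \<comment> \<open>The steps are at most \<open>1\<close>, so the quotients live on the ball of radius \<open>R + 1\<close>, and the points from the
    mean value theorem stay in the ball of radius \<open>R + 2\<close>.\<close>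
  define h where "h n = inverse (real (Suc n))" for n
  have h: "0 < h n" "h n \<le> 1" for n by (auto simp: h_def field_simps)
  have h0: "h \<longlonglongrightarrow> 0" unfolding h_def by (rule LIMSEQ_inverse_real_of_nat)
  define D where "D n x = (f (h n *\<^sub>R i + x) - f x) / h n" for n x
  have outside: "D n x = 0" if "x \<notin> cball 0 (R + 1)" for n x
  proof -
    have "norm x \<le> norm (h n *\<^sub>R i + x) + h n"
      using norm_triangle_ineq4[of "h n *\<^sub>R i + x" "h n *\<^sub>R i"] h(1)[of n] i by simp
    then have "norm (h n *\<^sub>R i + x) > R" "norm x > R" using that h(2)[of n] by auto
    then have "h n *\<^sub>R i + x \<notin> S" "x \<notin> S" using R by auto
    then have "f (h n *\<^sub>R i + x) = 0" "f x = 0" using S(2) by blast+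
    then show ?thesis by (simp add: D_def)
  qed
  have lim: "(\<lambda>n. D n x) \<longlonglongrightarrow> g x" for x
  proof -
    have "((\<lambda>t. (f (x + t *\<^sub>R i) - f x) / t) \<longlongrightarrow> g x) (at 0)"
      using deriv[of x 0] by (simp add: has_field_derivative_iff)
    moreover have "filterlim h (at 0) sequentially"
      using h0 h(1) by (auto simp: filterlim_at intro!: always_eventually) (metis less_irrefl)
    ultimately have "(\<lambda>n. (f (x + h n *\<^sub>R i) - f x) / h n) \<longlonglongrightarrow> g x"
      by (rule filterlim_compose)
    then show ?thesis by (simp add: D_def add.commute)
  qed
  have bound: "\<bar>D n x\<bar> \<le> indicator (cball 0 (R + 1)) x *\<^sub>R B" for n x
  proof (cases "x \<in> cball 0 (R + 1)")
    case True
    obtain z where z: "0 < z" "z < h n" "f (x + h n *\<^sub>R i) - f (x + 0 *\<^sub>R i) = (h n - 0) * g (x + z *\<^sub>R i)"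
      using MVT2[of 0 "h n" "\<lambda>t. f (x + t *\<^sub>R i)" "\<lambda>t. g (x + t *\<^sub>R i)"] deriv h(1)[of n] by blast
    have "norm (x + z *\<^sub>R i) \<le> norm x + z"
      using norm_triangle_ineq[of x "z *\<^sub>R i"] z(1) i by simp
    then have "x + z *\<^sub>R i \<in> cball 0 (R + 2)" using True z(2) h(2)[of n] by simp
    moreover have "D n x = g (x + z *\<^sub>R i)" using z(3) h(1)[of n] by (simp add: D_def add.commute)
    ultimately show ?thesis using B True by simp
  qed (simp add: outside)
  have meas: "f \<in> borel_measurable borel" "g \<in> borel_measurable borel"
    using fc g by (auto intro: borel_measurable_continuous_onI)
  have D_meas: "D n \<in> borel_measurable lborel" for n
    unfolding D_def[abs_def] using meas by measurable
  have fint: "integrable lborel f"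
  proof -
    have "integrable lborel (\<lambda>x. indicator S x *\<^sub>R f x)"
      using continuous_on_subset[OF fc, of S] S(1) by (intro borel_integrable_compact) auto
    moreover have "(\<lambda>x. indicator S x *\<^sub>R f x) = f"
      by (rule ext, rename_tac x, case_tac "x \<in> S") (simp_all add: S(2))
    ultimately show ?thesis by simp
  qed
  have "integral\<^sup>L lborel (D n) = 0" for n
  proof -
    have d: "lborel = distr lborel borel ((+) (h n *\<^sub>R i))" by (simp add: lborel_distr_plus)
    have "integrable (distr lborel borel ((+) (h n *\<^sub>R i))) f" using fint d by metis
    then have sint: "integrable lborel (\<lambda>x. f (h n *\<^sub>R i + x))"
      by (subst (asm) integrable_distr_eq) (use meas in auto)
    have "integral\<^sup>L lborel f = integral\<^sup>L (distr lborel borel ((+) (h n *\<^sub>R i))) f" using d by metis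
    also have "\<dots> = (\<integral>x. f (h n *\<^sub>R i + x) \<partial>lborel)"
      by (subst integral_distr) (use meas in auto)
    finally show ?thesis unfolding D_def[abs_def] using sint fint by simp
  qed
  moreover have "(\<lambda>n. integral\<^sup>L lborel (D n)) \<longlonglongrightarrow> integral\<^sup>L lborel g"
  proof (rule integral_dominated_convergence[where w = "\<lambda>x. indicator (cball 0 (R + 1)) x *\<^sub>R B"])
    show "integrable lborel (\<lambda>x. indicator (cball 0 (R + 1)) x *\<^sub>R B)"
      by (intro borel_integrable_compact) auto
  qed (use meas D_meas lim bound in auto)
  ultimately show ?thesis by (simp add: g_def LIMSEQ_const_iff)
qed

lemma test_functionE:
  assumes "\<phi> \<in> test_functions \<Omega>"
  obtains S where "compact S" "S \<subseteq> \<Omega>" "\<And>x. x \<notin> S \<Longrightarrow> \<phi> x = 0"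
  using assms that unfolding test_functions_def by auto

lemma test_function_outside: "\<phi> \<in> test_functions \<Omega> \<Longrightarrow> x \<notin> \<Omega> \<Longrightarrow> \<phi> x = 0"
  by (meson test_functionE subsetD)

lemma test_functionI:
  "(\<And>k. C_k k \<phi>) \<Longrightarrow> compact S \<Longrightarrow> S \<subseteq> \<Omega> \<Longrightarrow> (\<And>x. x \<notin> S \<Longrightarrow> \<phi> x = 0) \<Longrightarrow> \<phi> \<in> test_functions \<Omega>"
  unfolding test_functions_def by auto

lemma test_function_partial_deriv:
  assumes \<phi>: "\<phi> \<in> test_functions \<Omega>" and i: "i \<in> Basis"
  shows "partial_deriv i \<phi> \<in> test_functions \<Omega>"
proof -
  obtain S where S: "compact S" "S \<subseteq> \<Omega>" "\<And>x. x \<notin> S \<Longrightarrow> \<phi> x = 0"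
    using test_functionE[OF \<phi>] by blast
  show ?thesis
  proof (rule test_functionI[OF _ S(1,2)])
    show "C_k k (partial_deriv i \<phi>)" for k
      using test_function_C_k[OF \<phi>, of "Suc k"] i by simp
    show "partial_deriv i \<phi> x = 0" if "x \<notin> S" for x
    proof -
      have "(\<phi> has_derivative (\<lambda>h. 0)) (at x)"
        by (rule has_derivative_transform_within_open[where f = "\<lambda>x. 0" and s = "- S"])
           (use S that in \<open>auto simp: compact_imp_closed\<close>)
      then show ?thesis by (rule partial_deriv_eq)
    qed
  qed
qed

lemma test_function_combine:
  assumes "\<phi> \<in> test_functions \<Omega>" "\<psi> \<in> test_functions \<Omega>"
  shows "(\<lambda>x. \<phi> x + c * \<psi> x) \<in> test_functions \<Omega>"
proof -
  obtain S S' where S: "compact S" "S \<subseteq> \<Omega>" "\<And>x. x \<notin> S \<Longrightarrow> \<phi> x = 0"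
    and S': "compact S'" "S' \<subseteq> \<Omega>" "\<And>x. x \<notin> S' \<Longrightarrow> \<psi> x = 0"
    using assms by (metis test_functionE)
  show ?thesis
  proof (rule test_functionI[where S = "S \<union> S'"])
    show "C_k k (\<lambda>x. \<phi> x + c * \<psi> x)" for k
      using C_k_combine[OF test_function_C_k[OF assms(1)] test_function_C_k[OF assms(2)]] .
  qed (use S S' in \<open>simp_all add: compact_Un\<close>)
qed

lemma test_function_zero: "(\<lambda>x. 0) \<in> test_functions \<Omega>"
  by (rule test_functionI[where S = "{}"]) (simp_all add: C_k_const)

lemma test_function_L2:
  assumes "\<phi> \<in> test_functions \<Omega>" "\<Omega> \<in> sets lebesgue"
  shows "\<phi> \<in> L2 \<Omega>"
proof -
  obtain S where S: "compact S" "S \<subseteq> \<Omega>" "\<And>x. x \<notin> S \<Longrightarrow> \<phi> x = 0"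
    using test_functionE[OF assms(1)] by blast
  show ?thesis
    by (rule continuous_compact_support_L2[OF test_function_continuous[OF assms(1)] S(1) S(3) assms(2)])
qed

lemma test_function_scaleR_L2:
  assumes "\<phi> \<in> test_functions \<Omega>" "\<Omega> \<in> sets lebesgue"
  shows "(\<lambda>x. \<phi> x *\<^sub>R i) \<in> L2 \<Omega>"
proof -
  obtain S where S: "compact S" "S \<subseteq> \<Omega>" "\<And>x. x \<notin> S \<Longrightarrow> \<phi> x = 0"
    using test_functionE[OF assms(1)] by blast
  show ?thesis
  proof (rule continuous_compact_support_L2[OF _ S(1) _ assms(2)])
    show "continuous_on UNIV (\<lambda>x. \<phi> x *\<^sub>R i)"
      by (intro continuous_on_scaleR continuous_on_const test_function_continuous[OF assms(1)])
  qed (simp add: S(3))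
qed

text \<open>Both sides of the defining identity of weak gradients are \<open>L\<^sup>2\<close> inner products.\<close>

lemma is_weak_gradient_L2_ip:
  "is_weak_gradient \<Omega> u G \<longleftrightarrow> (\<forall>\<phi>\<in>test_functions \<Omega>. \<forall>i\<in>Basis.
     L2_ip \<Omega> u (partial_deriv i \<phi>) = - L2_ip \<Omega> G (\<lambda>x. \<phi> x *\<^sub>R i))"
  unfolding is_weak_gradient_def L2_ip_def by (simp add: mult.commute)

lemma is_weak_gradient_combine:
  assumes "u \<in> L2 \<Omega>" "v \<in> L2 \<Omega>" "G \<in> L2 \<Omega>" "G' \<in> L2 \<Omega>" "\<Omega> \<in> sets lebesgue"
    and "is_weak_gradient \<Omega> u G" "is_weak_gradient \<Omega> v G'"
  shows "is_weak_gradient \<Omega> (\<lambda>x. u x + c *\<^sub>R v x) (\<lambda>x. G x + c *\<^sub>R G' x)"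
  unfolding is_weak_gradient_L2_ip
proof (intro ballI)
  fix \<phi> :: "'a \<Rightarrow> real" and i :: 'a assume \<phi>: "\<phi> \<in> test_functions \<Omega>" and i: "i \<in> Basis"
  have "L2_ip \<Omega> u (partial_deriv i \<phi>) = - L2_ip \<Omega> G (\<lambda>x. \<phi> x *\<^sub>R i)"
    "L2_ip \<Omega> v (partial_deriv i \<phi>) = - L2_ip \<Omega> G' (\<lambda>x. \<phi> x *\<^sub>R i)"
    using assms(6,7) \<phi> i unfolding is_weak_gradient_L2_ip by blast+
  then show "L2_ip \<Omega> (\<lambda>x. u x + c *\<^sub>R v x) (partial_deriv i \<phi>)
      = - L2_ip \<Omega> (\<lambda>x. G x + c *\<^sub>R G' x) (\<lambda>x. \<phi> x *\<^sub>R i)"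
    using L2.combine_left[OF assms(1,2) test_function_L2[OF test_function_partial_deriv[OF \<phi> i] assms(5)], of c]
      L2.combine_left[OF assms(3,4) test_function_scaleR_L2[OF \<phi> assms(5)], of c i] by simp
qed

section \<open>The spaces \<open>H\<^sup>1\<close> and \<open>H\<^sub>0\<^sup>1\<close> on a bounded open set\<close>

abbreviation dirichlet :: "'a::euclidean_space set \<Rightarrow> ('a \<Rightarrow> real) \<Rightarrow> ('a \<Rightarrow> real) \<Rightarrow> real" where
  "dirichlet \<Omega> u v \<equiv> L2_ip \<Omega> (grad \<Omega> u) (grad \<Omega> v)"

lemma H10_nrm_power2: "(H10_nrm \<Omega> u)\<^sup>2 = dirichlet \<Omega> u u"
  by (simp add: H10_nrm_def L2_nrm_power2)

locale bounded_open =
  fixes \<Omega> :: "'a::euclidean_space set"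
  assumes open_domain: "open \<Omega>" and bounded_domain: "bounded \<Omega>"
begin

lemma domain_sets: "\<Omega> \<in> sets lebesgue"
  using open_domain by simp

lemma L2_imp_integrable:
  fixes u :: "'a \<Rightarrow> real"
  assumes "u \<in> L2 \<Omega>"
  shows "integrable (lebesgue_on \<Omega>) u"
proof -
  have "integrable (lebesgue_on \<Omega>) (\<lambda>x. 1 :: real)"
    using bounded_domain domain_sets
    by (intro finite_measure.integrable_const finite_measure_lebesgue_on bounded_set_imp_lmeasurable)
  then have "(\<lambda>x. 1 :: real) \<in> L2 \<Omega>" by (simp add: L2_def)
  from L2_ip_integrable[OF assms this] show ?thesis by simp
qed

text \<open>
  The fundamental lemma applies to each component of the difference of two weak gradients.
\<close>

lemma weak_gradient_unique:
  assumes G: "G \<in> L2 \<Omega>" "is_weak_gradient \<Omega> u G" and G': "G' \<in> L2 \<Omega>" "is_weak_gradient \<Omega> u G'"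
  shows "AE x in lebesgue_on \<Omega>. G x = G' x"
proof -
  have "AE x in lebesgue_on \<Omega>. (G x - G' x) \<bullet> i = 0" if i: "i \<in> Basis" for i
  proof (rule fundamental_lemma_calculus_of_variations[OF open_domain])
    have D: "(\<lambda>x. G x - G' x) \<in> L2 \<Omega>" using L2.diff_mem[OF G(1) G'(1)] .
    have "(\<lambda>x. (G x - G' x) \<bullet> i) \<in> L2 \<Omega>"
      unfolding L2_def
    proof (intro CollectI conjI)
      show *: "(\<lambda>x. (G x - G' x) \<bullet> i) \<in> borel_measurable (lebesgue_on \<Omega>)"
        using D by (intro borel_measurable_inner borel_measurable_const) (simp add: L2_def)
      show "integrable (lebesgue_on \<Omega>) (\<lambda>x. (norm ((G x - G' x) \<bullet> i))\<^sup>2)"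
      proof (rule Bochner_Integration.integrable_bound)
        show "integrable (lebesgue_on \<Omega>) (\<lambda>x. (norm (G x - G' x))\<^sup>2)"
          using D by (simp add: L2_def)
        show "(\<lambda>x. (norm ((G x - G' x) \<bullet> i))\<^sup>2) \<in> borel_measurable (lebesgue_on \<Omega>)"
          using * by measurable
        have "\<bar>(G x - G' x) \<bullet> i\<bar> \<le> norm (G x - G' x)" for x
          using Basis_le_norm[OF i] by blast
        then show "AE x in lebesgue_on \<Omega>. norm ((norm ((G x - G' x) \<bullet> i))\<^sup>2) \<le> norm ((norm (G x - G' x))\<^sup>2)"
          by (intro AE_I2) (simp add: abs_le_square_iff[symmetric])
      qed
    qed
    then show "integrable (lebesgue_on \<Omega>) (\<lambda>x. (G x - G' x) \<bullet> i)" by (rule L2_imp_integrable)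
    fix \<phi> assume \<phi>: "\<phi> \<in> test_functions \<Omega>"
    have "L2_ip \<Omega> G (\<lambda>x. \<phi> x *\<^sub>R i) = L2_ip \<Omega> G' (\<lambda>x. \<phi> x *\<^sub>R i)"
      using G(2) G'(2) \<phi> i unfolding is_weak_gradient_L2_ip by fastforce
    then have "L2_ip \<Omega> (\<lambda>x. G x - G' x) (\<lambda>x. \<phi> x *\<^sub>R i) = 0"
      using L2.diff_left[OF G(1) G'(1) test_function_scaleR_L2[OF \<phi> domain_sets], of i] by simp
    then show "(\<integral>x. (G x - G' x) \<bullet> i * \<phi> x \<partial>lebesgue_on \<Omega>) = 0"
      by (simp add: L2_ip_def mult.commute)
  qed
  then have "AE x in lebesgue_on \<Omega>. \<forall>i\<in>Basis. (G x - G' x) \<bullet> i = 0"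
    by (intro AE_finite_allI) auto
  then show ?thesis
    by eventually_elim (auto simp: euclidean_eq_iff[where 'a='a] inner_diff_left)
qed

lemma grad_L2: "u \<in> H1 \<Omega> \<Longrightarrow> grad \<Omega> u \<in> L2 \<Omega>"
  and grad_weak: "u \<in> H1 \<Omega> \<Longrightarrow> is_weak_gradient \<Omega> u (grad \<Omega> u)"
proof -
  assume "u \<in> H1 \<Omega>"
  then have "\<exists>G. G \<in> L2 \<Omega> \<and> is_weak_gradient \<Omega> u G" by (auto simp: H1_def)
  from someI_ex[OF this] show "grad \<Omega> u \<in> L2 \<Omega>" "is_weak_gradient \<Omega> u (grad \<Omega> u)"
    unfolding grad_def by blast+
qed

lemma grad_unique:
  assumes "u \<in> L2 \<Omega>" "G \<in> L2 \<Omega>" "is_weak_gradient \<Omega> u G"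
  shows "u \<in> H1 \<Omega>" "AE x in lebesgue_on \<Omega>. grad \<Omega> u x = G x"
proof -
  show u: "u \<in> H1 \<Omega>" unfolding H1_def using assms by blast
  show "AE x in lebesgue_on \<Omega>. grad \<Omega> u x = G x"
    using weak_gradient_unique[OF grad_L2[OF u] grad_weak[OF u] assms(2,3)] .
qed

lemma H1_L2: "u \<in> H1 \<Omega> \<Longrightarrow> u \<in> L2 \<Omega>"
  by (simp add: H1_def)

lemma H1_combine:
  assumes "u \<in> H1 \<Omega>" "v \<in> H1 \<Omega>"
  shows "(\<lambda>x. u x + c *\<^sub>R v x) \<in> H1 \<Omega>"
    and "AE x in lebesgue_on \<Omega>. grad \<Omega> (\<lambda>x. u x + c *\<^sub>R v x) x = grad \<Omega> u x + c *\<^sub>R grad \<Omega> v x"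
proof -
  note * = L2_combine[OF H1_L2[OF assms(1)] H1_L2[OF assms(2)], of c]
    L2_combine[OF grad_L2[OF assms(1)] grad_L2[OF assms(2)], of c]
    is_weak_gradient_combine[OF H1_L2[OF assms(1)] H1_L2[OF assms(2)] grad_L2[OF assms(1)]
      grad_L2[OF assms(2)] domain_sets grad_weak[OF assms(1)] grad_weak[OF assms(2)], of c]
  show "(\<lambda>x. u x + c *\<^sub>R v x) \<in> H1 \<Omega>" using grad_unique(1)[OF *] .
  show "AE x in lebesgue_on \<Omega>. grad \<Omega> (\<lambda>x. u x + c *\<^sub>R v x) x = grad \<Omega> u x + c *\<^sub>R grad \<Omega> v x"
    using grad_unique(2)[OF *] .
qed

lemma H1_zero: "(\<lambda>x. 0) \<in> H1 \<Omega>"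
  by (rule grad_unique(1)[OF L2.zero_mem L2.zero_mem]) (simp add: is_weak_gradient_def)

sublocale H1: semi_inner_functions "H1 \<Omega>" "dirichlet \<Omega>"
proof
  fix u v w :: "'a \<Rightarrow> real" and c :: real
  show "(\<lambda>x. 0 :: real) \<in> H1 \<Omega>" by (rule H1_zero)
  assume u: "u \<in> H1 \<Omega>"
  show "0 \<le> dirichlet \<Omega> u u" by (simp add: L2_ip_def)
  assume v: "v \<in> H1 \<Omega>"
  show "(\<lambda>x. u x + c *\<^sub>R v x) \<in> H1 \<Omega>" by (rule H1_combine(1)[OF u v])
  show "dirichlet \<Omega> u v = dirichlet \<Omega> v u" using L2.sym[OF grad_L2[OF u] grad_L2[OF v]] .
  assume w: "w \<in> H1 \<Omega>"
  have "dirichlet \<Omega> (\<lambda>x. u x + c *\<^sub>R v x) w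
      = L2_ip \<Omega> (\<lambda>x. grad \<Omega> u x + c *\<^sub>R grad \<Omega> v x) (grad \<Omega> w)"
    by (intro L2_ip_cong_AE grad_L2 H1_combine L2_combine u v w AE_I2) simp
  then show "dirichlet \<Omega> (\<lambda>x. u x + c *\<^sub>R v x) w = dirichlet \<Omega> u w + c * dirichlet \<Omega> v w"
    using L2.combine_left[OF grad_L2[OF u] grad_L2[OF v] grad_L2[OF w]] by simp
qed

text \<open>The associated norm of the following inner product is \<open>H1_nrm\<close>.\<close>

sublocale H1_full: semi_inner_functions "H1 \<Omega>" "\<lambda>u v. L2_ip \<Omega> u v + dirichlet \<Omega> u v"
proof
  fix u v w :: "'a \<Rightarrow> real" and c :: real
  show "(\<lambda>x. 0 :: real) \<in> H1 \<Omega>" by (rule H1_zero)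
  assume u: "u \<in> H1 \<Omega>"
  show "0 \<le> L2_ip \<Omega> u u + dirichlet \<Omega> u u" by (simp add: L2_ip_def)
  assume v: "v \<in> H1 \<Omega>"
  show "(\<lambda>x. u x + c *\<^sub>R v x) \<in> H1 \<Omega>" by (rule H1_combine(1)[OF u v])
  show "L2_ip \<Omega> u v + dirichlet \<Omega> u v = L2_ip \<Omega> v u + dirichlet \<Omega> v u"
    using H1.sym[OF u v] L2.sym[OF H1_L2[OF u] H1_L2[OF v]] by simp
  assume w: "w \<in> H1 \<Omega>"
  show "L2_ip \<Omega> (\<lambda>x. u x + c *\<^sub>R v x) w + dirichlet \<Omega> (\<lambda>x. u x + c *\<^sub>R v x) w
      = L2_ip \<Omega> u w + dirichlet \<Omega> u w + c * (L2_ip \<Omega> v w + dirichlet \<Omega> v w)"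
    using H1.combine_left[OF u v w, of c] L2.combine_left[OF H1_L2[OF u] H1_L2[OF v] H1_L2[OF w], of c]
    by (simp add: algebra_simps)
qed

lemma H1_nrm_eq: "H1_nrm \<Omega> u = sqrt (L2_ip \<Omega> u u + dirichlet \<Omega> u u)"
  by (simp add: H1_nrm_def L2_nrm_power2)

lemma H1_nrm_ge: "L2_nrm \<Omega> u \<le> H1_nrm \<Omega> u" "H10_nrm \<Omega> u \<le> H1_nrm \<Omega> u"
  by (simp_all add: H1_nrm_eq L2_nrm_def H10_nrm_def L2_ip_def)

definition classical_grad :: "('a \<Rightarrow> real) \<Rightarrow> 'a \<Rightarrow> 'a" where
  "classical_grad \<phi> x = (\<Sum>i\<in>Basis. partial_deriv i \<phi> x *\<^sub>R i)"

lemma classical_grad_inner: "i \<in> Basis \<Longrightarrow> classical_grad \<phi> x \<bullet> i = partial_deriv i \<phi> x"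
  by (simp add: classical_grad_def)

lemma classical_grad_L2:
  assumes \<phi>: "\<phi> \<in> test_functions \<Omega>"
  shows "classical_grad \<phi> \<in> L2 \<Omega>"
proof -
  have "(\<lambda>x. \<Sum>i\<in>B. partial_deriv i \<phi> x *\<^sub>R i) \<in> L2 \<Omega>" if "B \<subseteq> Basis" for B
    using finite_subset[OF that finite_Basis] that
  proof (induction B rule: finite_induct)
    case empty
    show ?case using L2.zero_mem by simp
  next
    case (insert i B)
    have "(\<lambda>x. \<Sum>i\<in>B. partial_deriv i \<phi> x *\<^sub>R i) \<in> L2 \<Omega>" using insert by simp
    from L2.add_mem[OF test_function_scaleR_L2[OF test_function_partial_deriv[OF \<phi>] domain_sets] this, of i i]
    show ?case using insert by simp
  qed
  then show ?thesis unfolding classical_grad_def[abs_def] by blast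
qed

text \<open>
  Integration by parts, in which only one factor needs compact support. It shows that classical
  gradients are weak gradients, and Poincare's inequality uses it with a polynomial factor.
\<close>

lemma integral_partial_deriv_test_mult:
  assumes \<phi>: "\<phi> \<in> test_functions \<Omega>" and f: "C_k (Suc 0) f" and i: "i \<in> Basis"
  shows "(\<integral>x. \<phi> x * partial_deriv i f x + partial_deriv i \<phi> x * f x \<partial>lebesgue_on \<Omega>) = 0"
proof -
  obtain S where S: "compact S" "S \<subseteq> \<Omega>" "\<And>x. x \<notin> S \<Longrightarrow> \<phi> x = 0"
    using test_functionE[OF \<phi>] by blast
  have C: "C_k (Suc 0) (\<lambda>x. \<phi> x * f x)" by (rule C_k_mult[OF test_function_C_k[OF \<phi>] f])
  have eq: "partial_deriv i (\<lambda>x. \<phi> x * f x) = (\<lambda>x. \<phi> x * partial_deriv i f x + partial_deriv i \<phi> x * f x)"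
    by (rule C_k_mult_partial[OF test_function_C_k[OF \<phi>] f])
  have "continuous_on UNIV (partial_deriv i (\<lambda>x. \<phi> x * f x))" using C i by simp
  then have "integral\<^sup>L (lebesgue_on \<Omega>) (partial_deriv i (\<lambda>x. \<phi> x * f x))
      = integral\<^sup>L lborel (partial_deriv i (\<lambda>x. \<phi> x * f x))"
  proof (rule integral_lebesgue_on_support[OF _ _ domain_sets])
    show "partial_deriv i (\<lambda>x. \<phi> x * f x) x = 0" if "x \<notin> \<Omega>" for x
      unfolding eq using test_function_outside[OF \<phi> that]
        test_function_outside[OF test_function_partial_deriv[OF \<phi> i] that] by simp
  qed
  also have "\<dots> = 0"
    by (rule integral_partial_deriv_eq_0[OF C S(1) _ i]) (simp add: S(3))
  finally show ?thesis unfolding eq .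
qed

lemma test_function_grad:
  assumes \<phi>: "\<phi> \<in> test_functions \<Omega>"
  shows "\<phi> \<in> H1 \<Omega>" "AE x in lebesgue_on \<Omega>. grad \<Omega> \<phi> x = classical_grad \<phi> x"
proof -
  have weak: "is_weak_gradient \<Omega> \<phi> (classical_grad \<phi>)"
    unfolding is_weak_gradient_def
  proof (intro ballI)
    fix \<psi> :: "'a \<Rightarrow> real" and i :: 'a assume \<psi>: "\<psi> \<in> test_functions \<Omega>" and i: "i \<in> Basis"
    have "integrable (lebesgue_on \<Omega>) (\<lambda>x. \<phi> x * partial_deriv i \<psi> x)"
      "integrable (lebesgue_on \<Omega>) (\<lambda>x. partial_deriv i \<phi> x * \<psi> x)"
      using L2_ip_integrable[OF test_function_L2[OF \<phi> domain_sets]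
          test_function_L2[OF test_function_partial_deriv[OF \<psi> i] domain_sets]]
        L2_ip_integrable[OF test_function_L2[OF test_function_partial_deriv[OF \<phi> i] domain_sets]
          test_function_L2[OF \<psi> domain_sets]] by simp_all
    then show "(\<integral>x. \<phi> x * partial_deriv i \<psi> x \<partial>lebesgue_on \<Omega>)
        = - (\<integral>x. classical_grad \<phi> x \<bullet> i * \<psi> x \<partial>lebesgue_on \<Omega>)"
      using integral_partial_deriv_test_mult[OF \<phi> test_function_C_k[OF \<psi>] i] i
      by (simp add: classical_grad_inner eq_neg_iff_add_eq_0)
  qed
  show "\<phi> \<in> H1 \<Omega>" "AE x in lebesgue_on \<Omega>. grad \<Omega> \<phi> x = classical_grad \<phi> x"
    using grad_unique[OF test_function_L2[OF \<phi> domain_sets] classical_grad_L2[OF \<phi>] weak] .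
qed

text \<open>
  Poincare's inequality for test functions. Integrating \<open>\<phi>\<^sup>2\<close> against \<open>1 = \<partial>\<^sub>i x\<^sub>i\<close> by parts gives
  \<open>\<parallel>\<phi>\<parallel>\<^sup>2 = - 2 (\<phi>, x\<^sub>i \<partial>\<^sub>i \<phi>)\<close>, and \<open>x\<^sub>i\<close> is bounded on \<open>\<Omega>\<close>.
\<close>

lemma poincare_test_function:
  assumes \<phi>: "\<phi> \<in> test_functions \<Omega>" and R: "0 \<le> R" "\<And>x. x \<in> \<Omega> \<Longrightarrow> norm x \<le> R"
  shows "L2_nrm \<Omega> \<phi> \<le> 2 * R * H10_nrm \<Omega> \<phi>"
proof -
  define i :: 'a where "i = (SOME i. i \<in> Basis)"
  have i: "i \<in> Basis" unfolding i_def by (rule someI_ex) (use nonempty_Basis in blast)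
  have C: "C_k k (\<lambda>x::'a. x \<bullet> i)" for k by (rule C_k_inner)
  have D\<phi>: "partial_deriv i \<phi> \<in> test_functions \<Omega>" by (rule test_function_partial_deriv[OF \<phi> i])
  define w where "w x = partial_deriv i \<phi> x * (x \<bullet> i)" for x
  have w: "w \<in> test_functions \<Omega>"
  proof -
    obtain S where S: "compact S" "S \<subseteq> \<Omega>" "\<And>x. x \<notin> S \<Longrightarrow> partial_deriv i \<phi> x = 0"
      using test_functionE[OF D\<phi>] by blast
    show ?thesis
    proof (rule test_functionI[OF _ S(1,2)])
      show "C_k k w" for k unfolding w_def[abs_def] by (rule C_k_mult[OF test_function_C_k[OF D\<phi>] C])
      show "w x = 0" if "x \<notin> S" for x using S(3)[OF that] by (simp add: w_def)
    qed
  qed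
  note L2s = test_function_L2[OF \<phi> domain_sets] test_function_L2[OF w domain_sets]
  have pd: "partial_deriv i (\<lambda>x::'a. x \<bullet> i) = (\<lambda>x. 1)"
  proof
    fix x :: 'a
    have "((\<lambda>x. x \<bullet> i) has_derivative (\<lambda>h. h \<bullet> i)) (at x)" by (auto intro!: derivative_eq_intros)
    then show "partial_deriv i (\<lambda>x. x \<bullet> i) x = 1" using i by (simp add: partial_deriv_eq)
  qed
  have "C_k (Suc 0) (\<lambda>x. \<phi> x * (x \<bullet> i))" by (rule C_k_mult[OF test_function_C_k[OF \<phi>] C])
  from integral_partial_deriv_test_mult[OF \<phi> this i]
  have "(\<integral>x. \<phi> x * (\<phi> x + w x) + w x * \<phi> x \<partial>lebesgue_on \<Omega>) = 0"
    unfolding C_k_mult_partial[OF test_function_C_k[OF \<phi>] C[of "Suc 0"]] pd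
    by (simp add: w_def algebra_simps)
  also have "(\<lambda>x. \<phi> x * (\<phi> x + w x) + w x * \<phi> x) = (\<lambda>x. \<phi> x * \<phi> x + 2 * (\<phi> x * w x))"
    by (simp add: algebra_simps)
  finally have "L2_ip \<Omega> \<phi> \<phi> + 2 * L2_ip \<Omega> \<phi> w = 0"
    using L2_ip_integrable[OF L2s(1,1)] L2_ip_integrable[OF L2s(1,2)] by (simp add: L2_ip_def)
  moreover have "\<bar>L2_ip \<Omega> \<phi> w\<bar> \<le> L2_nrm \<Omega> \<phi> * L2_nrm \<Omega> w"
    unfolding L2_nrm_def by (rule L2.cauchy_schwarz[OF L2s])
  ultimately have "(L2_nrm \<Omega> \<phi>)\<^sup>2 \<le> 2 * (L2_nrm \<Omega> \<phi> * L2_nrm \<Omega> w)"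
    by (simp add: L2_nrm_power2)
  then have 1: "L2_nrm \<Omega> \<phi> \<le> 2 * L2_nrm \<Omega> w"
    using L2_nrm_nonneg[of \<Omega> \<phi>] L2_nrm_nonneg[of \<Omega> w]
    by (cases "L2_nrm \<Omega> \<phi> = 0") (auto simp: power2_eq_square)
  have "L2_ip \<Omega> w w \<le> L2_ip \<Omega> (\<lambda>x. R *\<^sub>R grad \<Omega> \<phi> x) (\<lambda>x. R *\<^sub>R grad \<Omega> \<phi> x)"
    unfolding L2_ip_def
  proof (rule integral_mono_AE)
    show "integrable (lebesgue_on \<Omega>) (\<lambda>x. w x \<bullet> w x)" using L2_ip_integrable[OF L2s(2,2)] .
    have "(\<lambda>x. R *\<^sub>R grad \<Omega> \<phi> x) \<in> L2 \<Omega>"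
      using L2.scale_mem[OF grad_L2[OF test_function_grad(1)[OF \<phi>]]] .
    then show "integrable (lebesgue_on \<Omega>) (\<lambda>x. (R *\<^sub>R grad \<Omega> \<phi> x) \<bullet> (R *\<^sub>R grad \<Omega> \<phi> x))"
      by (intro L2_ip_integrable)
    have "AE x in lebesgue_on \<Omega>. x \<in> \<Omega>" by (intro AE_I2) simp
    then show "AE x in lebesgue_on \<Omega>. w x \<bullet> w x \<le> (R *\<^sub>R grad \<Omega> \<phi> x) \<bullet> (R *\<^sub>R grad \<Omega> \<phi> x)"
      using test_function_grad(2)[OF \<phi>]
    proof eventually_elim
      case (elim x)
      have "\<bar>partial_deriv i \<phi> x\<bar> \<le> norm (grad \<Omega> \<phi> x)"
        using Basis_le_norm[OF i, of "classical_grad \<phi> x"] classical_grad_inner[OF i] elim(2) by simp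
      moreover have "\<bar>x \<bullet> i\<bar> \<le> R" using Basis_le_norm[OF i, of x] R(2)[OF elim(1)] by simp
      ultimately have "\<bar>w x\<bar> \<le> norm (grad \<Omega> \<phi> x) * R"
        unfolding w_def abs_mult by (intro mult_mono) auto
      then have "\<bar>w x\<bar> \<le> \<bar>norm (R *\<^sub>R grad \<Omega> \<phi> x)\<bar>" using R(1) by (simp add: mult.commute)
      then have "(w x)\<^sup>2 \<le> (norm (R *\<^sub>R grad \<Omega> \<phi> x))\<^sup>2" by (simp only: abs_le_square_iff)
      then show ?case unfolding power2_norm_eq_inner by (simp add: power2_eq_square)
    qed
  qed
  then have "L2_nrm \<Omega> w \<le> R * H10_nrm \<Omega> \<phi>"
    using L2.nrm_scale[OF grad_L2[OF test_function_grad(1)[OF \<phi>]], of R] R(1)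
    unfolding L2_nrm_def H10_nrm_def by (metis abs_of_nonneg real_sqrt_le_mono)
  then show ?thesis using 1 by simp
qed

lemma H10_H1: "u \<in> H10 \<Omega> \<Longrightarrow> u \<in> H1 \<Omega>"
  by (simp add: H10_def)

lemma H10_L2: "u \<in> H10 \<Omega> \<Longrightarrow> u \<in> L2 \<Omega>"
  by (rule H1_L2[OF H10_H1])

lemma H10_approx:
  assumes "u \<in> H10 \<Omega>" "0 < \<epsilon>"
  obtains \<phi> where "\<phi> \<in> test_functions \<Omega>" "H1_nrm \<Omega> (\<lambda>x. u x - \<phi> x) < \<epsilon>"
  using assms by (auto simp: H10_def)

lemma H10_combine:
  assumes u: "u \<in> H10 \<Omega>" and v: "v \<in> H10 \<Omega>"
  shows "(\<lambda>x. u x + c *\<^sub>R v x) \<in> H10 \<Omega>"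
  unfolding H10_def
proof (intro CollectI conjI allI impI)
  show "(\<lambda>x. u x + c *\<^sub>R v x) \<in> H1 \<Omega>" by (rule H1_combine(1)[OF H10_H1[OF u] H10_H1[OF v]])
  fix \<epsilon> :: real assume \<epsilon>: "0 < \<epsilon>"
  define \<delta> where "\<delta> = \<epsilon> / (1 + \<bar>c\<bar>)"
  have \<delta>: "0 < \<delta>" using \<epsilon> by (simp add: \<delta>_def divide_pos_pos add_pos_nonneg)
  have "\<delta> * (1 + \<bar>c\<bar>) = \<epsilon>" unfolding \<delta>_def using abs_ge_zero[of c] by (intro nonzero_eq_divide_eq[THEN iffD1]) auto
  then have \<delta>_sum: "\<delta> + \<bar>c\<bar> * \<delta> = \<epsilon>" by (simp add: algebra_simps)
  obtain \<phi> where \<phi>: "\<phi> \<in> test_functions \<Omega>" "H1_nrm \<Omega> (\<lambda>x. u x - \<phi> x) < \<delta>" using H10_approx[OF u \<delta>] .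
  obtain \<psi> where \<psi>: "\<psi> \<in> test_functions \<Omega>" "H1_nrm \<Omega> (\<lambda>x. v x - \<psi> x) < \<delta>" using H10_approx[OF v \<delta>] .
  have "(\<lambda>x. u x + c *\<^sub>R v x - (\<phi> x + c * \<psi> x)) = (\<lambda>x. (u x - \<phi> x) + c *\<^sub>R (v x - \<psi> x))"
    by (simp add: algebra_simps)
  then have "H1_nrm \<Omega> (\<lambda>x. u x + c *\<^sub>R v x - (\<phi> x + c * \<psi> x))
      = H1_nrm \<Omega> (\<lambda>x. (u x - \<phi> x) + c *\<^sub>R (v x - \<psi> x))" by simp
  also have "\<dots> \<le> H1_nrm \<Omega> (\<lambda>x. u x - \<phi> x) + \<bar>c\<bar> * H1_nrm \<Omega> (\<lambda>x. v x - \<psi> x)"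
    unfolding H1_nrm_eq
    by (rule H1_full.triangle_combine[OF H1.diff_mem[OF H10_H1[OF u] test_function_grad(1)[OF \<phi>(1)]]
          H1.diff_mem[OF H10_H1[OF v] test_function_grad(1)[OF \<psi>(1)]]])
  also have "\<dots> < \<delta> + \<bar>c\<bar> * \<delta>"
    using \<phi>(2) \<psi>(2) by (intro add_less_le_mono mult_left_mono) auto
  finally show "\<exists>\<phi>\<in>test_functions \<Omega>. H1_nrm \<Omega> (\<lambda>x. u x + c *\<^sub>R v x - \<phi> x) < \<epsilon>"
    using test_function_combine[OF \<phi>(1) \<psi>(1), of c] \<delta>_sum by (intro bexI) simp_all
qed

lemma H10_zero: "(\<lambda>x. 0) \<in> H10 \<Omega>"
proof -
  have "H1_nrm \<Omega> (\<lambda>x. 0 - 0 :: real) = 0"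
    using H1_full.zero_left[OF H1.zero_mem] by (simp add: H1_nrm_eq)
  then show ?thesis unfolding H10_def using H1.zero_mem test_function_zero[of \<Omega>] by force
qed

sublocale H10: semi_inner_functions "H10 \<Omega>" "dirichlet \<Omega>"
proof
  fix u v w :: "'a \<Rightarrow> real" and c :: real
  show "(\<lambda>x. 0 :: real) \<in> H10 \<Omega>" by (rule H10_zero)
  assume u: "u \<in> H10 \<Omega>"
  show "0 \<le> dirichlet \<Omega> u u" by (rule H1.nonneg[OF H10_H1[OF u]])
  assume v: "v \<in> H10 \<Omega>"
  show "(\<lambda>x. u x + c *\<^sub>R v x) \<in> H10 \<Omega>" by (rule H10_combine[OF u v])
  show "dirichlet \<Omega> u v = dirichlet \<Omega> v u" by (rule H1.sym[OF H10_H1[OF u] H10_H1[OF v]])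
  assume w: "w \<in> H10 \<Omega>"
  show "dirichlet \<Omega> (\<lambda>x. u x + c *\<^sub>R v x) w = dirichlet \<Omega> u w + c * dirichlet \<Omega> v w"
    by (rule H1.combine_left[OF H10_H1[OF u] H10_H1[OF v] H10_H1[OF w]])
qed

lemma H10_nrm_zero: "H10_nrm \<Omega> (\<lambda>x. 0) = 0"
  using H10.zero_left[OF H10.zero_mem] by (simp add: H10_nrm_def L2_nrm_def)

text \<open>
  The inequality for test functions extends to their closure \<open>H\<^sub>0\<^sup>1\<close>, since both sides are continuous
  in the \<open>H\<^sup>1\<close> norm.
\<close>

theorem poincare: "\<exists>C\<ge>0. \<forall>u\<in>H10 \<Omega>. L2_nrm \<Omega> u \<le> C * H10_nrm \<Omega> u"
proof -
  obtain R where R: "0 < R" "\<And>x. x \<in> \<Omega> \<Longrightarrow> norm x \<le> R"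
    using bounded_domain unfolding bounded_pos by blast
  have "L2_nrm \<Omega> u \<le> 2 * R * H10_nrm \<Omega> u" if u: "u \<in> H10 \<Omega>" for u
  proof (rule field_le_epsilon)
    fix e :: real assume e: "0 < e"
    define \<epsilon> where "\<epsilon> = e / (1 + 2 * R)"
    have "\<epsilon> * (1 + 2 * R) = e" unfolding \<epsilon>_def using R(1) by (intro nonzero_eq_divide_eq[THEN iffD1]) auto
    then have \<epsilon>_sum: "\<epsilon> + 2 * R * \<epsilon> = e" by (simp add: algebra_simps)
    have \<epsilon>: "0 < \<epsilon>" using e R(1) by (simp add: \<epsilon>_def)
    obtain \<phi> where \<phi>: "\<phi> \<in> test_functions \<Omega>" "H1_nrm \<Omega> (\<lambda>x. u x - \<phi> x) < \<epsilon>"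
      using H10_approx[OF u \<epsilon>] .
    note \<phi>H1 = test_function_grad(1)[OF \<phi>(1)]
    have d: "(\<lambda>x. u x - \<phi> x) \<in> H1 \<Omega>" using H1.diff_mem[OF H10_H1[OF u] \<phi>H1] .
    have "L2_nrm \<Omega> u \<le> L2_nrm \<Omega> (\<lambda>x. u x - \<phi> x) + L2_nrm \<Omega> \<phi>"
      using L2.triangle[OF H1_L2[OF d] H1_L2[OF \<phi>H1]] by (simp add: L2_nrm_def)
    also have "L2_nrm \<Omega> (\<lambda>x. u x - \<phi> x) \<le> \<epsilon>"
      using \<phi>(2) H1_nrm_ge(1)[of "\<lambda>x. u x - \<phi> x"] by simp
    also have "L2_nrm \<Omega> \<phi> \<le> 2 * R * H10_nrm \<Omega> \<phi>"
      using poincare_test_function[OF \<phi>(1) less_imp_le[OF R(1)] R(2)] .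
    also have "H10_nrm \<Omega> \<phi> \<le> H10_nrm \<Omega> u + \<epsilon>"
    proof -
      have "H10_nrm \<Omega> (\<lambda>x. u x + (-1) *\<^sub>R (u x - \<phi> x)) \<le> H10_nrm \<Omega> u + \<bar>-1\<bar> * H10_nrm \<Omega> (\<lambda>x. u x - \<phi> x)"
        unfolding H10_nrm_def L2_nrm_def by (rule H1.triangle_combine[OF H10_H1[OF u] d])
      then show ?thesis using \<phi>(2) H1_nrm_ge(2)[of "\<lambda>x. u x - \<phi> x"] by simp
    qed
    finally show "L2_nrm \<Omega> u \<le> 2 * R * H10_nrm \<Omega> u + e"
      using R(1) \<epsilon>_sum by (simp add: algebra_simps)
  qed
  then show ?thesis using R(1) by (intro exI[of _ "2 * R"]) simp
qed

lemma H10_nrm_zero_imp_L2_nrm_zero: "u \<in> H10 \<Omega> \<Longrightarrow> H10_nrm \<Omega> u = 0 \<Longrightarrow> L2_nrm \<Omega> u = 0"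
  using poincare L2_nrm_nonneg[of \<Omega> u] by fastforce

text \<open>
  If \<open>\<parallel>\<nabla>u\<parallel> = 0\<close>, then \<open>u\<close> cannot be normalized, and the bound comes from the boundedness of \<open>F\<close>.
\<close>

lemma Hm1_bound:
  assumes F: "F \<in> Hm1 \<Omega>" and u: "u \<in> H10 \<Omega>"
  shows "\<bar>F u\<bar> \<le> Hm1_nrm \<Omega> F * H10_nrm \<Omega> u"
proof -
  obtain B where B: "\<And>u. u \<in> H10 \<Omega> \<Longrightarrow> \<bar>F u\<bar> \<le> B * H10_nrm \<Omega> u"
    using F unfolding Hm1_def by blast
  have nn: "0 \<le> H10_nrm \<Omega> u" for u by (simp add: H10_nrm_def L2_nrm_nonneg)
  have bdd: "bdd_above ((\<lambda>u. \<bar>F u\<bar>) ` {u \<in> H10 \<Omega>. H10_nrm \<Omega> u \<le> 1})"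
  proof (rule bdd_aboveI2)
    fix u assume u: "u \<in> {u \<in> H10 \<Omega>. H10_nrm \<Omega> u \<le> 1}"
    have "B * H10_nrm \<Omega> u \<le> \<bar>B\<bar> * 1" using u nn[of u] by (intro mult_mono) auto
    then show "\<bar>F u\<bar> \<le> \<bar>B\<bar>" using B[of u] u by simp
  qed
  show ?thesis
  proof (cases "H10_nrm \<Omega> u = 0")
    case True
    then show ?thesis using B[OF u] by simp
  next
    case False
    define r where "r = 1 / H10_nrm \<Omega> u"
    have r: "r > 0" "r * H10_nrm \<Omega> u = 1" using False nn[of u] by (auto simp: r_def)
    have ru: "(\<lambda>x. r * u x) \<in> H10 \<Omega>" using H10.scale_mem[OF u, of r] by simp
    have "H10_nrm \<Omega> (\<lambda>x. r * u x) = r * H10_nrm \<Omega> u"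
      using H10.nrm_scale[OF u, of r] r(1) by (simp add: H10_nrm_def L2_nrm_def)
    then have "\<bar>F (\<lambda>x. r * u x)\<bar> \<le> Hm1_nrm \<Omega> F"
      unfolding Hm1_nrm_def using ru r(2) by (intro cSUP_upper bdd) simp
    moreover have "F (\<lambda>x. r * u x) = r * F u" using F u by (auto simp: Hm1_def)
    ultimately have "r * \<bar>F u\<bar> \<le> Hm1_nrm \<Omega> F" using r(1) by (simp add: abs_mult)
    then have "r * \<bar>F u\<bar> * H10_nrm \<Omega> u \<le> Hm1_nrm \<Omega> F * H10_nrm \<Omega> u"
      by (intro mult_right_mono nn)
    also have "r * \<bar>F u\<bar> * H10_nrm \<Omega> u = \<bar>F u\<bar>"
      using r(2) by (metis mult.assoc mult.commute mult_1_right)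
    finally show ?thesis .
  qed
qed

lemma Hm1_zero: "F \<in> Hm1 \<Omega> \<Longrightarrow> F (\<lambda>x. 0) = 0"
  using Hm1_bound[OF _ H10.zero_mem] by (fastforce simp: H10_nrm_zero)

end

section \<open>Finite elements and the discrete Laplacian\<close>

lemma P1_on_combine:
  assumes "P1_on K u" "P1_on K v"
  shows "P1_on K (\<lambda>x. u x + c * v x)"
proof -
  obtain a1 b1 a2 b2 where "\<forall>x\<in>K. u x = a1 + b1 \<bullet> x" "\<forall>x\<in>K. v x = a2 + b2 \<bullet> x"
    using assms unfolding P1_on_def by blast
  then have "\<forall>x\<in>K. u x + c * v x = (a1 + c * a2) + (b1 + c *\<^sub>R b2) \<bullet> x"
    by (simp add: inner_left_distrib algebra_simps)
  then show ?thesis unfolding P1_on_def by blast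
qed

lemma P1_on_zero: "P1_on K (\<lambda>x. 0)"
  unfolding P1_on_def by (intro exI[of _ 0]) simp

lemma P1_on_hull_eq_0:
  assumes "P1_on (convex hull S) v" "\<And>x. x \<in> S \<Longrightarrow> v x = 0" "x \<in> convex hull S"
  shows "v x = 0"
proof -
  obtain c b where v: "\<And>x. x \<in> convex hull S \<Longrightarrow> v x = c + b \<bullet> x"
    using assms(1) unfolding P1_on_def by blast
  have "b \<bullet> x = - c" if "x \<in> S" for x
    using v[OF hull_inc[OF that]] assms(2)[OF that] by simp
  then have "convex hull S \<subseteq> {x. b \<bullet> x = - c}"
    by (intro hull_minimal convex_hyperplane) auto
  then show ?thesis using v[OF assms(3)] assms(3) by auto
qed

lemma full_simplex:
  fixes K :: "'a::euclidean_space set"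
  assumes "int DIM('a) simplex K"
  shows "convex K" "closed K" "interior K \<noteq> {}"
proof -
  obtain C where C: "finite C" "K = convex hull C" using assms unfolding simplex by blast
  show K: "convex K" "closed K"
    using C by (simp_all add: convex_convex_hull compact_imp_closed finite_imp_compact_convex_hull)
  have dim: "aff_dim K = DIM('a)" by (rule aff_dim_simplex[OF assms])
  then have "rel_interior K = interior K" by (intro rel_interior_interior) (simp add: aff_dim_eq_full)
  moreover have "K \<noteq> {}" using dim by auto
  ultimately show "interior K \<noteq> {}" using rel_interior_eq_empty[OF K(1)] by simp
qed

locale fe_space = bounded_open \<Omega> for \<Omega> :: "'a::euclidean_space set" +
  fixes \<T> :: "'a set set"
  assumes convex_domain: "convex \<Omega>" and triangulation: "triangulation_of \<Omega> \<T>"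
begin

abbreviation "V \<equiv> V_h \<Omega> \<T>"

lemma cell_simplex: "K \<in> \<T> \<Longrightarrow> int DIM('a) simplex K"
  and finite_cells: "finite \<T>"
  and cells_cover: "\<Union>\<T> = closure \<Omega>"
  using triangulation unfolding triangulation_of_def triangulation_def by blast+

lemma V_H10: "v \<in> V \<Longrightarrow> v \<in> H10 \<Omega>"
  and V_P1: "v \<in> V \<Longrightarrow> K \<in> \<T> \<Longrightarrow> P1_on K v"
  and V_outside: "v \<in> V \<Longrightarrow> x \<notin> \<Omega> \<Longrightarrow> v x = 0"
  unfolding V_h_def by blast+

lemmas V_L2 = H10_L2[OF V_H10]

lemma V_zero: "(\<lambda>x. 0) \<in> V"
  unfolding V_h_def by (simp add: H10.zero_mem P1_on_zero)

lemma V_combine: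
  assumes "u \<in> V" "v \<in> V"
  shows "(\<lambda>x. u x + c *\<^sub>R v x) \<in> V"
  unfolding V_h_def
proof (intro CollectI conjI ballI allI impI)
  show "(\<lambda>x. u x + c *\<^sub>R v x) \<in> H10 \<Omega>" by (rule H10_combine[OF V_H10[OF assms(1)] V_H10[OF assms(2)]])
  show "P1_on K (\<lambda>x. u x + c *\<^sub>R v x)" if "K \<in> \<T>" for K
    using P1_on_combine[OF V_P1[OF assms(1) that] V_P1[OF assms(2) that], of c] by simp
  show "u x + c *\<^sub>R v x = 0" if "x \<notin> \<Omega>" for x
    using V_outside[OF assms(1) that] V_outside[OF assms(2) that] by simp
qed

sublocale V: semi_inner_functions V "dirichlet \<Omega>"
proof
  fix u v w :: "'a \<Rightarrow> real" and c :: real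
  show "(\<lambda>x. 0 :: real) \<in> V" by (rule V_zero)
  assume u: "u \<in> V"
  show "0 \<le> dirichlet \<Omega> u u" by (rule H10.nonneg[OF V_H10[OF u]])
  assume v: "v \<in> V"
  show "(\<lambda>x. u x + c *\<^sub>R v x) \<in> V" by (rule V_combine[OF u v])
  show "dirichlet \<Omega> u v = dirichlet \<Omega> v u" by (rule H10.sym[OF V_H10[OF u] V_H10[OF v]])
  assume w: "w \<in> V"
  show "dirichlet \<Omega> (\<lambda>x. u x + c *\<^sub>R v x) w = dirichlet \<Omega> u w + c * dirichlet \<Omega> v w"
    by (rule H10.combine_left[OF V_H10[OF u] V_H10[OF v] V_H10[OF w]])
qed

sublocale V_mass: semi_inner_functions V "L2_ip \<Omega>"
proof
  fix u v w :: "'a \<Rightarrow> real" and c :: real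
  show "(\<lambda>x. 0 :: real) \<in> V" by (rule V_zero)
  assume u: "u \<in> V"
  show "0 \<le> L2_ip \<Omega> u u" by (rule L2.nonneg[OF V_L2[OF u]])
  assume v: "v \<in> V"
  show "(\<lambda>x. u x + c *\<^sub>R v x) \<in> V" by (rule V_combine[OF u v])
  show "L2_ip \<Omega> u v = L2_ip \<Omega> v u" by (rule L2.sym[OF V_L2[OF u] V_L2[OF v]])
  assume w: "w \<in> V"
  show "L2_ip \<Omega> (\<lambda>x. u x + c *\<^sub>R v x) w = L2_ip \<Omega> u w + c * L2_ip \<Omega> v w"
    by (rule L2.combine_left[OF V_L2[OF u] V_L2[OF v] V_L2[OF w]])
qed

lemma point_in_cell:
  assumes "x \<in> \<Omega>"
  obtains K where "K \<in> \<T>" "x \<in> K"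
  using assms closure_subset[of \<Omega>] cells_cover by blast

text \<open>
  An affine function that vanishes at the vertices of a simplex vanishes on the simplex, so the
  vertices of all cells separate the finite element functions. This is the finite-dimensionality
  that Riesz representation needs.
\<close>

lemma nodal_values_separate:
  "\<exists>P. finite P \<and> (\<forall>v\<in>V. (\<forall>p\<in>P. v p = 0) \<longrightarrow> v = (\<lambda>x. 0))"
proof -
  have "\<forall>K\<in>\<T>. \<exists>C. finite C \<and> K = convex hull C"
    using cell_simplex unfolding simplex by blast
  from bchoice[OF this] obtain C where C': "\<forall>K\<in>\<T>. finite (C K) \<and> K = convex hull (C K)" ..
  have C: "finite (C K)" "K = convex hull (C K)" if "K \<in> \<T>" for K
    using bspec[OF C' that] by (rule conjunct1, rule conjunct2)
  have "v x = 0" if v: "v \<in> V" and vert: "\<forall>p\<in>(\<Union>K\<in>\<T>. C K). v p = 0" for v x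
  proof (cases "x \<in> \<Omega>")
    case True
    then obtain K where K: "K \<in> \<T>" "x \<in> K" using point_in_cell by blast
    have "P1_on (convex hull (C K)) v" "x \<in> convex hull (C K)"
      using V_P1[OF v K(1)] K(2) C(2)[OF K(1)] by simp_all
    moreover have "v p = 0" if "p \<in> C K" for p using vert that K(1) by blast
    ultimately show ?thesis using P1_on_hull_eq_0 by blast
  qed (rule V_outside[OF v])
  moreover have "finite (\<Union>K\<in>\<T>. C K)" using finite_cells C(1) by blast
  ultimately show ?thesis by (intro exI[of _ "\<Union>K\<in>\<T>. C K"]) (auto simp: fun_eq_iff)
qed

text \<open>
  A finite element function that vanishes almost everywhere vanishes, because it is continuous on
  each cell and cells have interior points near each of their points.
\<close>

lemma V_mass_definite:
  assumes v: "v \<in> V" and zero: "L2_ip \<Omega> v v = 0"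
  shows "v = (\<lambda>x. 0)"
proof (rule ccontr)
  assume "v \<noteq> (\<lambda>x. 0)"
  then obtain x where x: "v x \<noteq> 0" by blast
  have "x \<in> \<Omega>" using V_outside[OF v] x by blast
  then obtain K where K: "K \<in> \<T>" "x \<in> K" using point_in_cell by blast
  obtain c b where vK: "\<And>y. y \<in> K \<Longrightarrow> v y = c + b \<bullet> y"
    using V_P1[OF v K(1)] unfolding P1_on_def by blast
  note simp = full_simplex[OF cell_simplex[OF K(1)]]
  define U where "U = {y. c + b \<bullet> y \<noteq> 0}"
  have U: "open U" unfolding U_def by (intro open_Collect_neq continuous_intros)
  have "x \<in> U" using x vK[OF K(2)] by (simp add: U_def)
  moreover have "x \<in> closure (interior K)"
    using convex_closure_interior[OF simp(1,3)] K(2) closure_subset by blast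
  ultimately have ne: "U \<inter> interior K \<noteq> {}"
    using U unfolding closure_iff_nhds_not_empty by (metis Int_commute subset_refl)
  have "interior K \<subseteq> interior (closure \<Omega>)" using K(1) cells_cover by (intro interior_mono) blast
  then have sub: "interior K \<subseteq> \<Omega>"
    using convex_interior_closure[OF convex_domain] interior_open[OF open_domain] by simp
  have "AE x in lebesgue. x \<in> \<Omega> \<longrightarrow> v x = 0"
    using L2_nrm_zero_imp_AE[OF V_L2[OF v]] zero domain_sets
    by (simp add: L2_nrm_def AE_restrict_space_iff)
  then obtain N where N: "\<And>x. x \<notin> N \<Longrightarrow> x \<in> \<Omega> \<Longrightarrow> v x = 0" "N \<in> null_sets lebesgue"
    by (elim AE_E3) auto
  have "U \<inter> interior K \<subseteq> N"
  proof
    fix y assume y: "y \<in> U \<inter> interior K"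
    then have "v y \<noteq> 0" using vK interior_subset[of K] by (auto simp: U_def)
    then show "y \<in> N" using N(1) y sub by blast
  qed
  then have "negligible (U \<inter> interior K)"
    using N(2) negligible_iff_null_sets negligible_subset by blast
  then show False using open_not_negligible[of "U \<inter> interior K"] U ne by auto
qed

text \<open>Here the boundary condition enters, through Poincare's inequality.\<close>

lemma V_definite:
  assumes v: "v \<in> V" and "dirichlet \<Omega> v v = 0"
  shows "v = (\<lambda>x. 0)"
proof (rule V_mass_definite[OF v])
  have "H10_nrm \<Omega> v = 0" using assms(2) by (simp add: H10_nrm_def L2_nrm_def)
  then have "(L2_nrm \<Omega> v)\<^sup>2 = 0" using H10_nrm_zero_imp_L2_nrm_zero[OF V_H10[OF v]] by simp
  then show "L2_ip \<Omega> v v = 0" by (simp add: L2_nrm_power2)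
qed

lemma V_eqI:
  assumes u: "u \<in> V" and v: "v \<in> V" and eq: "\<And>w. w \<in> V \<Longrightarrow> dirichlet \<Omega> u w = dirichlet \<Omega> v w"
  shows "u = v"
proof -
  have d: "(\<lambda>x. u x - v x) \<in> V" by (rule V.diff_mem[OF u v])
  have "dirichlet \<Omega> (\<lambda>x. u x - v x) (\<lambda>x. u x - v x) = 0"
    using V.diff_left[OF u v d] eq[OF d] by simp
  then have "(\<lambda>x. u x - v x) = (\<lambda>x. 0)" by (rule V_definite[OF d])
  then show ?thesis by (auto simp: fun_eq_iff)
qed

lemma V_mass_eqI:
  assumes u: "u \<in> V" and v: "v \<in> V" and eq: "\<And>w. w \<in> V \<Longrightarrow> L2_ip \<Omega> u w = L2_ip \<Omega> v w"
  shows "u = v"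
proof -
  have d: "(\<lambda>x. u x - v x) \<in> V" by (rule V.diff_mem[OF u v])
  have "L2_ip \<Omega> (\<lambda>x. u x - v x) (\<lambda>x. u x - v x) = 0"
    using V_mass.diff_left[OF u v d] eq[OF d] by simp
  then have "(\<lambda>x. u x - v x) = (\<lambda>x. 0)" by (rule V_mass_definite[OF d])
  then show ?thesis by (auto simp: fun_eq_iff)
qed

lemma
  assumes lin: "\<And>u v c. u \<in> V \<Longrightarrow> v \<in> V \<Longrightarrow> F (\<lambda>x. u x + c *\<^sub>R v x) = F u + c * (F v :: real)"
  shows V_riesz: "\<exists>u\<in>V. \<forall>w\<in>V. dirichlet \<Omega> u w = F w"
    and V_mass_riesz: "\<exists>u\<in>V. \<forall>w\<in>V. L2_ip \<Omega> u w = F w"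
proof -
  obtain P where P: "finite P" "\<And>v. v \<in> V \<Longrightarrow> (\<And>p. p \<in> P \<Longrightarrow> v p = 0) \<Longrightarrow> v = (\<lambda>x. 0)"
    using nodal_values_separate by blast
  define L :: "(('a \<Rightarrow> real) \<Rightarrow> real) set" where "L = (\<lambda>p v. v p) ` P"
  have L: "finite L"
    "\<And>\<xi> u v c. \<xi> \<in> L \<Longrightarrow> u \<in> V \<Longrightarrow> v \<in> V \<Longrightarrow> \<xi> (\<lambda>x. u x + c *\<^sub>R v x) = \<xi> u + c * \<xi> v"
    using P(1) by (auto simp: L_def)
  have sep: "u = (\<lambda>x. 0)" if "u \<in> V" "\<And>\<xi>. \<xi> \<in> L \<Longrightarrow> \<xi> u = 0" for u
    using P(2)[OF that(1)] that(2) unfolding L_def by blast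
  show "\<exists>u\<in>V. \<forall>w\<in>V. dirichlet \<Omega> u w = F w"
    by (rule V.riesz_representation[OF L(1) subset_refl V_zero V_combine V_definite L(2) sep lin])
  show "\<exists>u\<in>V. \<forall>w\<in>V. L2_ip \<Omega> u w = F w"
    by (rule V_mass.riesz_representation[OF L(1) subset_refl V_zero V_combine V_mass_definite L(2) sep lin])
qed

text \<open>
  The discrete Laplacian is a definite description and its inverse is an inverse function on the
  finite element space. Riesz representation for the \<open>L\<^sup>2\<close> product makes the former meaningful, and
  Riesz representation for the Dirichlet form yields surjectivity.
\<close>

lemma neg_laplace_h_eqI:
  assumes v: "v \<in> V" and u: "u \<in> V" "\<And>w. w \<in> V \<Longrightarrow> L2_ip \<Omega> u w = dirichlet \<Omega> v w"
  shows "neg_laplace_h \<Omega> \<T> v = u"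
  unfolding neg_laplace_h_def
proof (rule the_equality)
  show "u \<in> V \<and> (\<forall>w\<in>V. L2_ip \<Omega> u w = dirichlet \<Omega> v w)" using u by blast
  show "u' = u" if u': "u' \<in> V \<and> (\<forall>w\<in>V. L2_ip \<Omega> u' w = dirichlet \<Omega> v w)" for u'
    by (rule V_mass_eqI) (use u' u in simp_all)
qed

lemma neg_laplace_h_mass:
  assumes v: "v \<in> V" and w: "w \<in> V"
  shows "L2_ip \<Omega> (neg_laplace_h \<Omega> \<T> v) w = dirichlet \<Omega> v w"
proof -
  obtain u where u: "u \<in> V" "\<And>w. w \<in> V \<Longrightarrow> L2_ip \<Omega> u w = dirichlet \<Omega> v w"
    using V_mass_riesz[of "dirichlet \<Omega> v", OF V.combine_right[OF _ _ v]] by blast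
  then show ?thesis using neg_laplace_h_eqI[OF v u] w by simp
qed

lemma inj_on_neg_laplace_h: "inj_on (neg_laplace_h \<Omega> \<T>) V"
proof (rule inj_onI)
  fix u v assume u: "u \<in> V" and v: "v \<in> V" and eq: "neg_laplace_h \<Omega> \<T> u = neg_laplace_h \<Omega> \<T> v"
  show "u = v"
    by (rule V_eqI[OF u v]) (metis eq neg_laplace_h_mass u v)
qed

lemma inv_neg_laplace_h:
  assumes d: "d \<in> V"
  shows inv_neg_laplace_h_mem: "inv_neg_laplace_h \<Omega> \<T> d \<in> V"
    and inv_neg_laplace_h_dirichlet:
      "w \<in> V \<Longrightarrow> dirichlet \<Omega> (inv_neg_laplace_h \<Omega> \<T> d) w = L2_ip \<Omega> d w"
proof -
  obtain y where y: "y \<in> V" "\<And>w. w \<in> V \<Longrightarrow> dirichlet \<Omega> y w = L2_ip \<Omega> d w"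
    using V_riesz[of "L2_ip \<Omega> d", OF V_mass.combine_right[OF _ _ d]] by blast
  have "neg_laplace_h \<Omega> \<T> y = d"
    by (rule neg_laplace_h_eqI[OF y(1) d]) (simp add: y(2))
  then have "inv_neg_laplace_h \<Omega> \<T> d = y"
    unfolding inv_neg_laplace_h_def by (rule the_inv_into_f_eq[OF inj_on_neg_laplace_h _ y(1)])
  then show "inv_neg_laplace_h \<Omega> \<T> d \<in> V"
    "w \<in> V \<Longrightarrow> dirichlet \<Omega> (inv_neg_laplace_h \<Omega> \<T> d) w = L2_ip \<Omega> d w"
    using y by simp_all
qed

lemma inv_neg_laplace_h_combine:
  assumes u: "u \<in> V" and v: "v \<in> V"
  shows "inv_neg_laplace_h \<Omega> \<T> (\<lambda>x. u x + c *\<^sub>R v x)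
    = (\<lambda>x. inv_neg_laplace_h \<Omega> \<T> u x + c *\<^sub>R inv_neg_laplace_h \<Omega> \<T> v x)"
proof (rule V_eqI)
  note uv = V_combine[OF u v, of c]
  note mem = inv_neg_laplace_h_mem[OF u] inv_neg_laplace_h_mem[OF v]
  show "inv_neg_laplace_h \<Omega> \<T> (\<lambda>x. u x + c *\<^sub>R v x) \<in> V" by (rule inv_neg_laplace_h_mem[OF uv])
  show "(\<lambda>x. inv_neg_laplace_h \<Omega> \<T> u x + c *\<^sub>R inv_neg_laplace_h \<Omega> \<T> v x) \<in> V"
    by (rule V_combine[OF mem])
  fix w assume w: "w \<in> V"
  show "dirichlet \<Omega> (inv_neg_laplace_h \<Omega> \<T> (\<lambda>x. u x + c *\<^sub>R v x)) w
    = dirichlet \<Omega> (\<lambda>x. inv_neg_laplace_h \<Omega> \<T> u x + c *\<^sub>R inv_neg_laplace_h \<Omega> \<T> v x) w"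
    unfolding V.combine_left[OF mem w] inv_neg_laplace_h_dirichlet[OF uv w]
      inv_neg_laplace_h_dirichlet[OF u w] inv_neg_laplace_h_dirichlet[OF v w]
    by (rule V_mass.combine_left[OF u v w])
qed

end

section \<open>Integrals of piecewise polynomial functions of time\<close>

text \<open>
  By completeness of Lebesgue measure, \<open>f\<close> and \<open>g\<close> are both measurable or both not, and in the latter
  case both integrals are zero by convention. So values at grid points can be changed freely, for
  instance those of a time derivative, which mean nothing there.
\<close>

lemma integral_lebesgue_on_spike:
  fixes f g :: "real \<Rightarrow> real"
  assumes S: "S \<in> sets lebesgue" and N: "finite N" and eq: "\<And>s. s \<in> S \<Longrightarrow> s \<notin> N \<Longrightarrow> f s = g s"
  shows "integral\<^sup>L (lebesgue_on S) f = integral\<^sup>L (lebesgue_on S) g"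
proof -
  have "negligible (N \<inter> S)" using N by (intro negligible_finite) simp
  then have null: "N \<inter> S \<in> null_sets (lebesgue_on S)"
    using S by (simp add: null_sets_restrict_space negligible_iff_null_sets)
  have "S - N \<inter> S = S - N" by blast
  then have meas: "f \<in> borel_measurable (lebesgue_on S) \<longleftrightarrow> g \<in> borel_measurable (lebesgue_on S)"
    using borel_measurable_diff_null[OF null S, of f] borel_measurable_diff_null[OF null S, of g]
      measurable_lebesgue_cong[of "S - N" f g] eq by simp
  show ?thesis
  proof (cases "f \<in> borel_measurable (lebesgue_on S)")
    case True
    have "AE s in lebesgue_on S. f s = g s"
      by (rule AE_I'[OF null]) (use eq in auto)
    then show ?thesis using True meas by (intro integral_cong_AE) auto
  next
    case False
    then have "\<not> integrable (lebesgue_on S) f" "\<not> integrable (lebesgue_on S) g"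
      using meas borel_measurable_integrable by blast+
    then show ?thesis by (simp add: not_integrable_integral_eq)
  qed
qed

lemma integrable_indicator_Ioo:
  fixes f :: "real \<Rightarrow> real"
  assumes "integrable (lebesgue_on {0<..<T}) f" "A \<in> sets lebesgue"
  shows "integrable (lebesgue_on {0<..<T}) (\<lambda>s. if s \<in> A then f s else 0)"
proof -
  have "A \<inter> {0<..<T} \<in> sets (lebesgue_on {0<..<T})"
    using assms(2) by (auto simp: sets_restrict_space)
  then have "integrable (lebesgue_on {0<..<T}) (\<lambda>s. indicator (A \<inter> {0<..<T}) s *\<^sub>R f s)"
    using assms(1) by (rule integrable_mult_indicator)
  moreover have "integrable (lebesgue_on {0<..<T}) (\<lambda>s. indicator (A \<inter> {0<..<T}) s *\<^sub>R f s)
      \<longleftrightarrow> integrable (lebesgue_on {0<..<T}) (\<lambda>s. if s \<in> A then f s else 0)"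
    by (rule Bochner_Integration.integrable_cong) (auto simp: indicator_def)
  ultimately show ?thesis by blast
qed

lemma integrable_const_Ioo: "integrable (lebesgue_on {0<..<T}) (\<lambda>s. c :: real)" for T :: real
  by (intro finite_measure.integrable_const finite_measure_lebesgue_on) simp

lemma integral_affine_on_subinterval:
  fixes f :: "real \<Rightarrow> real"
  assumes ab: "0 \<le> a" "a < b" "b \<le> T"
    and inside: "\<And>s. a < s \<Longrightarrow> s < b \<Longrightarrow> f s = A + s * B"
    and outside: "\<And>s. 0 < s \<Longrightarrow> s < T \<Longrightarrow> s < a \<or> b < s \<Longrightarrow> f s = 0"
  shows "integral\<^sup>L (lebesgue_on {0<..<T}) f = (b - a) * (A + (a + b) / 2 * B)"
proof -
  define h where "h s = A + s * B" for s
  have h: "integrable (lebesgue_on {a..b}) h"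
    unfolding h_def[abs_def] by (intro continuous_imp_integrable_real continuous_intros)
  have "integral\<^sup>L (lebesgue_on {0<..<T}) f = (\<integral>s. (if s \<in> {a..b} then h s else 0) \<partial>lebesgue_on {0<..<T})"
    by (rule integral_lebesgue_on_spike[where N = "{a, b}"])
       (use inside outside in \<open>auto simp: h_def\<close>)
  also have "\<dots> = integral\<^sup>L (lebesgue_on ({a..b} \<inter> {0<..<T})) h"
    by (rule Lebesgue_Measure.integral_restrict_Int) auto
  also have "\<dots> = (\<integral>s. (if s \<in> {0<..<T} then h s else 0) \<partial>lebesgue_on {a..b})"
    using Lebesgue_Measure.integral_restrict_Int[of "{0<..<T}" "{a..b}" h] by (simp add: Int_commute)
  also have "\<dots> = integral\<^sup>L (lebesgue_on {a..b}) h"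
    by (rule integral_lebesgue_on_spike[where N = "{a, b}"]) (use ab in auto)
  also have "\<dots> = integral {a..b} h" by (rule lebesgue_integral_eq_integral[OF h]) simp
  also have "(h has_integral (A * b + b\<^sup>2 / 2 * B) - (A * a + a\<^sup>2 / 2 * B)) {a..b}"
    unfolding h_def[abs_def] using ab
    by (intro fundamental_theorem_of_calculus)
       (auto intro!: derivative_eq_intros simp flip: has_real_derivative_iff_has_vector_derivative)
  then have "integral {a..b} h = (A * b + b\<^sup>2 / 2 * B) - (A * a + a\<^sup>2 / 2 * B)"
    by (rule integral_unique)
  also have "\<dots> = (b - a) * (A + (a + b) / 2 * B)"
    by (simp add: field_simps power2_eq_square)
  finally show ?thesis .
qed

locale time_partition =
  fixes T :: real and M :: nat and t :: "nat \<Rightarrow> real"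
  assumes grid: "time_grid T M t" and T_pos: "0 < T"
begin

abbreviation "cell \<equiv> time_cell M t"

definition step :: "nat \<Rightarrow> real" where "step m = t m - t (m - 1)"

lemma grid_ends: "1 \<le> M" "t 0 = 0" "t M = T"
  using grid by (simp_all add: time_grid_def)

lemma grid_mono: "i \<le> j \<Longrightarrow> j \<le> M \<Longrightarrow> t i \<le> t j"
proof (induction j)
  case (Suc j)
  show ?case
  proof (cases "i = Suc j")
    case False
    then have "t i \<le> t j" using Suc by simp
    also have "t j < t (Suc j)" using grid Suc.prems(2) by (simp add: time_grid_def)
    finally show ?thesis by simp
  qed simp
qed simp

lemma grid_step: "m \<in> {1..M} \<Longrightarrow> t (m - 1) < t m"
  using grid unfolding time_grid_def by (metis Suc_diff_1 atLeastAtMost_iff less_eq_Suc_le One_nat_def Suc_le_lessD)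

lemma step_pos: "m \<in> {1..M} \<Longrightarrow> 0 < step m"
  using grid_step by (simp add: step_def)

lemma grid_bounds: "m \<in> {1..M} \<Longrightarrow> 0 \<le> t (m - 1)" "m \<in> {1..M} \<Longrightarrow> t m \<le> T"
  using grid_mono[of 0 "m - 1"] grid_mono[of m M] grid_ends by auto

lemma cell_sets: "cell m \<in> sets lebesgue"
  by (simp add: time_cell_def)

lemma cell_subset: "cell m \<subseteq> {t (m - 1)<..t m}"
  by (auto simp: time_cell_def)

lemma Ioo_subset_cell: "{t (m - 1)<..<t m} \<subseteq> cell m"
  by (auto simp: time_cell_def)

lemma cell_subset_Ioo:
  assumes "m \<in> {1..M}"
  shows "cell m \<subseteq> {0<..<T}"
proof (cases "m < M")
  case True
  then have "t m < T" using grid_step[of "Suc m"] grid_bounds(2)[of "Suc m"] by simp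
  then show ?thesis using grid_bounds(1)[OF assms] cell_subset[of m] by force
next
  case False
  then show ?thesis using grid_bounds[OF assms] by (auto simp: time_cell_def)
qed

lemma cell_disjoint:
  assumes "m \<in> {1..M}" "n \<in> {1..M}" "s \<in> cell m" "s \<in> cell n"
  shows "m = n"
proof (rule ccontr)
  assume "m \<noteq> n"
  then consider "m < n" | "n < m" by linarith
  then show False
  proof cases
    case 1
    then have "t m \<le> t (n - 1)" using assms by (intro grid_mono) auto
    then show False using assms(3,4) cell_subset[of m] cell_subset[of n] by force
  next
    case 2
    then have "t n \<le> t (m - 1)" using assms by (intro grid_mono) auto
    then show False using assms(3,4) cell_subset[of m] cell_subset[of n] by force
  qed
qed

lemma cell_cover:
  assumes "0 < s" "s < T"
  obtains m where "m \<in> {1..M}" "s \<in> cell m"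
proof -
  define m where "m = (LEAST m. s \<le> t m)"
  have ex: "s \<le> t M" using assms grid_ends by simp
  have m: "s \<le> t m" "m \<le> M" unfolding m_def using ex by (auto intro: LeastI Least_le)
  have "m \<noteq> 0" using m(1) grid_ends assms by (metis not_le)
  then have "\<not> s \<le> t (m - 1)" using not_less_Least[of "m - 1" "\<lambda>m. s \<le> t m"] by (simp add: m_def)
  then have "s \<in> cell m"
    using m assms grid_ends by (cases "m = M") (simp_all add: time_cell_def)
  then show ?thesis using that[of m] m(2) \<open>m \<noteq> 0\<close> by simp
qed

lemma grid_off_nodes:
  assumes "0 < s" "s < T" "s \<notin> t ` {..M}"
  obtains m where "m \<in> {1..M}" "t (m - 1) < s" "s < t m"
proof -
  obtain m where m: "m \<in> {1..M}" "s \<in> cell m" using cell_cover assms by blast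
  then have "s \<noteq> t m" using assms(3) by auto
  then show ?thesis using that[OF m(1)] m(2) cell_subset[of m] by force
qed

lemma integral_cell_affine:
  fixes f :: "real \<Rightarrow> real"
  assumes m: "m \<in> {1..M}"
    and "\<And>s. t (m - 1) < s \<Longrightarrow> s < t m \<Longrightarrow> f s = A + s * B"
    and "\<And>s. 0 < s \<Longrightarrow> s < T \<Longrightarrow> s \<notin> cell m \<Longrightarrow> f s = 0"
  shows "integral\<^sup>L (lebesgue_on {0<..<T}) f = step m * (A + (t (m - 1) + t m) / 2 * B)"
  unfolding step_def
  by (rule integral_affine_on_subinterval)
     (use assms grid_bounds[OF m] grid_step[OF m] cell_subset[of m] in force)+

lemma integral_cell_const:
  assumes m: "m \<in> {1..M}"
  shows "(\<integral>s. (if s \<in> cell m then A else 0) \<partial>lebesgue_on {0<..<T}) = step m * A"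
  using integral_cell_affine[OF m, of "\<lambda>s. if s \<in> cell m then A else 0" A 0] Ioo_subset_cell[of m]
  by (simp add: subset_iff)

text \<open>
  The bounds are only assumed in the interior of the cells; an integrable majorant suffices, because the
  integral of a function that is not integrable is zero.
\<close>

lemma integral_le_sum_cells:
  fixes f :: "real \<Rightarrow> real"
  assumes d: "\<And>m. m \<in> {1..M} \<Longrightarrow> 0 \<le> d m"
    and f: "\<And>m s. m \<in> {1..M} \<Longrightarrow> t (m - 1) < s \<Longrightarrow> s < t m \<Longrightarrow> f s \<le> d m"
  shows "integral\<^sup>L (lebesgue_on {0<..<T}) f \<le> (\<Sum>m=1..M. step m * d m)"
proof -
  define h where "h s = (\<Sum>m=1..M. if s \<in> cell m then d m else 0)" for s
  have int: "integrable (lebesgue_on {0<..<T}) (\<lambda>s. if s \<in> cell m then d m else 0)" for m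
    by (rule integrable_indicator_Ioo[OF integrable_const_Ioo cell_sets])
  have "negligible (t ` {..M} \<inter> {0<..<T})" by (intro negligible_finite) simp
  then have null: "t ` {..M} \<inter> {0<..<T} \<in> null_sets (lebesgue_on {0<..<T})"
    by (simp add: null_sets_restrict_space negligible_iff_null_sets)
  have "integral\<^sup>L (lebesgue_on {0<..<T}) f \<le> integral\<^sup>L (lebesgue_on {0<..<T}) h"
  proof (rule integral_mono_AE')
    show "integrable (lebesgue_on {0<..<T}) h"
      unfolding h_def[abs_def] by (intro Bochner_Integration.integrable_sum int)
    have "f s \<le> h s" if s: "0 < s" "s < T" "s \<notin> t ` {..M}" for s
    proof -
      obtain m where m: "m \<in> {1..M}" "t (m - 1) < s" "s < t m" using grid_off_nodes[OF s] by blast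
      have "s \<in> cell m" using m(2,3) Ioo_subset_cell[of m] by auto
      then have "d m = (if s \<in> cell m then d m else 0)" by simp
      also have "\<dots> \<le> h s"
        unfolding h_def by (rule member_le_sum) (use m(1) d in auto)
      finally show ?thesis using f[OF m] by linarith
    qed
    then show "AE s in lebesgue_on {0<..<T}. f s \<le> h s" by (intro AE_I'[OF null]) auto
    show "AE s in lebesgue_on {0<..<T}. 0 \<le> h s"
      unfolding h_def by (intro AE_I2 sum_nonneg) (use d in auto)
  qed
  also have "\<dots> = (\<Sum>m=1..M. step m * d m)"
    unfolding h_def[abs_def] using int by (simp add: integral_cell_const)
  finally show ?thesis .
qed

lemma sum_integral_cells_le:
  fixes f :: "real \<Rightarrow> real"
  assumes f: "integrable (lebesgue_on {0<..<T}) f" and nonneg: "\<And>s. 0 \<le> f s"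
  shows "(\<Sum>m=1..M. \<integral>s. (if s \<in> cell m then f s else 0) \<partial>lebesgue_on {0<..<T})
    \<le> integral\<^sup>L (lebesgue_on {0<..<T}) f"
proof -
  have int: "integrable (lebesgue_on {0<..<T}) (\<lambda>s. if s \<in> cell m then f s else 0)" for m
    by (rule integrable_indicator_Ioo[OF f cell_sets])
  have "(\<Sum>m=1..M. \<integral>s. (if s \<in> cell m then f s else 0) \<partial>lebesgue_on {0<..<T})
      = (\<integral>s. (\<Sum>m=1..M. if s \<in> cell m then f s else 0) \<partial>lebesgue_on {0<..<T})"
    using int by simp
  also have "\<dots> \<le> integral\<^sup>L (lebesgue_on {0<..<T}) f"
  proof (rule integral_mono_AE)
    show "integrable (lebesgue_on {0<..<T}) (\<lambda>s. \<Sum>m=1..M. if s \<in> cell m then f s else 0)"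
      by (intro Bochner_Integration.integrable_sum int)
    have "(\<Sum>m=1..M. if s \<in> cell m then f s else 0) \<le> f s" if s: "0 < s" "s < T" for s
    proof -
      obtain m where m: "m \<in> {1..M}" "s \<in> cell m" using cell_cover[OF s] by blast
      have "(s \<in> cell n) = (n = m)" if "n \<in> {1..M}" for n
        using cell_disjoint[OF m(1) that m(2)] m(2) by blast
      then have "(\<Sum>n=1..M. if s \<in> cell n then f s else 0) = (\<Sum>n=1..M. if n = m then f s else 0)"
        by (intro sum.cong) simp_all
      then show ?thesis using m(1) by simp
    qed
    then show "AE s in lebesgue_on {0<..<T}. (\<Sum>m=1..M. if s \<in> cell m then f s else 0) \<le> f s"
      by (intro AE_I2) auto
  qed (rule f)
  finally show ?thesis .
qed

end

section \<open>The discrete dual problem\<close>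

locale discrete_dual_problem = fe_space \<Omega> \<T> + time_partition T M t
  for \<Omega> :: "'a::euclidean_space set" and \<T> :: "'a set set" and T M t +
  fixes g :: "real \<Rightarrow> ('a \<Rightarrow> real) \<Rightarrow> real" and z\<^sub>T :: "'a \<Rightarrow> real" and z :: "real \<Rightarrow> 'a \<Rightarrow> real"
  assumes g: "g \<in> L2_time {0<..<T} (Hm1 \<Omega>) (Hm1_nrm \<Omega>)"
    and z\<^sub>T: "z\<^sub>T \<in> L2 \<Omega>"
    and z: "z \<in> P_sigma \<Omega> T \<T> M t"
    and dual: "\<And>v. v \<in> Y_sigma \<Omega> T \<T> M t \<Longrightarrow>
      A_form \<Omega> T v z = (\<integral>s. g s (v s) \<partial>lebesgue_on {0<..<T}) + L2_ip \<Omega> (v T) z\<^sub>T"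
begin

text \<open>
  On the cell \<open>m\<close> the solution is \<open>offset m + s * slope m\<close>; this affine function is also evaluated at
  the end points of the cell.
\<close>

definition coefficients :: "nat \<Rightarrow> ('a \<Rightarrow> real) \<times> ('a \<Rightarrow> real)" where
  "coefficients m = (SOME p. fst p \<in> V \<and> snd p \<in> V \<and>
     (\<forall>s\<in>cell m. z s = (\<lambda>x. fst p x + s *\<^sub>R snd p x)))"

abbreviation "offset m \<equiv> fst (coefficients m)"
abbreviation "slope m \<equiv> snd (coefficients m)"

definition piece :: "nat \<Rightarrow> real \<Rightarrow> 'a \<Rightarrow> real" where
  "piece m s = (\<lambda>x. offset m x + s *\<^sub>R slope m x)"

lemma coefficients:
  assumes m: "m \<in> {1..M}"
  shows offset_V: "offset m \<in> V" and slope_V: "slope m \<in> V"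
    and z_cell: "s \<in> cell m \<Longrightarrow> z s = piece m s"
proof -
  obtain c where c: "\<forall>j\<le>1. c j \<in> V" "\<forall>s\<in>cell m. z s = (\<lambda>x. \<Sum>j\<le>1. s ^ j * c j x)"
    using z m unfolding P_sigma_def poly_in_time_def by blast
  have "(\<lambda>x. \<Sum>j\<le>1. s ^ j * c j x) = (\<lambda>x. c 0 x + s *\<^sub>R c 1 x)" for s :: real
    by (simp add: fun_eq_iff)
  then have "fst (c 0, c 1) \<in> V \<and> snd (c 0, c 1) \<in> V \<and>
     (\<forall>s\<in>cell m. z s = (\<lambda>x. fst (c 0, c 1) x + s *\<^sub>R snd (c 0, c 1) x))"
    using c by simp
  then have "offset m \<in> V \<and> slope m \<in> V \<and> (\<forall>s\<in>cell m. z s = (\<lambda>x. offset m x + s *\<^sub>R slope m x))"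
    unfolding coefficients_def by (rule someI)
  then show "offset m \<in> V" "slope m \<in> V" "s \<in> cell m \<Longrightarrow> z s = piece m s"
    by (simp_all add: piece_def)
qed

lemma piece_V: "m \<in> {1..M} \<Longrightarrow> piece m s \<in> V"
  unfolding piece_def by (rule V_combine[OF offset_V slope_V])

lemma z_H10: "s \<in> {0..T} \<Longrightarrow> z s \<in> H10 \<Omega>"
  using z unfolding P_sigma_def C_time_def by blast

text \<open>
  By Poincare's inequality, functions in \<open>H\<^sub>0\<^sup>1\<close> with the same gradient are the same element of \<open>L\<^sup>2\<close>.
\<close>

lemma
  assumes u: "u \<in> H10 \<Omega>" and v: "v \<in> H10 \<Omega>" and zero: "H10_nrm \<Omega> (\<lambda>x. u x - v x) = 0"
  shows H10_nrm_diff_zero_imp_L2_ip_eq: "w \<in> L2 \<Omega> \<Longrightarrow> L2_ip \<Omega> w u = L2_ip \<Omega> w v"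
    and H10_nrm_diff_zero_imp_L2_nrm_eq: "L2_nrm \<Omega> u = L2_nrm \<Omega> v"
proof -
  note uL = H10_L2[OF u] and vL = H10_L2[OF v]
  have d: "(\<lambda>x. u x - v x) \<in> H10 \<Omega>" by (rule H10.diff_mem[OF u v])
  have "L2_nrm \<Omega> (\<lambda>x. u x - v x) = 0" by (rule H10_nrm_zero_imp_L2_nrm_zero[OF d zero])
  then have null: "L2_ip \<Omega> (\<lambda>x. u x - v x) (\<lambda>x. u x - v x) = 0"
    by (simp add: L2_nrm_def)
  have *: "L2_ip \<Omega> w u = L2_ip \<Omega> w v" if w: "w \<in> L2 \<Omega>" for w :: "'a \<Rightarrow> real"
    using L2.ip_zero_right_of_null[OF w H10_L2[OF d] null] L2.combine_right[OF uL vL w, of "-1"] by simp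
  then show "w \<in> L2 \<Omega> \<Longrightarrow> L2_ip \<Omega> w u = L2_ip \<Omega> w v" .
  show "L2_nrm \<Omega> u = L2_nrm \<Omega> v"
    using *[OF uL] *[OF vL] L2.sym[OF uL vL] by (simp add: L2_nrm_def)
qed

text \<open>
  At a grid point the solution takes the limit of the neighbouring affine pieces, by continuity in
  time. This is an equality in \<open>H\<^sub>0\<^sup>1\<close>, that is almost everywhere, since \<open>z 0\<close> and \<open>z T\<close> need not be
  the finite element representatives.
\<close>

lemma z_grid_point:
  assumes m: "m \<in> {1..M}" and \<tau>: "\<tau> = t (m - 1) \<or> \<tau> = t m"
  shows "H10_nrm \<Omega> (\<lambda>x. z \<tau> x - piece m \<tau> x) = 0"
proof -
  define J where "J = {t (m - 1)<..<t m}"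
  have J: "J \<subseteq> {0..T}" "J \<subseteq> cell m"
    using grid_bounds[OF m] Ioo_subset_cell[of m] by (auto simp: J_def)
  have \<tau>T: "\<tau> \<in> {0..T}" using \<tau> grid_bounds[OF m] grid_step[OF m] by auto
  note \<tau>H = z_H10[OF \<tau>T]
  have "\<tau> islimpt J"
    using \<tau> grid_step[OF m] islimpt_greaterThanLessThan1[of "t (m - 1)" "t m"]
      islimpt_greaterThanLessThan2[of "t (m - 1)" "t m"] unfolding J_def by auto
  then have nontrivial: "at \<tau> within J \<noteq> bot" by (simp add: trivial_limit_within)
  have "((\<lambda>s. H10_nrm \<Omega> (\<lambda>x. z s x - z \<tau> x)) \<longlongrightarrow> 0) (at \<tau> within {0..T})"
    using z \<tau>T unfolding P_sigma_def C_time_def by blast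
  then have lim: "((\<lambda>s. H10_nrm \<Omega> (\<lambda>x. z s x - z \<tau> x)) \<longlongrightarrow> 0) (at \<tau> within J)"
    by (rule tendsto_within_subset[OF _ J(1)])
  have "((\<lambda>s. \<bar>s - \<tau>\<bar> * H10_nrm \<Omega> (slope m)) \<longlongrightarrow> \<bar>\<tau> - \<tau>\<bar> * H10_nrm \<Omega> (slope m)) (at \<tau> within J)"
    by (intro tendsto_intros)
  from tendsto_add[OF lim this]
  have "((\<lambda>s. H10_nrm \<Omega> (\<lambda>x. z s x - z \<tau> x) + \<bar>s - \<tau>\<bar> * H10_nrm \<Omega> (slope m)) \<longlongrightarrow> 0) (at \<tau> within J)"
    by simp
  moreover have "\<forall>\<^sub>F s in at \<tau> within J. H10_nrm \<Omega> (\<lambda>x. z \<tau> x - piece m \<tau> x)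
      \<le> H10_nrm \<Omega> (\<lambda>x. z s x - z \<tau> x) + \<bar>s - \<tau>\<bar> * H10_nrm \<Omega> (slope m)"
    unfolding eventually_at_filter
  proof (rule always_eventually, intro allI impI)
    fix s assume "s \<in> J"
    then have s: "s \<in> cell m" "s \<in> {0..T}" using J by auto
    note sH = z_H10[OF s(2)] and slopeH = V_H10[OF slope_V[OF m]]
    have eq: "(\<lambda>x. z \<tau> x - piece m \<tau> x) = (\<lambda>x. (-1) *\<^sub>R (z s x - z \<tau> x) + (s - \<tau>) *\<^sub>R slope m x)"
      unfolding z_cell[OF m s(1)] by (simp add: piece_def algebra_simps)
    note d = H10.diff_mem[OF sH \<tau>H]
    have "H10_nrm \<Omega> (\<lambda>x. z \<tau> x - piece m \<tau> x)
        \<le> H10_nrm \<Omega> (\<lambda>x. (-1) *\<^sub>R (z s x - z \<tau> x)) + \<bar>s - \<tau>\<bar> * H10_nrm \<Omega> (slope m)"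
      unfolding eq H10_nrm_def L2_nrm_def
      by (rule H10.triangle_combine[OF H10.scale_mem[OF d] slopeH])
    also have "H10_nrm \<Omega> (\<lambda>x. (-1) *\<^sub>R (z s x - z \<tau> x)) = \<bar>-1\<bar> * H10_nrm \<Omega> (\<lambda>x. z s x - z \<tau> x)"
      unfolding H10_nrm_def L2_nrm_def by (rule H10.nrm_scale[OF d])
    finally show "H10_nrm \<Omega> (\<lambda>x. z \<tau> x - piece m \<tau> x)
      \<le> H10_nrm \<Omega> (\<lambda>x. z s x - z \<tau> x) + \<bar>s - \<tau>\<bar> * H10_nrm \<Omega> (slope m)" by simp
  qed
  ultimately have "H10_nrm \<Omega> (\<lambda>x. z \<tau> x - piece m \<tau> x) \<le> 0"
    by (rule tendsto_lowerbound[OF _ _ nontrivial])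
  then show ?thesis by (simp add: H10_nrm_def L2_nrm_nonneg order_antisym)
qed

definition load_sq :: "nat \<Rightarrow> real" where
  "load_sq m = (\<integral>s. (if s \<in> cell m then (Hm1_nrm \<Omega> (g s))\<^sup>2 else 0) \<partial>lebesgue_on {0<..<T})"

lemma g_Hm1: "s \<in> {0<..<T} \<Longrightarrow> g s \<in> Hm1 \<Omega>"
  and g_integrable: "integrable (lebesgue_on {0<..<T}) (\<lambda>s. (Hm1_nrm \<Omega> (g s))\<^sup>2)"
  using g unfolding L2_time_def by blast+

definition pulse :: "nat \<Rightarrow> ('a \<Rightarrow> real) \<Rightarrow> real \<Rightarrow> 'a \<Rightarrow> real" where
  "pulse m w s = (if s \<in> cell m then w else (\<lambda>x. 0))"

definition load :: "nat \<Rightarrow> ('a \<Rightarrow> real) \<Rightarrow> real" where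
  "load m w = (\<integral>s. g s (pulse m w s) \<partial>lebesgue_on {0<..<T})"

text \<open>
  Young's inequality \<open>\<parallel>g\<parallel> \<parallel>\<nabla>w\<parallel> \<le> \<parallel>g\<parallel>\<^sup>2 + \<parallel>\<nabla>w\<parallel>\<^sup>2 / 4\<close>, integrated over the cell. The factor \<open>1 / 4\<close> is small enough
  for the gradient term to be absorbed into the left-hand sides of both energy estimates.
\<close>

lemma load_bound:
  assumes m: "m \<in> {1..M}" and w: "w \<in> H10 \<Omega>"
  shows "\<bar>load m w\<bar> \<le> load_sq m + step m / 4 * dirichlet \<Omega> w w"
proof -
  define r where "r = dirichlet \<Omega> w w / 4"
  define G where "G s = (Hm1_nrm \<Omega> (g s))\<^sup>2" for s
  define B where "B s = (if s \<in> cell m then G s else 0) + (if s \<in> cell m then r else 0)" for s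
  have int: "integrable (lebesgue_on {0<..<T}) (\<lambda>s. if s \<in> cell m then G s else 0)"
    "integrable (lebesgue_on {0<..<T}) (\<lambda>s. if s \<in> cell m then r else 0)"
    unfolding G_def by (rule integrable_indicator_Ioo[OF g_integrable cell_sets]
        integrable_indicator_Ioo[OF integrable_const_Ioo cell_sets])+
  have bound: "\<bar>g s (pulse m w s)\<bar> \<le> B s" if s: "s \<in> {0<..<T}" for s
  proof (cases "s \<in> cell m")
    case True
    have "\<bar>g s w\<bar> \<le> Hm1_nrm \<Omega> (g s) * H10_nrm \<Omega> w" by (rule Hm1_bound[OF g_Hm1[OF s] w])
    also have "\<dots> \<le> (Hm1_nrm \<Omega> (g s))\<^sup>2 + (H10_nrm \<Omega> w)\<^sup>2 / 4"
      using sum_squares_bound[of "Hm1_nrm \<Omega> (g s)" "H10_nrm \<Omega> w / 2"] by (simp add: power_divide)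
    finally show ?thesis using True by (simp add: pulse_def B_def G_def r_def H10_nrm_power2)
  next
    case False
    then show ?thesis using Hm1_zero[OF g_Hm1[OF s]] by (simp add: pulse_def B_def)
  qed
  have "\<bar>load m w\<bar> \<le> (\<integral>s. \<bar>g s (pulse m w s)\<bar> \<partial>lebesgue_on {0<..<T})"
    unfolding load_def by (rule integral_abs_bound)
  also have "\<dots> \<le> integral\<^sup>L (lebesgue_on {0<..<T}) B"
  proof (rule integral_mono_AE')
    show "integrable (lebesgue_on {0<..<T}) B"
      unfolding B_def[abs_def] using int by (intro Bochner_Integration.integrable_add)
    show "AE s in lebesgue_on {0<..<T}. \<bar>g s (pulse m w s)\<bar> \<le> B s"
      using bound by (intro AE_I2) simp
    show "AE s in lebesgue_on {0<..<T}. 0 \<le> B s"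
      using order_trans[OF abs_ge_zero bound] by (intro AE_I2) simp
  qed
  also have "\<dots> = load_sq m + step m * r"
    unfolding B_def[abs_def] load_sq_def G_def using int[unfolded G_def]
    by (simp add: integral_cell_const[OF m])
  finally show ?thesis by (simp add: r_def)
qed

lemma sum_load_sq_le: "(\<Sum>m=1..M. load_sq m) \<le> (L2_time_nrm {0<..<T} (Hm1_nrm \<Omega>) g)\<^sup>2"
  unfolding load_sq_def L2_time_nrm_def using sum_integral_cells_le[OF g_integrable] by simp

lemma load_sq_nonneg: "0 \<le> load_sq m"
  unfolding load_sq_def by (rule Bochner_Integration.integral_nonneg) simp

text \<open>
  The test functions used below take at most one nonzero value on \<open>(0, T)\<close>, so they are their own
  approximation by simple functions.
\<close>

lemma simple_function_L2_time:
  assumes mem: "w \<in> H10 \<Omega>" and A: "A \<in> sets lebesgue"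
    and v: "\<And>s. 0 < s \<Longrightarrow> s < T \<Longrightarrow> v s = (if s \<in> A then w else (\<lambda>x. 0))"
  shows "v \<in> L2_time {0<..<T} (H10 \<Omega>) (H10_nrm \<Omega>)"
proof -
  let ?J = "lebesgue_on {0<..<T}"
  have v_mem: "v s \<in> H10 \<Omega>" if "s \<in> {0<..<T}" for s
    using v[of s] that mem H10.zero_mem by simp
  have "A \<inter> space ?J \<in> sets ?J" using A by (auto simp: sets_restrict_space)
  then have "simple_function ?J (\<lambda>s. if s \<in> A then w else (\<lambda>x. 0))"
    by (intro simple_function_If_set simple_function_const)
  then have simple: "simple_function ?J v"
    using v by (subst simple_function_cong[where g = "\<lambda>s. if s \<in> A then w else (\<lambda>x. 0)"]) auto
  have "strongly_measurable {0<..<T} (H10 \<Omega>) (H10_nrm \<Omega>) v"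
    unfolding strongly_measurable_def
    by (rule exI[of _ "\<lambda>n. v"]) (use simple v_mem in \<open>auto simp: H10_nrm_zero\<close>)
  moreover have "integrable ?J (\<lambda>s. (H10_nrm \<Omega> (v s))\<^sup>2)"
  proof -
    have "integrable ?J (\<lambda>s. if s \<in> A then (H10_nrm \<Omega> w)\<^sup>2 else 0)"
      by (rule integrable_indicator_Ioo[OF integrable_const_Ioo A])
    moreover have "integrable ?J (\<lambda>s. if s \<in> A then (H10_nrm \<Omega> w)\<^sup>2 else 0)
        \<longleftrightarrow> integrable ?J (\<lambda>s. (H10_nrm \<Omega> (v s))\<^sup>2)"
      by (rule Bochner_Integration.integrable_cong) (use v in \<open>auto simp: H10_nrm_zero\<close>)
    ultimately show ?thesis by blast
  qed
  ultimately show ?thesis using v_mem by (simp add: L2_time_def)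
qed

lemma poly_in_time_0: "w \<in> V \<Longrightarrow> (\<And>s. s \<in> J \<Longrightarrow> v s = w) \<Longrightarrow> poly_in_time 0 J V v"
  unfolding poly_in_time_def by (intro exI[of _ "\<lambda>j. w"]) simp

lemma T_not_in_cell: "m \<in> {1..M} \<Longrightarrow> T \<notin> cell m"
  using cell_subset_Ioo[of m] by auto

lemma pulse_Y_sigma:
  assumes m: "m \<in> {1..M}" and w: "w \<in> V"
  shows "pulse m w \<in> Y_sigma \<Omega> T \<T> M t"
  unfolding Y_sigma_def
proof (intro CollectI conjI ballI)
  show "pulse m w \<in> L2_time {0<..<T} (H10 \<Omega>) (H10_nrm \<Omega>)"
    by (rule simple_function_L2_time[OF V_H10[OF w] cell_sets[of m]]) (simp add: pulse_def)
  show "poly_in_time 0 (cell n) V (pulse m w)" if n: "n \<in> {1..M}" for n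
  proof (cases "n = m")
    case True
    show ?thesis by (rule poly_in_time_0[OF w]) (simp add: pulse_def True)
  next
    case False
    show ?thesis
      by (rule poly_in_time_0[OF V_zero]) (use cell_disjoint[OF m n] False in \<open>auto simp: pulse_def\<close>)
  qed
  show "pulse m w T \<in> V" using T_not_in_cell[OF m] V_zero by (simp add: pulse_def)
qed

lemma time_deriv_affine:
  assumes J: "open J" "s \<in> J" and v: "\<And>r. r \<in> J \<Longrightarrow> v r = (\<lambda>x. a x + r *\<^sub>R b x)"
  shows "time_deriv v s = b"
proof
  fix x
  have "((\<lambda>r. a x + r *\<^sub>R b x) has_real_derivative b x) (at s)"
    by (auto intro!: derivative_eq_intros)
  then have "((\<lambda>r. v r x) has_real_derivative b x) (at s)"
    by (rule has_field_derivative_transform_within_open[OF _ J]) (simp add: v)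
  then show "time_deriv v s x = b x" by (simp add: time_deriv_def DERIV_imp_deriv)
qed

definition mid :: "nat \<Rightarrow> 'a \<Rightarrow> real" where
  "mid m = piece m ((t (m - 1) + t m) / 2)"

lemma mid_V: "m \<in> {1..M} \<Longrightarrow> mid m \<in> V"
  unfolding mid_def by (rule piece_V)

text \<open>
  Testing with functions supported on one cell decouples the problem into the backward
  Crank-Nicolson scheme: \<open>slope m\<close> is the difference quotient of the nodal values, and the midpoint
  rule is exact for the affine integrand of the Dirichlet form.
\<close>

lemma crank_nicolson:
  assumes m: "m \<in> {1..M}" and w: "w \<in> V"
  shows "step m * (dirichlet \<Omega> (mid m) w - L2_ip \<Omega> (slope m) w) = load m w"
proof -
  note oV = offset_V[OF m] and sV = slope_V[OF m]
  have 0: "L2_ip \<Omega> u (\<lambda>x. 0) = 0" for u :: "'a \<Rightarrow> real" by (simp add: L2_ip_def)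
  have 1: "(\<integral>s. L2_to_Hm1 \<Omega> (time_deriv z s) (pulse m w s) \<partial>lebesgue_on {0<..<T})
      = step m * (L2_ip \<Omega> (slope m) w + (t (m - 1) + t m) / 2 * 0)"
  proof (rule integral_cell_affine[OF m])
    fix s assume s: "t (m - 1) < s" "s < t m"
    have "time_deriv z s = slope m"
    proof (rule time_deriv_affine[where J = "{t (m - 1)<..<t m}"])
      show "z r = (\<lambda>x. offset m x + r *\<^sub>R slope m x)" if "r \<in> {t (m - 1)<..<t m}" for r
        using z_cell[OF m subsetD[OF Ioo_subset_cell that]] by (simp add: piece_def)
    qed (use s in auto)
    moreover have "s \<in> cell m" using s Ioo_subset_cell[of m] by auto
    ultimately show "L2_to_Hm1 \<Omega> (time_deriv z s) (pulse m w s) = L2_ip \<Omega> (slope m) w + s * 0"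
      by (simp add: L2_to_Hm1_def pulse_def)
  qed (simp add: L2_to_Hm1_def pulse_def 0)
  have aff: "dirichlet \<Omega> w (piece m s) = dirichlet \<Omega> w (offset m) + s * dirichlet \<Omega> w (slope m)" for s
    unfolding piece_def by (rule V.combine_right[OF oV sV w])
  have 2: "(\<integral>s. dirichlet \<Omega> (pulse m w s) (z s) \<partial>lebesgue_on {0<..<T})
      = step m * (dirichlet \<Omega> w (offset m) + (t (m - 1) + t m) / 2 * dirichlet \<Omega> w (slope m))"
  proof (rule integral_cell_affine[OF m])
    fix s assume s: "t (m - 1) < s" "s < t m"
    then have "s \<in> cell m" using Ioo_subset_cell[of m] by auto
    then show "dirichlet \<Omega> (pulse m w s) (z s) = dirichlet \<Omega> w (offset m) + s * dirichlet \<Omega> w (slope m)"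
      using z_cell[OF m] aff by (simp add: pulse_def)
  next
    fix s assume "0 < s" "s < T" "s \<notin> cell m"
    then show "dirichlet \<Omega> (pulse m w s) (z s) = 0"
      using H10.zero_left[OF z_H10[of s]] by (simp add: pulse_def)
  qed
  have 3: "pulse m w T = (\<lambda>x. 0)" using T_not_in_cell[OF m] by (simp add: pulse_def)
  have 4: "L2_ip \<Omega> (\<lambda>x. 0 :: real) u = 0" for u by (simp add: L2_ip_def)
  have "- (step m * L2_ip \<Omega> (slope m) w) + step m * dirichlet \<Omega> w (mid m) = load m w"
    using dual[OF pulse_Y_sigma[OF m w]] aff[of "(t (m - 1) + t m) / 2"]
    unfolding A_form_def 1 2 3 4 load_def mid_def by simp
  then show ?thesis using V.sym[OF w mid_V[OF m]] by (simp add: algebra_simps)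
qed

text \<open>Testing with the independent degree of freedom at \<open>T\<close> shows that \<open>z T\<close> is the
  \<open>L\<^sup>2\<close> projection of \<open>z\<^sub>T\<close>, which cannot increase the norm.\<close>

lemma final_value_bound: "L2_nrm \<Omega> (z T) \<le> L2_nrm \<Omega> z\<^sub>T"
proof -
  have M: "M \<in> {1..M}" using grid_ends by simp
  define q where "q = piece M T"
  have q: "q \<in> V" unfolding q_def by (rule piece_V[OF M])
  define v where "v s = (if s = T then q else (\<lambda>x. 0))" for s
  have v0: "v s = (\<lambda>x. 0)" if "0 < s" "s < T" for s using that by (simp add: v_def)
  have "v \<in> Y_sigma \<Omega> T \<T> M t"
    unfolding Y_sigma_def
  proof (intro CollectI conjI ballI)
    show "v \<in> L2_time {0<..<T} (H10 \<Omega>) (H10_nrm \<Omega>)"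
      by (rule simple_function_L2_time[OF H10.zero_mem, of "{}"]) (simp_all add: v0)
    show "poly_in_time 0 (cell n) V v" if "n \<in> {1..M}" for n
      by (rule poly_in_time_0[OF V_zero]) (use cell_subset_Ioo[OF that] in \<open>auto intro!: v0\<close>)
    show "v T \<in> V" using q by (simp add: v_def)
  qed
  from dual[OF this]
  have eq: "- (\<integral>s. L2_to_Hm1 \<Omega> (time_deriv z s) (v s) \<partial>lebesgue_on {0<..<T})
     + (\<integral>s. dirichlet \<Omega> (v s) (z s) \<partial>lebesgue_on {0<..<T}) + L2_ip \<Omega> q (z T)
     = (\<integral>s. g s (v s) \<partial>lebesgue_on {0<..<T}) + L2_ip \<Omega> q z\<^sub>T"
    by (simp add: A_form_def v_def)
  have "(\<integral>s. L2_to_Hm1 \<Omega> (time_deriv z s) (v s) \<partial>lebesgue_on {0<..<T}) = (\<integral>s. 0 \<partial>lebesgue_on {0<..<T})"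
    by (rule Bochner_Integration.integral_cong) (simp_all add: v0 L2_to_Hm1_def L2_ip_def)
  moreover have "(\<integral>s. dirichlet \<Omega> (v s) (z s) \<partial>lebesgue_on {0<..<T}) = (\<integral>s. 0 \<partial>lebesgue_on {0<..<T})"
    by (rule Bochner_Integration.integral_cong) (simp_all add: v0 H10.zero_left z_H10)
  moreover have "(\<integral>s. g s (v s) \<partial>lebesgue_on {0<..<T}) = (\<integral>s. 0 \<partial>lebesgue_on {0<..<T})"
    by (rule Bochner_Integration.integral_cong) (simp_all add: v0 Hm1_zero g_Hm1)
  ultimately have proj: "L2_ip \<Omega> q (z T) = L2_ip \<Omega> q z\<^sub>T" using eq by simp
  have T: "T \<in> {0..T}" using T_pos by simp
  have "H10_nrm \<Omega> (\<lambda>x. z T x - q x) = 0"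
    using z_grid_point[OF M, of T] grid_ends by (simp add: q_def)
  note same = H10_nrm_diff_zero_imp_L2_ip_eq[OF z_H10[OF T] V_H10[OF q] this V_L2[OF q]]
    H10_nrm_diff_zero_imp_L2_nrm_eq[OF z_H10[OF T] V_H10[OF q] this]
  have "(L2_nrm \<Omega> q)\<^sup>2 = L2_ip \<Omega> q z\<^sub>T" using proj same(1) by (simp add: L2_nrm_power2)
  also have "\<dots> \<le> L2_nrm \<Omega> q * L2_nrm \<Omega> z\<^sub>T"
    using L2.cauchy_schwarz[OF V_L2[OF q] z\<^sub>T] by (simp add: L2_nrm_def)
  finally have "L2_nrm \<Omega> q \<le> L2_nrm \<Omega> z\<^sub>T"
    using L2_nrm_nonneg[of \<Omega> q] L2_nrm_nonneg[of \<Omega> z\<^sub>T]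
    by (cases "L2_nrm \<Omega> q = 0") (auto simp: power2_eq_square)
  then show ?thesis using same(2) by simp
qed

section \<open>Energy estimates\<close>

lemma nodal_norm:
  assumes m: "m \<in> {1..M}" and \<tau>: "\<tau> = t (m - 1) \<or> \<tau> = t m"
  shows "L2_nrm \<Omega> (z \<tau>) = L2_nrm \<Omega> (piece m \<tau>)"
proof -
  have "\<tau> \<in> {0..T}" using \<tau> grid_bounds[OF m] grid_step[OF m] by auto
  then show ?thesis
    using H10_nrm_diff_zero_imp_L2_nrm_eq[OF z_H10 V_H10[OF piece_V[OF m]] z_grid_point[OF m \<tau>]] by blast
qed

text \<open>
  The value \<open>mid m\<close> is the mean of the two nodal values and \<open>slope m\<close> their difference quotient, so
  testing the scheme with \<open>mid m\<close> produces the difference of the squared nodal norms.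
\<close>

lemma energy_step:
  assumes m: "m \<in> {1..M}"
  shows "(L2_nrm \<Omega> (z (t (m - 1))))\<^sup>2 + step m * dirichlet \<Omega> (mid m) (mid m)
    \<le> (L2_nrm \<Omega> (z (t m)))\<^sup>2 + 2 * load_sq m"
proof -
  note mV = mid_V[OF m] and sV = slope_V[OF m]
  define k where "k = step m"
  have ends: "piece m (t m) = (\<lambda>x. mid m x + (k / 2) *\<^sub>R slope m x)"
    "piece m (t (m - 1)) = (\<lambda>x. mid m x + (- k / 2) *\<^sub>R slope m x)"
    unfolding mid_def piece_def k_def step_def by (simp_all add: fun_eq_iff field_simps)
  have "(L2_nrm \<Omega> (z (t m)))\<^sup>2 = L2_ip \<Omega> (mid m) (mid m) + 2 * (k / 2) * L2_ip \<Omega> (mid m) (slope m)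
      + (k / 2)\<^sup>2 * L2_ip \<Omega> (slope m) (slope m)"
    by (subst nodal_norm[OF m disjI2[OF refl]])
       (simp only: ends L2_nrm_power2 V_mass.ip_combine_self[OF mV sV])
  moreover have "(L2_nrm \<Omega> (z (t (m - 1))))\<^sup>2 = L2_ip \<Omega> (mid m) (mid m)
      + 2 * (- k / 2) * L2_ip \<Omega> (mid m) (slope m) + (- k / 2)\<^sup>2 * L2_ip \<Omega> (slope m) (slope m)"
    by (subst nodal_norm[OF m disjI1[OF refl]])
       (simp only: ends L2_nrm_power2 V_mass.ip_combine_self[OF mV sV])
  ultimately have "(L2_nrm \<Omega> (z (t m)))\<^sup>2 - (L2_nrm \<Omega> (z (t (m - 1))))\<^sup>2
      = 2 * k * L2_ip \<Omega> (slope m) (mid m)"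
    using V_mass.sym[OF mV sV] by simp
  moreover have "k * (dirichlet \<Omega> (mid m) (mid m) - L2_ip \<Omega> (slope m) (mid m))
      \<le> load_sq m + k / 4 * dirichlet \<Omega> (mid m) (mid m)"
    using crank_nicolson[OF m mV] load_bound[OF m V_H10[OF mV]] by (simp add: k_def)
  moreover have "0 \<le> k * dirichlet \<Omega> (mid m) (mid m)"
    using step_pos[OF m] V.nonneg[OF mV] by (simp add: k_def)
  ultimately show ?thesis by (simp add: k_def algebra_simps)
qed

lemma energy_estimate:
  assumes "j \<le> M"
  shows "(L2_nrm \<Omega> (z (t j)))\<^sup>2 + (\<Sum>m\<in>{j<..M}. step m * dirichlet \<Omega> (mid m) (mid m))
    \<le> (L2_nrm \<Omega> (z T))\<^sup>2 + 2 * (\<Sum>m\<in>{j<..M}. load_sq m)"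
  using assms
proof (induction j rule: inc_induct)
  case base
  then show ?case using grid_ends by simp
next
  case (step n)
  have "{n<..M} = insert (Suc n) {Suc n<..M}" using step.hyps by auto
  then show ?case using step.IH energy_step[of "Suc n"] step.hyps by simp
qed

lemma
  defines "a \<equiv> L2_nrm \<Omega> z\<^sub>T" and "b \<equiv> L2_time_nrm {0<..<T} (Hm1_nrm \<Omega>) g"
  shows nodal_bound: "j \<le> M \<Longrightarrow> (L2_nrm \<Omega> (z (t j)))\<^sup>2 \<le> a\<^sup>2 + 2 * b\<^sup>2"
    and dissipation_bound: "(\<Sum>m=1..M. step m * dirichlet \<Omega> (mid m) (mid m)) \<le> a\<^sup>2 + 2 * b\<^sup>2"
proof -
  have final: "(L2_nrm \<Omega> (z T))\<^sup>2 \<le> a\<^sup>2"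
    unfolding a_def by (rule power_mono[OF final_value_bound L2_nrm_nonneg])
  have diss: "0 \<le> step m * dirichlet \<Omega> (mid m) (mid m)" if "m \<in> {1..M}" for m
    using step_pos[OF that] V.nonneg[OF mid_V[OF that]] by simp
  have *: "(L2_nrm \<Omega> (z (t j)))\<^sup>2 + (\<Sum>m\<in>{j<..M}. step m * dirichlet \<Omega> (mid m) (mid m)) \<le> a\<^sup>2 + 2 * b\<^sup>2"
    if j: "j \<le> M" for j
  proof -
    have "(\<Sum>m\<in>{j<..M}. load_sq m) \<le> (\<Sum>m=1..M. load_sq m)"
      by (rule sum_mono2) (use load_sq_nonneg in auto)
    then show ?thesis using energy_estimate[OF j] final sum_load_sq_le unfolding b_def by linarith
  qed
  show "(L2_nrm \<Omega> (z (t j)))\<^sup>2 \<le> a\<^sup>2 + 2 * b\<^sup>2" if "j \<le> M"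
  proof -
    have "0 \<le> (\<Sum>m\<in>{j<..M}. step m * dirichlet \<Omega> (mid m) (mid m))"
      by (rule sum_nonneg) (use diss in auto)
    then show ?thesis using *[OF that] by linarith
  qed
  have cells: "{0<..M} = {1..M}" by auto
  show "(\<Sum>m=1..M. step m * dirichlet \<Omega> (mid m) (mid m)) \<le> a\<^sup>2 + 2 * b\<^sup>2"
    using *[OF le0, unfolded cells] zero_le_power2[of "L2_nrm \<Omega> (z (t 0))"] by linarith
qed

text \<open>Inside a cell, the solution is a convex combination of its two nodal values.\<close>

lemma maximum_norm_bound:
  assumes B: "\<And>j. j \<le> M \<Longrightarrow> L2_nrm \<Omega> (z (t j)) \<le> B"
  shows "C_time_nrm {0..T} (L2_nrm \<Omega>) z \<le> B"
  unfolding C_time_nrm_def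
proof (rule cSUP_least)
  show "{0..T} \<noteq> {}" using T_pos by simp
  fix s assume s: "s \<in> {0..T}"
  consider "s = 0" | "s = T" | "0 < s" "s < T" using s by fastforce
  then show "L2_nrm \<Omega> (z s) \<le> B"
  proof cases
    case 1
    then show ?thesis using B[of 0] grid_ends by simp
  next
    case 2
    then show ?thesis using B[of M] grid_ends by simp
  next
    case 3
    obtain m where m: "m \<in> {1..M}" "s \<in> cell m" using cell_cover[OF 3] .
    define \<theta> where "\<theta> = (s - t (m - 1)) / step m"
    have k: "0 < step m" by (rule step_pos[OF m(1)])
    have \<theta>: "0 \<le> \<theta>" "\<theta> \<le> 1"
      using m(2) cell_subset[of m] k by (auto simp: \<theta>_def step_def field_simps)
    have s_eq: "s = t (m - 1) + \<theta> * step m" using k by (simp add: \<theta>_def)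
    have "piece m (t (m - 1) + \<theta> * step m)
        = (\<lambda>x. (1 - \<theta>) *\<^sub>R piece m (t (m - 1)) x + \<theta> *\<^sub>R piece m (t m) x)"
      unfolding piece_def step_def by (simp add: fun_eq_iff algebra_simps)
    then have zs: "z s = (\<lambda>x. (1 - \<theta>) *\<^sub>R piece m (t (m - 1)) x + \<theta> *\<^sub>R piece m (t m) x)"
      using z_cell[OF m] s_eq by metis
    have "L2_nrm \<Omega> (z s) \<le> L2_nrm \<Omega> (\<lambda>x. (1 - \<theta>) *\<^sub>R piece m (t (m - 1)) x)
        + \<bar>\<theta>\<bar> * L2_nrm \<Omega> (piece m (t m))"
      unfolding zs L2_nrm_def
      by (rule V_mass.triangle_combine[OF V.scale_mem[OF piece_V[OF m(1)]] piece_V[OF m(1)]])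
    also have "L2_nrm \<Omega> (\<lambda>x. (1 - \<theta>) *\<^sub>R piece m (t (m - 1)) x) = \<bar>1 - \<theta>\<bar> * L2_nrm \<Omega> (piece m (t (m - 1)))"
      unfolding L2_nrm_def by (rule V_mass.nrm_scale[OF piece_V[OF m(1)]])
    also have "\<bar>1 - \<theta>\<bar> * L2_nrm \<Omega> (piece m (t (m - 1))) + \<bar>\<theta>\<bar> * L2_nrm \<Omega> (piece m (t m))
        \<le> \<bar>1 - \<theta>\<bar> * B + \<bar>\<theta>\<bar> * B"
      using B[of "m - 1"] B[of m] m(1) nodal_norm[OF m(1), of "t (m - 1)"] nodal_norm[OF m(1), of "t m"]
      by (intro add_mono mult_left_mono) auto
    also have "\<dots> = B" using \<theta> by (simp add: algebra_simps)
    finally show ?thesis .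
  qed
qed

text \<open>
  On the cell \<open>m\<close> the time derivative of \<open>(-\<Delta>\<^sub>h)\<^sup>-\<^sup>1 z\<close> is \<open>y = (-\<Delta>\<^sub>h)\<^sup>-\<^sup>1 (slope m)\<close>. Testing the scheme with
  \<open>y\<close> turns the mass term into \<open>\<parallel>\<nabla>y\<parallel>\<^sup>2\<close>, which is thus bounded by the dissipation and the load.
\<close>

definition slope_potential :: "nat \<Rightarrow> 'a \<Rightarrow> real" where
  "slope_potential m = inv_neg_laplace_h \<Omega> \<T> (slope m)"

lemma slope_potential_bound:
  assumes m: "m \<in> {1..M}"
  shows "step m * (H10_nrm \<Omega> (slope_potential m))\<^sup>2
    \<le> 2 * (step m * dirichlet \<Omega> (mid m) (mid m)) + 2 * load_sq m"
proof -
  define y where "y = slope_potential m"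
  note sV = slope_V[OF m] and mV = mid_V[OF m]
  have y: "y \<in> V" "dirichlet \<Omega> y y = L2_ip \<Omega> (slope m) y"
    using inv_neg_laplace_h_mem[OF sV] inv_neg_laplace_h_dirichlet[OF sV]
    by (simp_all add: y_def slope_potential_def)
  \<comment> \<open>\<open>\<parallel>\<nabla>(\<mu> - y / 2)\<parallel>\<^sup>2 \<ge> 0\<close> for the midpoint value \<open>\<mu>\<close>, the form of Young's inequality that leaves half of \<open>\<parallel>\<nabla>y\<parallel>\<^sup>2\<close>
    on the left-hand side after the load has taken another quarter\<close>
  have "0 \<le> dirichlet \<Omega> (mid m) (mid m) - dirichlet \<Omega> (mid m) y + dirichlet \<Omega> y y / 4"
    using V.nonneg[OF V.combine_mem[OF mV y(1), of "- 1 / 2"]]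
    unfolding V.ip_combine_self[OF mV y(1)] by (simp add: power2_eq_square)
  then have "step m * dirichlet \<Omega> (mid m) y
      \<le> step m * (dirichlet \<Omega> (mid m) (mid m) + dirichlet \<Omega> y y / 4)"
    using step_pos[OF m] by (intro mult_left_mono) auto
  moreover have "step m * dirichlet \<Omega> y y \<le> step m * dirichlet \<Omega> (mid m) y + load_sq m + step m / 4 * dirichlet \<Omega> y y"
    using crank_nicolson[OF m y(1)] load_bound[OF m V_H10[OF y(1)]] y(2)
    by (simp add: algebra_simps)
  ultimately show ?thesis unfolding H10_nrm_power2 y_def by (simp add: algebra_simps)
qed

lemma time_deriv_inv_laplace:
  assumes m: "m \<in> {1..M}" and s: "t (m - 1) < s" "s < t m"
  shows "time_deriv (\<lambda>r. inv_neg_laplace_h \<Omega> \<T> (z r)) s = slope_potential m"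
  unfolding slope_potential_def
proof (rule time_deriv_affine[where J = "{t (m - 1)<..<t m}"])
  show "inv_neg_laplace_h \<Omega> \<T> (z r) = (\<lambda>x. inv_neg_laplace_h \<Omega> \<T> (offset m) x
      + r *\<^sub>R inv_neg_laplace_h \<Omega> \<T> (slope m) x)" if "r \<in> {t (m - 1)<..<t m}" for r
    unfolding z_cell[OF m subsetD[OF Ioo_subset_cell that]] piece_def
    by (rule inv_neg_laplace_h_combine[OF offset_V[OF m] slope_V[OF m]])
qed (use s in auto)

text \<open>
  Twice the dissipation bound \<open>a\<^sup>2 + 2 b\<^sup>2\<close> and twice the total load \<open>b\<^sup>2\<close> add up to the right-hand side.
\<close>

lemma time_deriv_bound:
  defines "a \<equiv> L2_nrm \<Omega> z\<^sub>T" and "b \<equiv> L2_time_nrm {0<..<T} (Hm1_nrm \<Omega>) g"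
  shows "(L2_time_nrm {0<..<T} (L2_nrm \<Omega>)
      (\<lambda>s. grad \<Omega> (time_deriv (\<lambda>r. inv_neg_laplace_h \<Omega> \<T> (z r)) s)))\<^sup>2 \<le> 2 * a\<^sup>2 + 6 * b\<^sup>2"
    (is "?N\<^sup>2 \<le> _")
proof -
  have "?N\<^sup>2 = (\<integral>s. (L2_nrm \<Omega> (grad \<Omega> (time_deriv (\<lambda>r. inv_neg_laplace_h \<Omega> \<T> (z r)) s)))\<^sup>2 \<partial>lebesgue_on {0<..<T})"
    unfolding L2_time_nrm_def by (intro real_sqrt_pow2 Bochner_Integration.integral_nonneg) simp
  also have "\<dots> \<le> (\<Sum>m=1..M. step m * (H10_nrm \<Omega> (slope_potential m))\<^sup>2)"
    by (rule integral_le_sum_cells) (simp_all add: time_deriv_inv_laplace H10_nrm_def)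
  also have "\<dots> \<le> (\<Sum>m=1..M. 2 * (step m * dirichlet \<Omega> (mid m) (mid m)) + 2 * load_sq m)"
    by (intro sum_mono slope_potential_bound)
  also have "\<dots> = 2 * (\<Sum>m=1..M. step m * dirichlet \<Omega> (mid m) (mid m)) + 2 * (\<Sum>m=1..M. load_sq m)"
    by (simp add: sum.distrib sum_distrib_left)
  also have "\<dots> \<le> 2 * a\<^sup>2 + 6 * b\<^sup>2"
    using dissipation_bound sum_load_sq_le unfolding a_def b_def by linarith
  finally show ?thesis .
qed

text \<open>
  The constant is \<open>5 = 3 + 2\<close>, from \<open>2 a\<^sup>2 + 6 b\<^sup>2 \<le> (3 (b + a))\<^sup>2\<close> for the time derivative and
  \<open>a\<^sup>2 + 2 b\<^sup>2 \<le> (2 (b + a))\<^sup>2\<close> for the maximum norm.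
\<close>

theorem stability:
  "L2_time_nrm {0<..<T} (L2_nrm \<Omega>)
      (\<lambda>s. grad \<Omega> (time_deriv (\<lambda>r. inv_neg_laplace_h \<Omega> \<T> (z r)) s))
    + C_time_nrm {0..T} (L2_nrm \<Omega>) z
    \<le> 5 * (L2_time_nrm {0<..<T} (Hm1_nrm \<Omega>) g + L2_nrm \<Omega> z\<^sub>T)"
proof -
  define a where "a = L2_nrm \<Omega> z\<^sub>T"
  define b where "b = L2_time_nrm {0<..<T} (Hm1_nrm \<Omega>) g"
  have ab: "0 \<le> a" "0 \<le> b"
    by (simp_all add: a_def b_def L2_nrm_nonneg L2_time_nrm_def)
  have squares: "0 \<le> a\<^sup>2" "0 \<le> b\<^sup>2" "0 \<le> a * b" using ab by simp_all
  have "(3 * (b + a))\<^sup>2 = 9 * a\<^sup>2 + 18 * (a * b) + 9 * b\<^sup>2" by algebra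
  then have "2 * a\<^sup>2 + 6 * b\<^sup>2 \<le> (3 * (b + a))\<^sup>2" using squares by linarith
  then have "L2_time_nrm {0<..<T} (L2_nrm \<Omega>)
      (\<lambda>s. grad \<Omega> (time_deriv (\<lambda>r. inv_neg_laplace_h \<Omega> \<T> (z r)) s)) \<le> 3 * (b + a)"
    using ab by (intro power2_le_imp_le[OF order_trans[OF time_deriv_bound[folded a_def b_def]]]) simp_all
  moreover have "C_time_nrm {0..T} (L2_nrm \<Omega>) z \<le> 2 * (b + a)"
  proof (rule maximum_norm_bound)
    fix j assume j: "j \<le> M"
    have "(2 * (b + a))\<^sup>2 = 4 * a\<^sup>2 + 8 * (a * b) + 4 * b\<^sup>2" by algebra
    then have "a\<^sup>2 + 2 * b\<^sup>2 \<le> (2 * (b + a))\<^sup>2" using squares by linarith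
    then show "L2_nrm \<Omega> (z (t j)) \<le> 2 * (b + a)"
      using ab
      by (intro power2_le_imp_le[OF order_trans[OF nodal_bound[OF j, folded a_def b_def]]]) simp_all
  qed
  ultimately show ?thesis unfolding a_def b_def by simp
qed

end

section \<open>Stability of the dual problem on a family of meshes\<close>

lemma fe_spaceI:
  assumes "convex_polyhedral_domain \<Omega>" "mesh_family \<Omega> H \<T>" "h \<in> H"
  shows "fe_space \<Omega> (\<T> h)"
proof
  show "open \<Omega>" "convex \<Omega>" using assms(1) by (simp_all add: convex_polyhedral_domain_def)
  have "bounded (closure \<Omega>)"
    using assms(1) by (simp add: convex_polyhedral_domain_def polytope_imp_bounded)
  then show "bounded \<Omega>" using bounded_subset closure_subset by blast
  show "triangulation_of \<Omega> (\<T> h)" using assms(2,3) by (simp add: mesh_family_def)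
qed

theorem lemma5p3:
  fixes \<Omega> :: "'a::euclidean_space set"
    and T :: real
    and H :: "real set"
    and \<T> :: "real \<Rightarrow> 'a set set"
  assumes "DIM('a) = 2 \<or> DIM('a) = 3"
    and "convex_polyhedral_domain \<Omega>"
    and "0 < T"
    and "mesh_family \<Omega> H \<T>"
    and "shape_regular H \<T>"
    and "quasi_uniform H \<T>"
  shows "\<exists>C>0. \<forall>h\<in>H. \<forall>M t. time_grid T M t \<longrightarrow>
    (\<forall>g\<in>L2_time {0<..<T} (Hm1 \<Omega>) (Hm1_nrm \<Omega>). \<forall>z_T\<in>(L2 \<Omega> :: ('a \<Rightarrow> real) set).
      \<forall>z\<in>P_sigma \<Omega> T (\<T> h) M t.
        (\<forall>v\<in>Y_sigma \<Omega> T (\<T> h) M t.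
           A_form \<Omega> T v z
             = (\<integral>s. g s (v s) \<partial>lebesgue_on {0<..<T}) + L2_ip \<Omega> (v T) z_T) \<longrightarrow>
        L2_time_nrm {0<..<T} (L2_nrm \<Omega>)
            (\<lambda>s. grad \<Omega> (time_deriv (\<lambda>r. inv_neg_laplace_h \<Omega> (\<T> h) (z r)) s))
          + C_time_nrm {0..T} (L2_nrm \<Omega>) z
        \<le> C * (L2_time_nrm {0<..<T} (Hm1_nrm \<Omega>) g + L2_nrm \<Omega> z_T))"
proof (intro exI[of _ 5] conjI ballI allI impI)
  fix h M t g z z_T
  assume h: "h \<in> H" and "time_grid T M t"
    and "g \<in> L2_time {0<..<T} (Hm1 \<Omega>) (Hm1_nrm \<Omega>)" and "z_T \<in> (L2 \<Omega> :: ('a \<Rightarrow> real) set)"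
    and "z \<in> P_sigma \<Omega> T (\<T> h) M t"
    and "\<forall>v\<in>Y_sigma \<Omega> T (\<T> h) M t. A_form \<Omega> T v z
             = (\<integral>s. g s (v s) \<partial>lebesgue_on {0<..<T}) + L2_ip \<Omega> (v T) z_T"
  then interpret discrete_dual_problem \<Omega> "\<T> h" T M t g z_T z
    using \<open>0 < T\<close> fe_spaceI[OF assms(2,4) h]
    by (intro discrete_dual_problem.intro discrete_dual_problem_axioms.intro time_partition.intro) blast+
  show "L2_time_nrm {0<..<T} (L2_nrm \<Omega>)
            (\<lambda>s. grad \<Omega> (time_deriv (\<lambda>r. inv_neg_laplace_h \<Omega> (\<T> h) (z r)) s))
          + C_time_nrm {0..T} (L2_nrm \<Omega>) z
        \<le> 5 * (L2_time_nrm {0<..<T} (Hm1_nrm \<Omega>) g + L2_nrm \<Omega> z_T)"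
    by (rule stability)
qed simp

end
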